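(* Let $q>0$, let $\mathbf{F}\in\mathcal{D}_q'$ be a distribution on $\mathbb{C}$, and put $F=e^{|z|^2}\mathbf{F}$. Suppose that the infinite matrices $\mathfrak{P}(F)$ and $\mathfrak{K}(F)$ (the latter for every sequence of points $z_j\in\mathbb{C}$) have finite rank, not greater than $N$. Then $F$ is a finite linear combination of $\delta$-distributions at no more than $N$ points and their derivatives: $$\mathbf{F}=\sum_{j=1}^{N_0}\mathcal{L}_j\delta_{z_j},$$ where $N_0\le N$, $z_j\in\mathbb{C}$, and $\mathcal{L}_j$ are differential operators.
   Context: For $q>0$, $\mathcal{D}_q$ is the space of functions $\psi\in C^\infty(\mathbb{C})$ such that, for every multi-index $\alpha$, $|D^\alpha\psi(z)|=o(e^{q|z|^2})$ as $|z|\to\infty$ (derivatives in the two real coordinates), with the locally convex topology defined by the seminorms $\sup_z|D^\alpha\psi(z)|e^{-q|z|^2}$; $\mathcal{D}_q'$ is its dual, and $\langle\cdot,\cdot\rangle$ is the (bilinear) action of a distribution on a function. Let $\omega(z)=\pi^{-1}e^{-|z|^2}$. For a distribution $F$ on $\mathbb{C}$ with $\omega F\in\mathcal{D}_q'$ for some $q>0$, the Toeplitz sesquilinear form with symbol $F$ is $\mathbf{t}_F(u,v)=\langle\omega F,u\bar v\rangle$; it is defined in particular for analytic polynomials and for the reproducing kernels $\kappa_z(w)=e^{w\bar z}$ of the Fock space. The infinite matrix $\mathfrak{P}(F)$ has entries $\mathbf{t}_F(w^k,w^{k'})=\langle\omega F,w^k\bar w^{k'}\rangle$, $k,k'\ge0$;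 for a sequence of points $z_j\in\mathbb{C}$ the infinite matrix $\mathfrak{K}(F)$ has entries $\mathbf{t}_F(\kappa_{z_k},\kappa_{z_{k'}})$. *)

theory Defs
  imports "HOL-Analysis.Analysis" "HOL-Library.Landau_Symbols" "HOL-Library.Function_Algebras"
begin

section \<open>Smooth functions on the plane\<close>

text \<open>All derivatives are taken in the two real coordinates of $z = x + iy$; no holomorphy is
  involved.\<close>

definition dx :: "(complex \<Rightarrow> complex) \<Rightarrow> complex \<Rightarrow> complex" where
  "dx f z = frechet_derivative f (at z) 1"

definition dy :: "(complex \<Rightarrow> complex) \<Rightarrow> complex \<Rightarrow> complex" where
  "dy f z = frechet_derivative f (at z) \<i>"

definition D :: "nat \<times> nat \<Rightarrow> (complex \<Rightarrow> complex) \<Rightarrow> complex \<Rightarrow> complex" where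
  "D \<alpha> f = (dx ^^ fst \<alpha>) ((dy ^^ snd \<alpha>) f)"

definition mi_order :: "nat \<times> nat \<Rightarrow> nat" where
  "mi_order \<alpha> = fst \<alpha> + snd \<alpha>"

primrec C_k :: "nat \<Rightarrow> (complex \<Rightarrow> complex) \<Rightarrow> bool" where
  "C_k 0 f \<longleftrightarrow> continuous_on UNIV f"
| "C_k (Suc k) f \<longleftrightarrow> (\<forall>z. f differentiable (at z)) \<and> C_k k (dx f) \<and> C_k k (dy f)"

definition smooth :: "(complex \<Rightarrow> complex) \<Rightarrow> bool" where
  "smooth f \<longleftrightarrow> (\<forall>k. C_k k f)"

definition test_functions :: "(complex \<Rightarrow> complex) set" where
  "test_functions = {\<phi>. smooth \<phi> \<and> compact (closure {z. \<phi> z \<noteq> 0})}"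


section \<open>The space of functions of Gaussian growth and its dual\<close>

definition Dq :: "real \<Rightarrow> (complex \<Rightarrow> complex) set" where
  "Dq q = {\<psi>. smooth \<psi> \<and>
     (\<forall>\<alpha>. (\<lambda>z. norm (D \<alpha> \<psi> z)) \<in> o[at_infinity](\<lambda>z. exp (q * (norm z)\<^sup>2)))}"

definition Dq_seminorm :: "real \<Rightarrow> nat \<times> nat \<Rightarrow> (complex \<Rightarrow> complex) \<Rightarrow> real" where
  "Dq_seminorm q \<alpha> \<psi> = (SUP z. norm (D \<alpha> \<psi> z) * exp (- q * (norm z)\<^sup>2))"

text \<open>The locally convex topology of the seminorms: the open seminorm balls form a subbasis.
  Its carrier is \<^term>\<open>Dq q\<close>.\<close>

definition Dq_topology :: "real \<Rightarrow> (complex \<Rightarrow> complex) topology" where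
  "Dq_topology q = topology_generated_by
     {{\<phi> \<in> Dq q. Dq_seminorm q \<alpha> (\<lambda>z. \<phi> z - \<psi> z) < \<epsilon>} | \<alpha> \<psi> \<epsilon>. \<psi> \<in> Dq q \<and> 0 < \<epsilon>}"

text \<open>Distributions are represented by total HOL functions; an element of the dual is only
  constrained by, and only meaningful on, arguments in \<^term>\<open>Dq q\<close>.\<close>

type_synonym dist = "(complex \<Rightarrow> complex) \<Rightarrow> complex"

definition Dq_dual :: "real \<Rightarrow> dist set" where
  "Dq_dual q = {G.
     (\<forall>\<phi>\<in>Dq q. \<forall>\<psi>\<in>Dq q. G (\<lambda>z. \<phi> z + \<psi> z) = G \<phi> + G \<psi>) \<and>
     (\<forall>c. \<forall>\<psi>\<in>Dq q. G (\<lambda>z. c * \<psi> z) = c * G \<psi>) \<and>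
     continuous_map (Dq_topology q) euclidean G}"


section \<open>Operations on distributions\<close>

definition dist_mult :: "(complex \<Rightarrow> complex) \<Rightarrow> dist \<Rightarrow> dist" where
  "dist_mult g G = (\<lambda>\<psi>. G (\<lambda>z. g z * \<psi> z))"

definition dirac :: "complex \<Rightarrow> dist" where
  "dirac z = (\<lambda>\<psi>. \<psi> z)"

definition dist_deriv :: "nat \<times> nat \<Rightarrow> dist \<Rightarrow> dist" where
  "dist_deriv \<alpha> G = (\<lambda>\<psi>. (- 1) ^ mi_order \<alpha> * G (D \<alpha> \<psi>))"

text \<open>Constant coefficients: applied to a delta distribution, an operator with smooth
  coefficients gives nothing more.\<close>

definition differential_operator :: "(dist \<Rightarrow> dist) \<Rightarrow> bool" where
  "differential_operator L \<longleftrightarrow>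
     (\<exists>(m::nat) (c :: nat \<times> nat \<Rightarrow> complex).
        L = (\<lambda>G \<psi>. \<Sum>\<alpha> | mi_order \<alpha> \<le> m. c \<alpha> * dist_deriv \<alpha> G \<psi>))"


section \<open>Toeplitz forms and their matrices\<close>

definition gauss :: "complex \<Rightarrow> complex" where
  "gauss z = of_real (exp (- (norm z)\<^sup>2) / pi)"

definition toeplitz_form :: "dist \<Rightarrow> (complex \<Rightarrow> complex) \<Rightarrow> (complex \<Rightarrow> complex) \<Rightarrow> complex" where
  "toeplitz_form F u v = dist_mult gauss F (\<lambda>w. u w * cnj (v w))"

definition fock_kernel :: "complex \<Rightarrow> complex \<Rightarrow> complex" where
  "fock_kernel z w = exp (w * cnj z)"

definition P_matrix :: "dist \<Rightarrow> nat \<Rightarrow> nat \<Rightarrow> complex" where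
  "P_matrix F k k' = toeplitz_form F (\<lambda>w. w ^ k) (\<lambda>w. w ^ k')"

definition K_matrix :: "dist \<Rightarrow> (nat \<Rightarrow> complex) \<Rightarrow> nat \<Rightarrow> nat \<Rightarrow> complex" where
  "K_matrix F z k k' = toeplitz_form F (fock_kernel (z k)) (fock_kernel (z k'))"


section \<open>Rank of an infinite matrix\<close>

definition seq_scale :: "complex \<Rightarrow> (nat \<Rightarrow> complex) \<Rightarrow> nat \<Rightarrow> complex" where
  "seq_scale c x = (\<lambda>i. c * x i)"

lemma vector_space_seq_scale: "vector_space seq_scale"
  by unfold_locales (auto simp: seq_scale_def algebra_simps fun_eq_iff)

text \<open>The rank is the dimension of the row space. Finiteness has to be required separately,
  since \<^const>\<open>vector_space.dim\<close> is 0 on infinite-dimensional spaces.\<close>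

definition finite_rank :: "(nat \<Rightarrow> nat \<Rightarrow> complex) \<Rightarrow> bool" where
  "finite_rank A \<longleftrightarrow> (\<exists>B. finite B \<and> range A \<subseteq> module.span seq_scale B)"

definition matrix_rank :: "(nat \<Rightarrow> nat \<Rightarrow> complex) \<Rightarrow> nat" where
  "matrix_rank A = vector_space.dim seq_scale (range A)"

end

theory Submission
  imports Defs "HOL-Complex_Analysis.Complex_Analysis" "Jordan_Normal_Form.Determinant"
begin

text \<open>Write $G$ for the functional \<open>bF\<close> and $\Phi(s,t) = G(e^{sw + t\bar w})$, the
  Fourier-Laplace transform of $G$, which is entire in both variables. The factor $e^{|z|^2}$ in
  $F$ cancels the Gaussian in the Toeplitz form, so the kernel matrices consist of values of
  $\Phi/\pi$. One sequence of points can list the row and the column arguments of any minor;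
  finite rank for all sequences therefore makes every minor of $\Phi$ of order $N+1$ vanish
  (\<open>minors_vanish\<close>).

  The vanishing minors yield a polynomial that annihilates $G$. Let $r$ be the largest order of
  a nonzero minor $\Delta(a;b)$. Then $\Phi$ factors through $r$ of its rows
  (\<open>kernel_factorization\<close>), whence $\Delta(x;y)\Delta(a;b) =
  \Delta(x;b)\Delta(a;y)$. On the line $t = -\bar s$ the exponentials are bounded characters, so
  continuity of $G$ gives a polynomial bound there. By the product formula the entire function
  $\Delta(x+s;b)\,\overline{\Delta(a;b-\bar s)}$ of $s$ has polynomial growth; by Liouville it
  is a polynomial, of a degree that does not depend on $x$. Lagrange interpolation in $s$ then
  places all functions $x \mapsto \Phi(x+s,t)$ with small $s$ in one space of finite dimension
  (\<open>shifts_finite_dimensional\<close>). Derivatives in $x$ are moments of $G$, and with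
  more powers of $w$ than dimensions one finds a polynomial $p \neq 0$ for which $pG$ kills
  every exponential (\<open>annihilating_polynomial\<close>).

  A continuous functional $H$ that kills the exponentials is zero on test functions. For a
  periodic $f$ the grid averages of $u \mapsto H(f(\cdot-u))$ against characters tend to $0$,
  because averages of translates of $f$ converge to constants together with all derivatives. The
  same holds against powers of a trigonometric polynomial which concentrate at the lattice
  points, and this forces $H(f) = 0$ (\<open>zero_on_periodic\<close>). A test function differs
  from its periodization only far away, where the Gaussian weight makes the difference
  negligible (\<open>zero_on_compactly_supported\<close>).

  Hence $pG = 0$, so $G$ lives on the finitely many roots of $p$. Being of finite order $m$, the
  part of $G$ at a root kills functions that vanish there to order $m+1$
  (\<open>finite_support_decomposition\<close>); by Taylor's formula it is a combination of
  derivatives of the delta distribution (\<open>jet_representation\<close>). The little-o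
  condition in the definition of \<^term>\<open>Dq q\<close> makes compactly supported functions
  dense, which extends the formula to all of it (\<open>dual_decomposition_extends\<close>).

  The number of points is bounded by the rank of the matrix of monomials. For each point $l$ at
  which $G$ has a nonzero part there are polynomials $u_l$, $v_l$ that vanish to high order at
  the other points and satisfy $G(u_l\overline{v_l}) \neq 0$. The pairings
  $G(u_l\overline{v_{l'}})$ form a diagonal matrix without zeros on the diagonal, and its rank
  is at most that of the matrix of monomials (\<open>number_of_points_le_rank\<close>).\<close>

section \<open>Smooth functions\<close>

definition dir_deriv :: "complex \<Rightarrow> (complex \<Rightarrow> complex) \<Rightarrow> complex \<Rightarrow> complex" where
  "dir_deriv v f z = frechet_derivative f (at z) v"

lemma dx_dir_deriv: "dx = dir_deriv 1" and dy_dir_deriv: "dy = dir_deriv \<i>"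
  by (auto simp: fun_eq_iff dir_deriv_def dx_def dy_def)

lemma dir_deriv_eq: "(f has_derivative f') (at z) \<Longrightarrow> dir_deriv v f z = f' v"
  unfolding dir_deriv_def by (metis frechet_derivative_at)

lemma has_derivative_dir_deriv: "f differentiable at z \<Longrightarrow> (f has_derivative (\<lambda>v. dir_deriv v f z)) (at z)"
  unfolding dir_deriv_def using frechet_derivative_works[of f "at z"] by simp

lemma dir_deriv_decomp:
  assumes "f differentiable at z"
  shows "dir_deriv v f z = of_real (Re v) * dx f z + of_real (Im v) * dy f z"
proof -
  interpret linear "\<lambda>v. dir_deriv v f z"
    using has_derivative_dir_deriv[OF assms] has_derivative_linear by blast
  have "dir_deriv (Re v *\<^sub>R 1 + Im v *\<^sub>R \<i>) f z = Re v *\<^sub>R dir_deriv 1 f z + Im v *\<^sub>R dir_deriv \<i> f z"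
    by (simp only: add scale)
  moreover have "Re v *\<^sub>R 1 + Im v *\<^sub>R \<i> = v"
    by (simp add: complex_eq_iff)
  ultimately show ?thesis
    by (simp add: dx_dir_deriv dy_dir_deriv scaleR_conv_of_real)
qed

lemma dir_deriv_const [simp]: "dir_deriv v (\<lambda>z. c) = (\<lambda>z. 0)"
  by (simp add: dir_deriv_def fun_eq_iff)

lemma dir_deriv_add:
  "f differentiable at z \<Longrightarrow> g differentiable at z \<Longrightarrow> dir_deriv v (\<lambda>z. f z + g z) z = dir_deriv v f z + dir_deriv v g z"
  by (rule dir_deriv_eq[THEN trans]) (auto intro!: derivative_eq_intros has_derivative_dir_deriv)

lemma dir_deriv_mult:
  "f differentiable at z \<Longrightarrow> g differentiable at z \<Longrightarrow>
     dir_deriv v (\<lambda>z. f z * g z) z = dir_deriv v f z * g z + f z * dir_deriv v g z"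
  by (rule dir_deriv_eq[THEN trans]) (auto intro!: derivative_eq_intros has_derivative_dir_deriv simp: algebra_simps)

lemma dir_deriv_cnj: "f differentiable at z \<Longrightarrow> dir_deriv v (\<lambda>z. cnj (f z)) z = cnj (dir_deriv v f z)"
  by (rule dir_deriv_eq[THEN trans]) (auto intro!: derivative_eq_intros has_derivative_dir_deriv)

lemma dir_deriv_affine:
  assumes "\<And>z. f differentiable at z"
  shows "dir_deriv v (\<lambda>z. f (of_real c * (z - u))) = (\<lambda>z. of_real c * dir_deriv v f (of_real c * (z - u)))"
proof
  fix z
  have "((\<lambda>z. f (of_real c * (z - u))) has_derivative (\<lambda>v. dir_deriv (of_real c * v) f (of_real c * (z - u)))) (at z)"
    by (rule has_derivative_compose[where g = f and f = "\<lambda>z. of_real c * (z - u)", OF _ has_derivative_dir_deriv[OF assms]])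
       (auto intro!: derivative_eq_intros)
  then have "dir_deriv v (\<lambda>z. f (of_real c * (z - u))) z = dir_deriv (of_real c * v) f (of_real c * (z - u))"
    by (rule dir_deriv_eq)
  also have "\<dots> = of_real c * dir_deriv v f (of_real c * (z - u))"
    by (subst (1 2) dir_deriv_decomp[OF assms]) (simp add: algebra_simps)
  finally show "dir_deriv v (\<lambda>z. f (of_real c * (z - u))) z = of_real c * dir_deriv v f (of_real c * (z - u))" .
qed

lemma dir_deriv_exp:
  assumes "f differentiable at z"
  shows "((\<lambda>z. exp (f z)) has_derivative (\<lambda>v. dir_deriv v f z * exp (f z))) (at z)"
    and "dir_deriv v (\<lambda>z. exp (f z)) z = dir_deriv v f z * exp (f z)"
proof -
  have "((\<lambda>z. exp (f z)) has_derivative (\<lambda>v. exp (f z) * dir_deriv v f z)) (at z)"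
    using has_derivative_compose[OF has_derivative_dir_deriv[OF assms]
        DERIV_exp[of "f z", unfolded has_field_derivative_def]] .
  then show "((\<lambda>z. exp (f z)) has_derivative (\<lambda>v. dir_deriv v f z * exp (f z))) (at z)"
    by (simp only: mult.commute)
  then show "dir_deriv v (\<lambda>z. exp (f z)) z = dir_deriv v f z * exp (f z)"
    by (rule dir_deriv_eq)
qed

lemma dir_deriv_inverse:
  "f differentiable at z \<Longrightarrow> f z \<noteq> 0 \<Longrightarrow>
     dir_deriv v (\<lambda>z. inverse (f z)) z = - (dir_deriv v f z * (inverse (f z) * inverse (f z)))"
  by (rule dir_deriv_eq[THEN trans]) (auto intro!: derivative_eq_intros has_derivative_dir_deriv)

lemma differentiable_cnj: "f differentiable F \<Longrightarrow> (\<lambda>z. cnj (f z)) differentiable F"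
  unfolding differentiable_def by (auto intro: derivative_intros)

lemma C_k_pred: "C_k (Suc k) f \<Longrightarrow> C_k k f"
proof (induction k arbitrary: f)
  case 0
  then have "f differentiable (at z)" for z
    unfolding C_k.simps(2) by blast
  then have "continuous_on UNIV f"
    by (blast intro: continuous_at_imp_continuous_on differentiable_imp_continuous_within)
  then show ?case
    by simp
next
  case (Suc k)
  then have "\<forall>z. f differentiable at z" "C_k (Suc k) (dx f)" "C_k (Suc k) (dy f)"
    unfolding C_k.simps(2)[of "Suc k"] by blast+
  then show ?case
    by (subst C_k.simps(2)) (intro conjI Suc.IH)
qed

lemma C_k_const: "C_k k (\<lambda>_. c)"
  by (induction k arbitrary: c) (auto simp: dx_dir_deriv dy_dir_deriv)

lemma C_k_add: "C_k k f \<Longrightarrow> C_k k g \<Longrightarrow> C_k k (\<lambda>z. f z + g z)"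
proof (induction k arbitrary: f g)
  case (Suc k)
  then have "dir_deriv v (\<lambda>z. f z + g z) = (\<lambda>z. dir_deriv v f z + dir_deriv v g z)" for v
    by (auto simp: fun_eq_iff dir_deriv_add)
  with Suc show ?case
    by (auto simp: dx_dir_deriv dy_dir_deriv intro!: Suc.IH)
qed (auto intro: continuous_intros)

lemma C_k_mult: "C_k k f \<Longrightarrow> C_k k g \<Longrightarrow> C_k k (\<lambda>z. f z * g z)"
proof (induction k arbitrary: f g)
  case (Suc k)
  then have "dir_deriv v (\<lambda>z. f z * g z) = (\<lambda>z. dir_deriv v f z * g z + f z * dir_deriv v g z)" for v
    by (auto simp: fun_eq_iff dir_deriv_mult)
  with Suc show ?case
    using C_k_pred[OF Suc.prems(1)] C_k_pred[OF Suc.prems(2)]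
    by (auto simp: dx_dir_deriv dy_dir_deriv intro!: C_k_add Suc.IH)
qed (auto intro: continuous_intros)

lemma C_k_cnj: "C_k k f \<Longrightarrow> C_k k (\<lambda>z. cnj (f z))"
proof (induction k arbitrary: f)
  case (Suc k)
  then have "dir_deriv v (\<lambda>z. cnj (f z)) = (\<lambda>z. cnj (dir_deriv v f z))" for v
    by (auto simp: fun_eq_iff dir_deriv_cnj)
  with Suc show ?case
    by (auto simp: dx_dir_deriv dy_dir_deriv intro: Suc.IH differentiable_cnj)
qed (auto intro: continuous_intros)

lemma smooth_iff:
  "smooth f \<longleftrightarrow> (\<forall>z. f differentiable at z) \<and> smooth (dir_deriv 1 f) \<and> smooth (dir_deriv \<i> f)" (is "?l = ?r")
proof
  assume f: ?l
  then have *: "C_k (Suc k) f" for k unfolding smooth_def by blast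
  show ?r
    using *[unfolded C_k.simps(2) dx_dir_deriv dy_dir_deriv] unfolding smooth_def by blast
next
  assume ?r
  then have "C_k (Suc k) f" for k
    unfolding C_k.simps(2) dx_dir_deriv dy_dir_deriv smooth_def by blast
  then show ?l unfolding smooth_def using C_k_pred by blast
qed

lemma smooth_differentiable: "smooth f \<Longrightarrow> f differentiable at z"
  using smooth_iff by blast

lemma smooth_const [simp]: "smooth (\<lambda>_. c)"
  by (simp add: smooth_def C_k_const)

lemma smooth_add: "smooth f \<Longrightarrow> smooth g \<Longrightarrow> smooth (\<lambda>z. f z + g z)"
  by (simp add: smooth_def C_k_add)

lemma smooth_mult: "smooth f \<Longrightarrow> smooth g \<Longrightarrow> smooth (\<lambda>z. f z * g z)"
  by (simp add: smooth_def C_k_mult)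

lemma smooth_cnj: "smooth f \<Longrightarrow> smooth (\<lambda>z. cnj (f z))"
  by (simp add: smooth_def C_k_cnj)

lemma smooth_dir_deriv: "smooth f \<Longrightarrow> smooth (dir_deriv v f)"
proof -
  assume f: "smooth f"
  have "dir_deriv v f = (\<lambda>z. of_real (Re v) * dir_deriv 1 f z + of_real (Im v) * dir_deriv \<i> f z)"
    using dir_deriv_decomp[OF smooth_differentiable[OF f], of v] unfolding dx_dir_deriv dy_dir_deriv by (rule ext)
  then show ?thesis
    using iffD1[OF smooth_iff f] by (auto intro!: smooth_add smooth_mult)
qed

lemma smooth_dx: "smooth f \<Longrightarrow> smooth (dx f)" and smooth_dy: "smooth f \<Longrightarrow> smooth (dy f)"
  by (auto simp: dx_dir_deriv dy_dir_deriv smooth_dir_deriv)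

lemma smooth_continuous: "smooth f \<Longrightarrow> continuous_on S f"
  by (meson smooth_differentiable differentiable_imp_continuous_on differentiable_at_withinI differentiable_on_def)

lemma smooth_minus: "smooth f \<Longrightarrow> smooth (\<lambda>z. - f z)"
  using smooth_mult[of "\<lambda>_. -1" f] by simp

lemma smooth_diff: "smooth f \<Longrightarrow> smooth g \<Longrightarrow> smooth (\<lambda>z. f z - g z)"
  using smooth_add[of f "\<lambda>z. - g z"] by (simp add: smooth_minus)

lemma smooth_sum: "(\<And>i. i \<in> I \<Longrightarrow> smooth (f i)) \<Longrightarrow> smooth (\<lambda>z. \<Sum>i\<in>I. f i z)"
  by (induction I rule: infinite_finite_induct) (auto intro: smooth_add)

lemma smooth_prod: "(\<And>i. i \<in> I \<Longrightarrow> smooth (f i)) \<Longrightarrow> smooth (\<lambda>z. \<Prod>i\<in>I. f i z)"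
  by (induction I rule: infinite_finite_induct) (auto intro: smooth_mult)

lemma smooth_power: "smooth f \<Longrightarrow> smooth (\<lambda>z. f z ^ n)"
  by (induction n) (auto intro: smooth_mult)

lemma dir_deriv_id: "dir_deriv v (\<lambda>z. z) = (\<lambda>_. v)"
  by (auto simp: dir_deriv_def fun_eq_iff)

lemma smooth_id: "smooth (\<lambda>z. z)"
  by (subst smooth_iff) (auto simp: dir_deriv_id)

lemma smooth_affine:
  assumes "smooth f" shows "smooth (\<lambda>z. f (of_real c * (z - u)))"
proof -
  have "C_k k (\<lambda>z. f (of_real c * (z - u)))" for k
    using assms
  proof (induction k arbitrary: f)
    case 0
    then show ?case
      by (auto intro!: continuous_intros continuous_on_compose2[OF smooth_continuous[of f UNIV]])
  next
    case (Suc k)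
    have "(\<lambda>z. f (of_real c * (z - u))) differentiable at z" for z
      using differentiable_chain_at[of "\<lambda>z. of_real c * (z - u)" z f] smooth_differentiable[OF Suc.prems]
      by (auto simp: o_def)
    moreover have "C_k k (dir_deriv v (\<lambda>z. f (of_real c * (z - u))))" for v
      using dir_deriv_affine[OF smooth_differentiable[OF Suc.prems]] Suc.IH[OF smooth_dir_deriv[OF Suc.prems]]
      by (simp add: C_k_mult C_k_const)
    ultimately show ?case by (simp add: dx_dir_deriv dy_dir_deriv)
  qed
  then show ?thesis by (simp add: smooth_def)
qed

lemma smooth_translate: "smooth f \<Longrightarrow> smooth (\<lambda>z. f (z - u))"
  using smooth_affine[of f 1 u] by simp

lemma smooth_exp:
  assumes "smooth f" shows "smooth (\<lambda>z. exp (f z))"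
proof -
  have "C_k k (\<lambda>z. exp (f z))" for k
  proof (induction k)
    case 0
    then show ?case using continuous_on_exp[OF smooth_continuous[OF assms]] by simp
  next
    case (Suc k)
    have "(\<lambda>z. exp (f z)) differentiable at z" for z
      using dir_deriv_exp(1)[OF smooth_differentiable[OF assms]] by (auto simp: differentiable_def)
    moreover have "C_k k (dir_deriv v (\<lambda>z. exp (f z)))" for v
    proof -
      have "dir_deriv v (\<lambda>z. exp (f z)) = (\<lambda>z. dir_deriv v f z * exp (f z))"
        using dir_deriv_exp(2) smooth_differentiable[OF assms] by blast
      then show ?thesis
        using Suc smooth_dir_deriv[OF assms] by (simp add: C_k_mult smooth_def)
    qed
    ultimately show ?case by (simp add: dx_dir_deriv dy_dir_deriv)
  qed
  then show ?thesis by (simp add: smooth_def)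
qed

lemma smooth_inverse:
  assumes "smooth f" "\<And>z. f z \<noteq> 0" shows "smooth (\<lambda>z. inverse (f z))"
proof -
  have "C_k k (\<lambda>z. inverse (f z))" for k
  proof (induction k)
    case 0
    then show ?case using continuous_on_inverse[OF smooth_continuous[OF assms(1)]] assms(2) by simp
  next
    case (Suc k)
    have "(\<lambda>z. inverse (f z)) differentiable at z" for z
      using smooth_differentiable[OF assms(1)] assms(2) by (intro differentiable_inverse) auto
    moreover have "C_k k (dir_deriv v (\<lambda>z. inverse (f z)))" for v
    proof -
      have "dir_deriv v (\<lambda>z. inverse (f z)) = (\<lambda>z. (-1) * (dir_deriv v f z * (inverse (f z) * inverse (f z))))"
        using dir_deriv_inverse[OF smooth_differentiable[OF assms(1)] assms(2)] by (simp add: fun_eq_iff)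
      then show ?thesis
        using Suc smooth_dir_deriv[OF assms(1)] by (simp only:) (intro C_k_mult C_k_const, auto simp: smooth_def)
    qed
    ultimately show ?case by (simp add: dx_dir_deriv dy_dir_deriv)
  qed
  then show ?thesis by (simp add: smooth_def)
qed

lemma smooth_Re: "smooth f \<Longrightarrow> smooth (\<lambda>z. of_real (Re (f z)))"
proof -
  assume "smooth f"
  then have "smooth (\<lambda>z. (1/2) * (f z + cnj (f z)))"
    by (intro smooth_mult smooth_add smooth_cnj) auto
  moreover have "(\<lambda>z. (1/2) * (f z + cnj (f z))) = (\<lambda>z. of_real (Re (f z)))"
    by (auto simp: fun_eq_iff complex_eq_iff)
  ultimately show ?thesis by simp
qed

lemma smooth_Im: "smooth f \<Longrightarrow> smooth (\<lambda>z. of_real (Im (f z)))"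
proof -
  assume "smooth f"
  then have "smooth (\<lambda>z. of_real (Re (- \<i> * f z)))"
    by (intro smooth_Re smooth_mult smooth_const)
  then show ?thesis by simp
qed

lemmas smooth_intros = smooth_const smooth_add smooth_mult smooth_cnj smooth_minus smooth_diff
  smooth_sum smooth_prod smooth_power smooth_id smooth_exp smooth_Re smooth_Im

lemma dir_deriv_cmult: "f differentiable at z \<Longrightarrow> dir_deriv v (\<lambda>z. c * f z) z = c * dir_deriv v f z"
  using dir_deriv_mult[of "\<lambda>_. c" z f v] by simp

lemma dir_deriv_add_smooth: "smooth f \<Longrightarrow> smooth g \<Longrightarrow> dir_deriv u (\<lambda>z. f z + g z) = (\<lambda>z. dir_deriv u f z + dir_deriv u g z)"
  by (rule ext) (rule dir_deriv_add; rule smooth_differentiable)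

lemma dir_deriv_mult_smooth:
  "smooth f \<Longrightarrow> smooth g \<Longrightarrow> dir_deriv u (\<lambda>z. f z * g z) = (\<lambda>z. dir_deriv u f z * g z + f z * dir_deriv u g z)"
  by (rule ext) (rule dir_deriv_mult; rule smooth_differentiable)

lemma dir_deriv_cmult_smooth: "smooth f \<Longrightarrow> dir_deriv u (\<lambda>z. c * f z) = (\<lambda>z. c * dir_deriv u f z)"
  by (rule ext) (rule dir_deriv_cmult; rule smooth_differentiable)

lemma dir_deriv_diff_smooth: "smooth f \<Longrightarrow> smooth g \<Longrightarrow> dir_deriv u (\<lambda>z. f z - g z) = (\<lambda>z. dir_deriv u f z - dir_deriv u g z)"
  using dir_deriv_add_smooth[of f "\<lambda>z. (-1) * g z" u] dir_deriv_cmult_smooth[of g u "-1"]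
  by (simp add: smooth_minus)

lemma dir_deriv_translate: "smooth f \<Longrightarrow> dir_deriv v (\<lambda>z. f (z - u)) = (\<lambda>z. dir_deriv v f (z - u))"
  using dir_deriv_affine[OF smooth_differentiable, of f v 1 u] by simp

lemma has_vector_derivative_line:
  assumes "smooth f"
  shows "((\<lambda>t. f (p + of_real t * w)) has_vector_derivative dir_deriv w f (p + of_real s * w)) (at s)"
proof -
  have "((\<lambda>t. f (p + of_real t * w)) has_derivative (\<lambda>x. dir_deriv (of_real x * w) f (p + of_real s * w))) (at s)"
    by (rule has_derivative_compose[where g = f and f = "\<lambda>t. p + of_real t * w",
          OF _ has_derivative_dir_deriv[OF smooth_differentiable[OF assms]]])
       (auto intro!: derivative_eq_intros)
  moreover have "dir_deriv (of_real x * w) f q = x *\<^sub>R dir_deriv w f q" for x q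
    using dir_deriv_decomp[OF smooth_differentiable[OF assms]] by (simp add: algebra_simps scaleR_conv_of_real)
  ultimately show ?thesis by (simp add: has_vector_derivative_def)
qed

text \<open>Subtracting a constant $c$ covers two uses: $c = 0$ is a Lipschitz estimate, and for $c$ a
  value of the derivative it is a first-order Taylor estimate.\<close>

lemma mean_value_bound:
  assumes f: "smooth f" and B: "\<And>s. 0 < s \<Longrightarrow> s < t \<Longrightarrow> norm (dir_deriv w f (z + of_real s * w) - c) \<le> B" and t: "0 < t"
  shows "norm (f (z + of_real t * w) - f z - of_real t * c) \<le> B * t"
proof -
  let ?\<phi> = "\<lambda>s. f (z + of_real s * w) - of_real s * c"
  have lin: "((\<lambda>s. of_real s * c) has_vector_derivative c) (at s)" for s
    by (auto intro!: derivative_eq_intros simp: has_vector_derivative_def scaleR_conv_of_real)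
  have der: "(?\<phi> has_vector_derivative (dir_deriv w f (z + of_real s * w) - c)) (at s)" for s
    by (intro has_vector_derivative_diff has_vector_derivative_line f lin)
  have "norm (?\<phi> t - ?\<phi> 0) \<le> B * t - B * 0"
  proof (rule differentiable_bound_general[where f' = "\<lambda>s. dir_deriv w f (z + of_real s * w) - c" and \<phi>' = "\<lambda>_. B"])
    show "continuous_on {0..t} ?\<phi>"
      using der by (meson continuous_at_imp_continuous_on has_vector_derivative_continuous)
    show "continuous_on {0..t} (\<lambda>x. B * x)" by (intro continuous_intros)
  qed (use t B der in \<open>auto intro!: derivative_eq_intros\<close>)
  then show ?thesis by (simp add: algebra_simps)
qed

text \<open>The mean value estimate is applied once in each direction. The second difference is symmetric
  in $u$ and $v$, while the mixed derivative that it approximates takes them in a fixed order;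
  comparing the two orders is Clairaut's theorem.\<close>

lemma second_difference_bound:
  assumes f: "smooth f" and e: "0 < e"
  shows "\<exists>d>0. \<forall>h. 0 < h \<and> h < d \<longrightarrow>
    norm ((f (z + of_real h * u + of_real h * v) - f (z + of_real h * u) - f (z + of_real h * v) + f z)
      - of_real (h * h) * dir_deriv v (dir_deriv u f) z) \<le> e * (h * h)"
proof -
  let ?g = "dir_deriv v (dir_deriv u f)"
  have "continuous (at z) ?g"
    using smooth_continuous[OF smooth_dir_deriv[OF smooth_dir_deriv[OF f]], of UNIV] by (simp add: continuous_on_eq_continuous_at)
  then obtain d where d: "d > 0" and dg: "\<And>w. dist w z < d \<Longrightarrow> dist (?g w) (?g z) < e"
    using e unfolding continuous_at_eps_delta by metis
  define c where "c = d / (norm u + norm v + 1)"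
  have c: "0 < c" using d unfolding c_def by (intro divide_pos_pos add_nonneg_pos) auto
  have near: "norm (?g (z + of_real t * u + of_real s * v) - ?g z) \<le> e"
    if "0 \<le> t" "t \<le> h" "0 \<le> s" "s \<le> h" "h < c" for t s h
  proof -
    have "dist (z + of_real t * u + of_real s * v) z \<le> t * norm u + s * norm v"
      using that norm_triangle_ineq[of "of_real t * u" "of_real s * v"] by (simp add: dist_norm norm_mult add.assoc)
    also have "\<dots> \<le> h * norm u + h * norm v" using that by (intro add_mono mult_right_mono) auto
    also have "\<dots> \<le> h * (norm u + norm v + 1)" using that by (simp add: algebra_simps)
    also have "\<dots> < c * (norm u + norm v + 1)"
      using that by (intro mult_strict_right_mono) (auto intro: add_nonneg_pos)
    also have "\<dots> = d" by (simp add: c_def add_nonneg_pos[THEN less_imp_neq, symmetric])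
    finally show ?thesis using dg by (auto simp: dist_norm intro: less_imp_le)
  qed
  have inner: "norm (dir_deriv u f (z + of_real t * u + of_real h * v) - dir_deriv u f (z + of_real t * u)
      - of_real h * ?g z) \<le> e * h"
    if "0 < h" "h < c" "0 \<le> t" "t \<le> h" for t h
    by (rule mean_value_bound[OF smooth_dir_deriv[OF f]]) (use that near in auto)
  have "norm ((f (z + of_real h * u + of_real h * v) - f (z + of_real h * u) - f (z + of_real h * v) + f z)
      - of_real (h * h) * ?g z) \<le> e * (h * h)" if h: "0 < h" "h < c" for h
  proof -
    define k where "k x = f (x - (- (of_real h * v))) - f x" for x
    have s: "smooth (\<lambda>x. f (x - (- (of_real h * v))))" by (rule smooth_translate[OF f])
    have "dir_deriv u k x = dir_deriv u f (x + of_real h * v) - dir_deriv u f x" for x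
      unfolding k_def[abs_def] dir_deriv_diff_smooth[OF s f] dir_deriv_translate[OF f] by simp
    then have "norm (k (z + of_real h * u) - k z - of_real h * (of_real h * ?g z)) \<le> (e * h) * h"
      unfolding k_def[abs_def] using inner[OF h] h
      by (intro mean_value_bound smooth_diff s f) (simp_all add: k_def[abs_def])
    then show ?thesis by (simp add: k_def algebra_simps)
  qed
  with c show ?thesis by blast
qed

lemma dir_deriv_commute:
  assumes f: "smooth f" shows "dir_deriv u (dir_deriv v f) = dir_deriv v (dir_deriv u f)"
proof
  fix z
  have "norm (dir_deriv u (dir_deriv v f) z - dir_deriv v (dir_deriv u f) z) \<le> e" if "e > 0" for e
  proof -
    have e2: "e / 2 > 0" using that by simp
    obtain d1 where d1: "d1 > 0" and b1: "\<And>h. 0 < h \<Longrightarrow> h < d1 \<Longrightarrow>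
      norm ((f (z + of_real h * u + of_real h * v) - f (z + of_real h * u) - f (z + of_real h * v) + f z)
        - of_real (h * h) * dir_deriv v (dir_deriv u f) z) \<le> e / 2 * (h * h)"
      using second_difference_bound[OF f e2, of z u v] by blast
    obtain d2 where d2: "d2 > 0" and b2: "\<And>h. 0 < h \<Longrightarrow> h < d2 \<Longrightarrow>
      norm ((f (z + of_real h * v + of_real h * u) - f (z + of_real h * v) - f (z + of_real h * u) + f z)
        - of_real (h * h) * dir_deriv u (dir_deriv v f) z) \<le> e / 2 * (h * h)"
      using second_difference_bound[OF f e2, of z v u] by blast
    define h where "h = min d1 d2 / 2"
    have h: "0 < h" "h < d1" "h < d2" using d1 d2 by (auto simp: h_def)
    let ?S = "f (z + of_real h * u + of_real h * v) - f (z + of_real h * u) - f (z + of_real h * v) + f z"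
    have "norm (of_real (h * h) * (dir_deriv u (dir_deriv v f) z - dir_deriv v (dir_deriv u f) z))
        = norm ((?S - of_real (h * h) * dir_deriv v (dir_deriv u f) z) - (?S - of_real (h * h) * dir_deriv u (dir_deriv v f) z))"
      by (simp add: algebra_simps)
    also have "\<dots> \<le> e / 2 * (h * h) + e / 2 * (h * h)"
    proof (rule order_trans[OF norm_triangle_ineq4 add_mono])
      show "norm (?S - of_real (h * h) * dir_deriv v (dir_deriv u f) z) \<le> e / 2 * (h * h)"
        by (rule b1[OF h(1,2)])
      have "?S = f (z + of_real h * v + of_real h * u) - f (z + of_real h * v) - f (z + of_real h * u) + f z"
        by (simp add: algebra_simps)
      then show "norm (?S - of_real (h * h) * dir_deriv u (dir_deriv v f) z) \<le> e / 2 * (h * h)"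
        using b2[OF h(1,3)] by (simp only:)
    qed
    finally have "norm (of_real (h * h) * (dir_deriv u (dir_deriv v f) z - dir_deriv v (dir_deriv u f) z)) \<le> e / 2 * (h * h) + e / 2 * (h * h)" .
    moreover have "norm (of_real (h * h) * (dir_deriv u (dir_deriv v f) z - dir_deriv v (dir_deriv u f) z))
        = (h * h) * norm (dir_deriv u (dir_deriv v f) z - dir_deriv v (dir_deriv u f) z)"
      by (simp only: norm_mult norm_of_real) (use h in simp)
    ultimately have "(h * h) * norm (dir_deriv u (dir_deriv v f) z - dir_deriv v (dir_deriv u f) z) \<le> (h * h) * e"
      by (simp add: algebra_simps)
    moreover have "0 < h * h" using h by simp
    ultimately show ?thesis by (rule mult_left_le_imp_le)
  qed
  then have "norm (dir_deriv u (dir_deriv v f) z - dir_deriv v (dir_deriv u f) z) \<le> 0"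
    using field_le_epsilon[of "norm (dir_deriv u (dir_deriv v f) z - dir_deriv v (dir_deriv u f) z)" 0] by simp
  then show "dir_deriv u (dir_deriv v f) z = dir_deriv v (dir_deriv u f) z" by simp
qed

lemma D_0 [simp]: "D (0, 0) f = f"
  by (simp add: D_def)

lemma D_Suc_left: "D (Suc a, b) f = dx (D (a, b) f)"
  by (simp add: D_def)

lemma D_0_Suc: "D (0, Suc b) f = dy (D (0, b) f)" "D (0, Suc b) f = D (0, b) (dy f)"
  by (simp_all add: D_def funpow_swap1)

lemma D_dy: "D (a, b) (dy f) = D (a, Suc b) f"
  by (simp add: D_def funpow_swap1)

lemma smooth_dy_pow: "smooth f \<Longrightarrow> smooth ((dy ^^ b) f)"
  by (induction b) (auto intro: smooth_dy)

lemma smooth_D: "smooth f \<Longrightarrow> smooth (D \<alpha> f)"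
proof -
  have *: "smooth g \<Longrightarrow> smooth ((dx ^^ a) g)" for g a
    by (induction a) (auto intro: smooth_dx)
  show "smooth f \<Longrightarrow> smooth (D \<alpha> f)"
    unfolding D_def by (intro * smooth_dy_pow)
qed

lemma D_dx:
  assumes "smooth f" shows "D (a, b) (dx f) = D (Suc a, b) f"
proof -
  have "(dy ^^ b) (dx f) = dx ((dy ^^ b) f)"
    using dir_deriv_commute[OF smooth_dy_pow[OF assms]] by (induction b) (auto simp: dx_dir_deriv dy_dir_deriv)
  then show ?thesis by (simp add: D_def funpow_swap1)
qed

lemma D_add: 
  assumes "smooth f" "smooth g" shows "D \<alpha> (\<lambda>z. f z + g z) = (\<lambda>z. D \<alpha> f z + D \<alpha> g z)"
proof -
  have step: "dir_deriv v (\<lambda>z. p z + r z) = (\<lambda>z. dir_deriv v p z + dir_deriv v r z)" if "smooth p" "smooth r" for v p r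
    using that dir_deriv_add smooth_differentiable by blast
  obtain a b where \<alpha>: "\<alpha> = (a, b)" by force
  have "D (0, b) (\<lambda>z. f z + g z) = (\<lambda>z. D (0, b) f z + D (0, b) g z)" for b
    by (induction b) (use assms in \<open>simp_all add: D_0_Suc(1) dy_dir_deriv step smooth_D\<close>)
  then have "D (a, b) (\<lambda>z. f z + g z) = (\<lambda>z. D (a, b) f z + D (a, b) g z)"
    by (induction a) (use assms in \<open>simp_all add: D_Suc_left dx_dir_deriv step smooth_D\<close>)
  then show ?thesis by (simp add: \<alpha>)
qed

lemma D_cmult: 
  assumes "smooth f" shows "D \<alpha> (\<lambda>z. c * f z) = (\<lambda>z. c * D \<alpha> f z)"
proof -
  have step: "dir_deriv v (\<lambda>z. c * p z) = (\<lambda>z. c * dir_deriv v p z)" if "smooth p" for v p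
    using that dir_deriv_cmult smooth_differentiable by blast
  obtain a b where \<alpha>: "\<alpha> = (a, b)" by force
  have "D (0, b) (\<lambda>z. c * f z) = (\<lambda>z. c * D (0, b) f z)" for b
    by (induction b) (use assms in \<open>simp_all add: D_0_Suc(1) dy_dir_deriv step smooth_D\<close>)
  then have "D (a, b) (\<lambda>z. c * f z) = (\<lambda>z. c * D (a, b) f z)"
    by (induction a) (use assms in \<open>simp_all add: D_Suc_left dx_dir_deriv step smooth_D\<close>)
  then show ?thesis by (simp add: \<alpha>)
qed

lemma D_zero: "D \<alpha> (\<lambda>_. 0) = (\<lambda>_. 0)"
  using D_cmult[of "\<lambda>_. 0" \<alpha> 0] by simp

lemma D_sum:
  "finite I \<Longrightarrow> (\<And>i. i \<in> I \<Longrightarrow> smooth (f i)) \<Longrightarrow> D \<alpha> (\<lambda>z. \<Sum>i\<in>I. f i z) = (\<lambda>z. \<Sum>i\<in>I. D \<alpha> (f i) z)"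
  by (induction I rule: finite_induct) (auto simp: D_zero D_add smooth_sum)

section \<open>Weighted bounds on all derivatives\<close>

text \<open>All words of length $j \le k$ in the two partial derivatives are bounded by $\rho^j v$. The
  scale $\rho$ is kept apart from $v$ because characters of frequency about $\rho$, and cutoffs
  on discs of radius about $1/\rho$, satisfy such a bound with $v$ independent of $\rho$.\<close>

primrec deriv_bound :: "nat \<Rightarrow> real \<Rightarrow> (complex \<Rightarrow> real) \<Rightarrow> (complex \<Rightarrow> complex) \<Rightarrow> bool" where
  "deriv_bound 0 \<rho> v f \<longleftrightarrow> (\<forall>z. norm (f z) \<le> v z)"
| "deriv_bound (Suc k) \<rho> v f \<longleftrightarrow> (\<forall>z. norm (f z) \<le> v z) \<and>
     deriv_bound k \<rho> (\<lambda>z. \<rho> * v z) (dir_deriv 1 f) \<and> deriv_bound k \<rho> (\<lambda>z. \<rho> * v z) (dir_deriv \<i> f)"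

lemma deriv_bound_SucI:
  "(\<And>z. norm (f z) \<le> v z) \<Longrightarrow> (\<And>u. u = 1 \<or> u = \<i> \<Longrightarrow> deriv_bound k \<rho> (\<lambda>z. \<rho> * v z) (dir_deriv u f)) \<Longrightarrow> deriv_bound (Suc k) \<rho> v f"
  by simp

lemma deriv_bound_SucD: "deriv_bound (Suc k) \<rho> v f \<Longrightarrow> u = 1 \<or> u = \<i> \<Longrightarrow> deriv_bound k \<rho> (\<lambda>z. \<rho> * v z) (dir_deriv u f)"
  by auto

lemma deriv_bound_norm: "deriv_bound k \<rho> v f \<Longrightarrow> norm (f z) \<le> v z"
  by (cases k) auto

lemma deriv_bound_nonneg: "deriv_bound k \<rho> v f \<Longrightarrow> 0 \<le> v z"
  using deriv_bound_norm norm_ge_zero order_trans by metis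

lemma deriv_bound_mono:
  "deriv_bound k \<rho> v f \<Longrightarrow> 0 \<le> \<rho> \<Longrightarrow> \<rho> \<le> \<sigma> \<Longrightarrow> (\<And>z. v z \<le> w z) \<Longrightarrow> deriv_bound k \<sigma> w f"
proof (induction k arbitrary: v w f)
  case 0
  then show ?case using order_trans unfolding deriv_bound.simps by blast
next
  case (Suc k)
  show ?case
  proof (rule deriv_bound_SucI)
    show "norm (f z) \<le> w z" for z
      using deriv_bound_norm[OF Suc.prems(1)] Suc.prems(4) order_trans by blast
    fix u :: complex assume "u = 1 \<or> u = \<i>"
    then have "deriv_bound k \<rho> (\<lambda>z. \<rho> * v z) (dir_deriv u f)"
      using deriv_bound_SucD[OF Suc.prems(1)] by blast
    moreover have "\<rho> * v z \<le> \<sigma> * w z" for z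
      using Suc.prems deriv_bound_nonneg[OF Suc.prems(1)] by (intro mult_mono) auto
    ultimately show "deriv_bound k \<sigma> (\<lambda>z. \<sigma> * w z) (dir_deriv u f)"
      by (intro Suc.IH[where v = "\<lambda>z. \<rho> * v z"] Suc.prems(2,3))
  qed
qed

lemma deriv_bound_weaken: "deriv_bound k \<rho> v f \<Longrightarrow> 0 \<le> \<rho> \<Longrightarrow> (\<And>z. v z \<le> w z) \<Longrightarrow> deriv_bound k \<rho> w f"
  by (erule deriv_bound_mono) auto

lemma deriv_bound_pred: "deriv_bound (Suc k) \<rho> v f \<Longrightarrow> deriv_bound k \<rho> v f"
proof (induction k arbitrary: v f)
  case 0
  then show ?case by simp
next
  case (Suc k)
  show ?case
    by (rule deriv_bound_SucI[OF deriv_bound_norm[OF Suc.prems] Suc.IH[OF deriv_bound_SucD[OF Suc.prems]]])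
qed

lemma deriv_bound_antimono: 
  assumes "deriv_bound k \<rho> v f" "j \<le> k" shows "deriv_bound j \<rho> v f"
  using assms(2,1) by (induction rule: dec_induct) (auto dest: deriv_bound_pred simp del: deriv_bound.simps)

lemma deriv_bound_add:
  "smooth f \<Longrightarrow> smooth g \<Longrightarrow> deriv_bound k \<rho> v f \<Longrightarrow> deriv_bound k \<rho> w g \<Longrightarrow> deriv_bound k \<rho> (\<lambda>z. v z + w z) (\<lambda>z. f z + g z)"
proof (induction k arbitrary: f g v w)
  case 0
  then show ?case
    by (simp add: norm_triangle_mono)
next
  case (Suc k)
  show ?case
  proof (rule deriv_bound_SucI)
    show "norm (f z + g z) \<le> v z + w z" for z
      using deriv_bound_norm[OF Suc.prems(3)] deriv_bound_norm[OF Suc.prems(4)] by (rule norm_triangle_mono)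
    fix u :: complex assume u: "u = 1 \<or> u = \<i>"
    show "deriv_bound k \<rho> (\<lambda>z. \<rho> * (v z + w z)) (dir_deriv u (\<lambda>z. f z + g z))"
      unfolding dir_deriv_add_smooth[OF Suc.prems(1,2)] distrib_left
      by (intro Suc.IH smooth_dir_deriv Suc.prems(1,2) deriv_bound_SucD[OF Suc.prems(3) u] deriv_bound_SucD[OF Suc.prems(4) u])
  qed
qed

text \<open>Each use of the product rule doubles the number of terms, whence the factor $2^k$.\<close>

lemma deriv_bound_mult:
  "smooth f \<Longrightarrow> smooth g \<Longrightarrow> deriv_bound k \<rho> v f \<Longrightarrow> deriv_bound k \<rho> w g \<Longrightarrow> 0 \<le> \<rho> \<Longrightarrow>
     deriv_bound k \<rho> (\<lambda>z. 2 ^ k * (v z * w z)) (\<lambda>z. f z * g z)"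
proof (induction k arbitrary: f g v w)
  case 0
  then show ?case
    by (auto simp: norm_mult intro!: mult_mono')
next
  case (Suc k)
  have nn: "0 \<le> v z" "0 \<le> w z" for z
    using Suc.prems deriv_bound_nonneg by blast+
  show ?case
  proof (rule deriv_bound_SucI)
    fix z
    have "norm (f z * g z) \<le> v z * w z"
      using deriv_bound_norm[OF Suc.prems(3)] deriv_bound_norm[OF Suc.prems(4)] nn
      by (simp add: norm_mult mult_mono)
    also have "\<dots> \<le> 2 ^ Suc k * (v z * w z)"
      using mult_right_mono[of 1 "2 ^ Suc k" "v z * w z"] nn one_le_power[of "2::real" "Suc k"] by simp
    finally show "norm (f z * g z) \<le> 2 ^ Suc k * (v z * w z)" .
  next
    fix u :: complex assume u: "u = 1 \<or> u = \<i>"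
    have 1: "deriv_bound k \<rho> (\<lambda>z. 2 ^ k * ((\<rho> * v z) * w z)) (\<lambda>z. dir_deriv u f z * g z)"
      by (intro Suc.IH smooth_dir_deriv Suc.prems(1,2,5) deriv_bound_SucD[OF Suc.prems(3) u] deriv_bound_pred[OF Suc.prems(4)])
    have 2: "deriv_bound k \<rho> (\<lambda>z. 2 ^ k * (v z * (\<rho> * w z))) (\<lambda>z. f z * dir_deriv u g z)"
      by (intro Suc.IH smooth_dir_deriv Suc.prems(1,2,5) deriv_bound_pred[OF Suc.prems(3)] deriv_bound_SucD[OF Suc.prems(4) u])
    have "deriv_bound k \<rho> (\<lambda>z. 2 ^ k * ((\<rho> * v z) * w z) + 2 ^ k * (v z * (\<rho> * w z)))
        (\<lambda>z. dir_deriv u f z * g z + f z * dir_deriv u g z)"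
      by (intro deriv_bound_add 1 2 smooth_mult smooth_dir_deriv Suc.prems(1,2))
    moreover have "(\<lambda>z. 2 ^ k * ((\<rho> * v z) * w z) + 2 ^ k * (v z * (\<rho> * w z)))
        = (\<lambda>z. \<rho> * (2 ^ Suc k * (v z * w z)))"
      by (simp add: fun_eq_iff algebra_simps)
    ultimately show "deriv_bound k \<rho> (\<lambda>z. \<rho> * (2 ^ Suc k * (v z * w z))) (dir_deriv u (\<lambda>z. f z * g z))"
      unfolding dir_deriv_mult_smooth[OF Suc.prems(1,2)] by simp
  qed
qed

lemma deriv_bound_const: "0 \<le> \<rho> \<Longrightarrow> deriv_bound k \<rho> (\<lambda>_. norm c) (\<lambda>_. c)"
proof (induction k arbitrary: c)
  case (Suc k)
  have "deriv_bound k \<rho> (\<lambda>z. \<rho> * norm c) (\<lambda>z. 0)"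
    using Suc.IH[of 0] Suc.prems by (rule deriv_bound_weaken) (use Suc.prems in auto)
  then show ?case by simp
qed simp

lemma deriv_bound_cmult:
  "smooth f \<Longrightarrow> deriv_bound k \<rho> v f \<Longrightarrow> deriv_bound k \<rho> (\<lambda>z. norm c * v z) (\<lambda>z. c * f z)"
proof (induction k arbitrary: f v)
  case 0
  then show ?case by (simp add: norm_mult mult_left_mono)
next
  case (Suc k)
  show ?case
  proof (rule deriv_bound_SucI)
    show "norm (c * f z) \<le> norm c * v z" for z
      using deriv_bound_norm[OF Suc.prems(2)] by (simp add: norm_mult mult_left_mono)
    fix u :: complex assume u: "u = 1 \<or> u = \<i>"
    have "deriv_bound k \<rho> (\<lambda>z. norm c * (\<rho> * v z)) (\<lambda>z. c * dir_deriv u f z)"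
      by (intro Suc.IH smooth_dir_deriv Suc.prems(1) deriv_bound_SucD[OF Suc.prems(2) u])
    then show "deriv_bound k \<rho> (\<lambda>z. \<rho> * (norm c * v z)) (dir_deriv u (\<lambda>z. c * f z))"
      unfolding dir_deriv_cmult_smooth[OF Suc.prems(1)] by (simp add: mult.left_commute)
  qed
qed

lemma deriv_bound_diff:
  assumes "smooth f" "smooth g" "deriv_bound k \<rho> v f" "deriv_bound k \<rho> w g"
  shows "deriv_bound k \<rho> (\<lambda>z. v z + w z) (\<lambda>z. f z - g z)"
  using deriv_bound_add[of f "\<lambda>z. -1 * g z", OF _ _ _ deriv_bound_cmult[OF _ assms(4)]] assms
  by (simp add: smooth_minus)

lemma dir_deriv_zero_on_open:
  assumes "open U" "\<And>z. z \<in> U \<Longrightarrow> f z = g z" "z \<in> U" "f differentiable at z"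
  shows "dir_deriv v f z = dir_deriv v g z"
  using frechet_derivative_transform_within_open[of f z U g] assms unfolding dir_deriv_def by auto

text \<open>On an open set where $f$ vanishes all its derivatives vanish as well. This is how localized
  functions get localized bounds.\<close>

lemma deriv_bound_restrict:
  assumes U: "open U" and r: "0 \<le> \<rho>"
  shows "smooth f \<Longrightarrow> deriv_bound k \<rho> v f \<Longrightarrow> (\<And>z. z \<in> U \<Longrightarrow> f z = 0) \<Longrightarrow>
     deriv_bound k \<rho> (\<lambda>z. if z \<in> U then 0 else v z) f"
proof (induction k arbitrary: f v)
  case 0
  then show ?case by auto
next
  case (Suc k)
  show ?case
  proof (rule deriv_bound_SucI)
    show "norm (f z) \<le> (if z \<in> U then 0 else v z)" for z
      using deriv_bound_norm[OF Suc.prems(2)] Suc.prems(3) by auto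
    fix u :: complex assume u: "u = 1 \<or> u = \<i>"
    have "dir_deriv u f z = 0" if "z \<in> U" for z
      using dir_deriv_zero_on_open[of U f "\<lambda>_. 0" z u] U Suc.prems that by (simp add: smooth_differentiable)
    then have "deriv_bound k \<rho> (\<lambda>z. if z \<in> U then 0 else \<rho> * v z) (dir_deriv u f)"
      by (intro Suc.IH smooth_dir_deriv Suc.prems(1) deriv_bound_SucD[OF Suc.prems(2) u])
    moreover have "(\<lambda>z. if z \<in> U then 0 else \<rho> * v z) = (\<lambda>z. \<rho> * (if z \<in> U then 0 else v z))"
      by auto
    ultimately show "deriv_bound k \<rho> (\<lambda>z. \<rho> * (if z \<in> U then 0 else v z)) (dir_deriv u f)"
      by simp
  qed
qed

lemma deriv_bound_to_1:
  assumes r: "1 \<le> \<rho>" shows "deriv_bound k \<rho> v f \<Longrightarrow> deriv_bound k 1 (\<lambda>z. \<rho> ^ k * v z) f"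
proof (induction k arbitrary: f v)
  case 0
  then show ?case by simp
next
  case (Suc k)
  show ?case
  proof (rule deriv_bound_SucI)
    fix z
    have "1 * v z \<le> \<rho> ^ Suc k * v z"
      using deriv_bound_nonneg[OF Suc.prems] one_le_power[OF r, of "Suc k"] by (intro mult_right_mono)
    then show "norm (f z) \<le> \<rho> ^ Suc k * v z"
      using deriv_bound_norm[OF Suc.prems, of z] by linarith
  next
    fix u :: complex assume u: "u = 1 \<or> u = \<i>"
    show "deriv_bound k 1 (\<lambda>z. 1 * (\<rho> ^ Suc k * v z)) (dir_deriv u f)"
      using Suc.IH[OF deriv_bound_SucD[OF Suc.prems u]] by (simp add: mult.assoc mult.left_commute)
  qed
qed

lemma deriv_bound_affine:
  assumes c: "0 \<le> c"
  shows "smooth f \<Longrightarrow> deriv_bound k \<rho> v f \<Longrightarrow>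
    deriv_bound k (c * \<rho>) (\<lambda>z. v (of_real c * (z - u))) (\<lambda>z. f (of_real c * (z - u)))"
proof (induction k arbitrary: f v)
  case 0
  then show ?case by simp
next
  case (Suc k)
  show ?case
  proof (rule deriv_bound_SucI)
    show "norm (f (of_real c * (z - u))) \<le> v (of_real c * (z - u))" for z
      using deriv_bound_norm[OF Suc.prems(2)] .
    fix w :: complex assume w: "w = 1 \<or> w = \<i>"
    have "deriv_bound k (c * \<rho>) (\<lambda>z. \<rho> * v (of_real c * (z - u))) (\<lambda>z. dir_deriv w f (of_real c * (z - u)))"
      using Suc.IH[OF smooth_dir_deriv[OF Suc.prems(1)] deriv_bound_SucD[OF Suc.prems(2) w]] .
    then have "deriv_bound k (c * \<rho>) (\<lambda>z. norm (of_real c :: complex) * (\<rho> * v (of_real c * (z - u))))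
        (\<lambda>z. of_real c * dir_deriv w f (of_real c * (z - u)))"
      by (intro deriv_bound_cmult smooth_affine smooth_dir_deriv Suc.prems(1))
    then show "deriv_bound k (c * \<rho>) (\<lambda>z. c * \<rho> * v (of_real c * (z - u))) (dir_deriv w (\<lambda>z. f (of_real c * (z - u))))"
      unfolding dir_deriv_affine[OF smooth_differentiable[OF Suc.prems(1)]] using c by (simp add: mult.assoc)
  qed
qed

lemma deriv_bound_translate: "smooth f \<Longrightarrow> deriv_bound k \<rho> v f \<Longrightarrow> deriv_bound k \<rho> (\<lambda>z. v (z - u)) (\<lambda>z. f (z - u))"
  using deriv_bound_affine[of 1 f k \<rho> v u] by simp

text \<open>A uniform bound for every member of a class that is stable under differentiation bounds all
  derivatives; used for periodic and for compactly supported functions.\<close>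

lemma deriv_bound_of_closed_class:
  assumes bounded: "\<And>f. P f \<Longrightarrow> \<exists>B. \<forall>z. norm (f z) \<le> B" and closed: "\<And>f u. P f \<Longrightarrow> P (dir_deriv u f)"
  shows "P f \<Longrightarrow> \<exists>B. deriv_bound k 1 (\<lambda>_. B) f"
proof (induction k arbitrary: f)
  case 0
  then show ?case using bounded by simp
next
  case (Suc k)
  obtain B0 where B0: "\<And>z. norm (f z) \<le> B0" using bounded[OF Suc.prems] by blast
  obtain B1 where B1: "deriv_bound k 1 (\<lambda>_. B1) (dir_deriv 1 f)" using Suc.IH[OF closed[OF Suc.prems]] by blast
  obtain B2 where B2: "deriv_bound k 1 (\<lambda>_. B2) (dir_deriv \<i> f)" using Suc.IH[OF closed[OF Suc.prems]] by blast
  let ?B = "max B0 (max B1 B2)"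
  have "deriv_bound (Suc k) 1 (\<lambda>_. ?B) f"
  proof (rule deriv_bound_SucI)
    show "norm (f z) \<le> ?B" for z using B0[of z] by simp
    fix u :: complex assume "u = 1 \<or> u = \<i>"
    then show "deriv_bound k 1 (\<lambda>z. 1 * ?B) (dir_deriv u f)"
      using deriv_bound_weaken[OF B1, of "\<lambda>_. ?B"] deriv_bound_weaken[OF B2, of "\<lambda>_. ?B"] by auto
  qed
  then show ?case ..
qed

lemma deriv_bound_D:
  assumes "smooth f" "deriv_bound k 1 v f" "mi_order \<alpha> \<le> k" shows "norm (D \<alpha> f z) \<le> v z"
proof -
  have dy: "deriv_bound (k - b) 1 v ((dy ^^ b) f)" if "b \<le> k" for b
    using that
  proof (induction b)
    case 0
    then show ?case using assms by simp
  next
    case (Suc b)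
    then have "deriv_bound (Suc (k - Suc b)) 1 v ((dy ^^ b) f)" by (simp add: Suc_diff_Suc del: deriv_bound.simps)
    then show ?case by (simp add: dy_dir_deriv)
  qed
  have dx: "deriv_bound (j - a) 1 v ((dx ^^ a) g)" if "a \<le> j" "deriv_bound j 1 v g" for a j g
    using that
  proof (induction a)
    case (Suc a)
    then have "deriv_bound (Suc (j - Suc a)) 1 v ((dx ^^ a) g)" by (simp add: Suc_diff_Suc del: deriv_bound.simps)
    then show ?case by (simp add: dx_dir_deriv)
  qed simp
  show ?thesis
    unfolding D_def
    by (rule deriv_bound_norm, rule dx[OF _ dy]) (use assms(3) in \<open>auto simp: mi_order_def\<close>)
qed

text \<open>By Clairaut's theorem every word in the partial derivatives equals one in normal form.\<close>

lemma deriv_bound_of_D: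
  "smooth f \<Longrightarrow> (\<And>\<alpha> z. mi_order \<alpha> \<le> k \<Longrightarrow> norm (D \<alpha> f z) \<le> v z) \<Longrightarrow> deriv_bound k 1 v f"
proof (induction k arbitrary: f)
  case 0
  then show ?case using 0(2)[of "(0,0)"] by (simp add: mi_order_def)
next
  case (Suc k)
  show ?case
  proof (rule deriv_bound_SucI)
    show "norm (f z) \<le> v z" for z
      using Suc.prems(2)[of "(0,0)"] by (simp add: mi_order_def)
    fix u :: complex assume u: "u = 1 \<or> u = \<i>"
    have "norm (D \<alpha> (dir_deriv u f) z) \<le> v z" if "mi_order \<alpha> \<le> k" for \<alpha> z
    proof -
      obtain a b where \<alpha>: "\<alpha> = (a, b)" by force
      have "D \<alpha> (dir_deriv u f) = D (if u = 1 then (Suc a, b) else (a, Suc b)) f"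
        using u D_dx[OF Suc.prems(1)] D_dy by (auto simp: \<alpha> dx_dir_deriv dy_dir_deriv)
      then show ?thesis
        using Suc.prems(2) that by (simp add: mi_order_def \<alpha>)
    qed
    then show "deriv_bound k 1 (\<lambda>z. 1 * v z) (dir_deriv u f)"
      using Suc.IH[OF smooth_dir_deriv[OF Suc.prems(1)]] by simp
  qed
qed

section \<open>Vanishing order\<close>

text \<open>All derivatives of order less than $k$ vanish at $z$. The recursion runs parallel to that of
  \<open>deriv_bound\<close>, so that both are handled by the same inductions.\<close>

primrec vanishes :: "nat \<Rightarrow> (complex \<Rightarrow> complex) \<Rightarrow> complex \<Rightarrow> bool" where
  "vanishes 0 f z \<longleftrightarrow> True"
| "vanishes (Suc k) f z \<longleftrightarrow> f z = 0 \<and> vanishes k (dir_deriv 1 f) z \<and> vanishes k (dir_deriv \<i> f) z"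

lemma vanishes_SucI:
  "f z = 0 \<Longrightarrow> (\<And>u. u = 1 \<or> u = \<i> \<Longrightarrow> vanishes k (dir_deriv u f) z) \<Longrightarrow> vanishes (Suc k) f z"
  by simp

lemma vanishes_SucD: "vanishes (Suc k) f z \<Longrightarrow> u = 1 \<or> u = \<i> \<Longrightarrow> vanishes k (dir_deriv u f) z"
  by auto

lemma vanishes_pred: "vanishes (Suc k) f z \<Longrightarrow> vanishes k f z"
proof (induction k arbitrary: f)
  case (Suc k)
  show ?case
    by (rule vanishes_SucI[OF _ Suc.IH[OF vanishes_SucD[OF Suc.prems]]]) (use Suc.prems in simp)
qed simp

lemma vanishes_antimono: "vanishes k f z \<Longrightarrow> j \<le> k \<Longrightarrow> vanishes j f z"
  by (rotate_tac 1, induction rule: dec_induct) (auto dest: vanishes_pred simp del: vanishes.simps)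

lemma vanishes_add: "smooth f \<Longrightarrow> smooth g \<Longrightarrow> vanishes k f z \<Longrightarrow> vanishes k g z \<Longrightarrow> vanishes k (\<lambda>z. f z + g z) z"
  by (induction k arbitrary: f g) (auto simp: dir_deriv_add_smooth smooth_dir_deriv)

text \<open>Induction by the product rule: a derivative costs one order of a factor that still has order
  to lose; if the differentiated factor has order $0$, the order is given up by the other one.\<close>

lemma vanishes_mult:
  "smooth f \<Longrightarrow> smooth g \<Longrightarrow> vanishes k f z \<Longrightarrow> vanishes l g z \<Longrightarrow> vanishes (k + l) (\<lambda>z. f z * g z) z"
proof (induction "k + l" arbitrary: k l f g)
  case 0
  then show ?case by simp
next
  case (Suc n)
  have "vanishes (Suc n) (\<lambda>z. f z * g z) z"
  proof (rule vanishes_SucI)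
    show "f z * g z = 0"
      using Suc.prems Suc.hyps(2) by (cases k; cases l) auto
    fix u :: complex assume u: "u = 1 \<or> u = \<i>"
    have "vanishes n (\<lambda>z. dir_deriv u f z * g z) z"
    proof (cases k)
      case 0
      then have "n = 0 + (l - 1)" "vanishes (l - 1) g z"
        using Suc.hyps(2) Suc.prems vanishes_pred[of "l - 1"] by auto
      then show ?thesis
        using Suc.hyps(1)[of 0 "l - 1" "dir_deriv u f" g] Suc.prems by (simp add: smooth_dir_deriv)
    next
      case (Suc k')
      then show ?thesis
        using Suc.hyps(1)[of k' l "dir_deriv u f" g] Suc.hyps(2) Suc.prems vanishes_SucD[OF _ u] by (simp add: smooth_dir_deriv del: vanishes.simps)
    qed
    moreover have "vanishes n (\<lambda>z. f z * dir_deriv u g z) z"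
    proof (cases l)
      case 0
      then have "n = (k - 1) + 0" "vanishes (k - 1) f z"
        using Suc.hyps(2) Suc.prems vanishes_pred[of "k - 1"] by auto
      then show ?thesis
        using Suc.hyps(1)[of "k - 1" 0 f "dir_deriv u g"] Suc.prems by (simp add: smooth_dir_deriv)
    next
      case (Suc l')
      then show ?thesis
        using Suc.hyps(1)[of k l' f "dir_deriv u g"] Suc.hyps(2) Suc.prems vanishes_SucD[OF _ u] by (simp add: smooth_dir_deriv del: vanishes.simps)
    qed
    ultimately show "vanishes n (dir_deriv u (\<lambda>z. f z * g z)) z"
      unfolding dir_deriv_mult_smooth[OF Suc.prems(1,2)]
      by (intro vanishes_add smooth_mult smooth_dir_deriv Suc.prems(1,2))
  qed
  then show ?case using Suc.hyps(2) by simp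
qed

lemma vanishes_mult_left: "smooth f \<Longrightarrow> smooth g \<Longrightarrow> vanishes k g z \<Longrightarrow> vanishes k (\<lambda>z. f z * g z) z"
  using vanishes_mult[of f g 0 z k] by simp

lemma vanishes_D:
  assumes "smooth f" "vanishes k f z" "mi_order \<alpha> < k" shows "D \<alpha> f z = 0"
proof -
  have dy: "vanishes (k - b) ((dy ^^ b) f) z" if "b \<le> k" for b
    using that
  proof (induction b)
    case 0
    then show ?case using assms by simp
  next
    case (Suc b)
    then have "vanishes (Suc (k - Suc b)) ((dy ^^ b) f) z" by (simp add: Suc_diff_Suc del: vanishes.simps)
    then show ?case by (simp add: dy_dir_deriv)
  qed
  have dx: "vanishes (j - a) ((dx ^^ a) g) z" if "a \<le> j" "vanishes j g z" for a j g
    using that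
  proof (induction a)
    case (Suc a)
    then have "vanishes (Suc (j - Suc a)) ((dx ^^ a) g) z" by (simp add: Suc_diff_Suc del: vanishes.simps)
    then show ?case by (simp add: dx_dir_deriv)
  qed simp
  have "vanishes (Suc (k - snd \<alpha> - fst \<alpha> - 1)) (D \<alpha> f) z"
    using dx[OF _ dy, of "fst \<alpha>" "snd \<alpha>"] assms(3) by (simp add: mi_order_def D_def Suc_diff_Suc del: vanishes.simps)
  then show ?thesis by simp
qed

lemma vanishes_of_D:
  "smooth f \<Longrightarrow> (\<And>\<alpha>. mi_order \<alpha> < k \<Longrightarrow> D \<alpha> f z = 0) \<Longrightarrow> vanishes k f z"
proof (induction k arbitrary: f)
  case (Suc k)
  show ?case
  proof (rule vanishes_SucI)
    show "f z = 0"
      using Suc.prems(2)[of "(0,0)"] by (simp add: mi_order_def)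
    fix u :: complex assume u: "u = 1 \<or> u = \<i>"
    have "D \<alpha> (dir_deriv u f) z = 0" if "mi_order \<alpha> < k" for \<alpha>
    proof -
      obtain a b where \<alpha>: "\<alpha> = (a, b)" by force
      have "D \<alpha> (dir_deriv u f) = D (if u = 1 then (Suc a, b) else (a, Suc b)) f"
        using u D_dx[OF Suc.prems(1)] D_dy by (auto simp: \<alpha> dx_dir_deriv dy_dir_deriv)
      then show ?thesis
        using Suc.prems(2) that by (simp add: mi_order_def \<alpha>)
    qed
    then show "vanishes k (dir_deriv u f) z"
      using Suc.IH[OF smooth_dir_deriv[OF Suc.prems(1)]] by simp
  qed
qed simp

section \<open>Functions of Gaussian growth and continuous functionals\<close>

text \<open>A big-O counterpart of the space \<^term>\<open>Dq q\<close>. It is contained in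
  \<^term>\<open>Dq q'\<close> for $q < q'$, and under products the exponents just add.\<close>

definition gaussian :: "real \<Rightarrow> (complex \<Rightarrow> complex) set" where
  "gaussian q = {f. smooth f \<and> (\<forall>k. \<exists>B. deriv_bound k 1 (\<lambda>z. B * exp (q * (norm z)\<^sup>2)) f)}"

text \<open>An algebra containing the polynomials in $z$ and $\bar z$, the exponentials, the smooth
  periodic functions and the test functions.\<close>

definition subgaussian :: "(complex \<Rightarrow> complex) set" where
  "subgaussian = (\<Inter>q\<in>{0<..}. gaussian q)"

lemma gaussian_smooth: "f \<in> gaussian q \<Longrightarrow> smooth f" 
  by (simp add: gaussian_def)

lemma subgaussian_smooth: "f \<in> subgaussian \<Longrightarrow> smooth f"
  using gaussian_smooth[of f 1] by (simp add: subgaussian_def)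

lemma subgaussian_gaussian: "f \<in> subgaussian \<Longrightarrow> 0 < q \<Longrightarrow> f \<in> gaussian q"
  by (simp add: subgaussian_def)

lemma gaussian_deriv_bound: 
  assumes "f \<in> gaussian q" obtains B where "0 \<le> B" "deriv_bound k 1 (\<lambda>z. B * exp (q * (norm z)\<^sup>2)) f"
proof -
  obtain B where B: "deriv_bound k 1 (\<lambda>z. B * exp (q * (norm z)\<^sup>2)) f"
    using assms by (auto simp: gaussian_def)
  moreover have "0 \<le> B" using deriv_bound_nonneg[OF B, of 0] by simp
  ultimately show ?thesis using that by blast
qed

lemma gaussianI: "smooth f \<Longrightarrow> (\<And>k. \<exists>B. deriv_bound k 1 (\<lambda>z. B * exp (q * (norm z)\<^sup>2)) f) \<Longrightarrow> f \<in> gaussian q"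
  by (simp add: gaussian_def)

lemma gaussian_add: 
  assumes "f \<in> gaussian q" "g \<in> gaussian q" shows "(\<lambda>z. f z + g z) \<in> gaussian q"
proof (rule gaussianI)
  fix k
  obtain B where B: "0 \<le> B" "deriv_bound k 1 (\<lambda>z. B * exp (q * (norm z)\<^sup>2)) f"
    using gaussian_deriv_bound[OF assms(1)] by blast
  obtain C where C: "0 \<le> C" "deriv_bound k 1 (\<lambda>z. C * exp (q * (norm z)\<^sup>2)) g"
    using gaussian_deriv_bound[OF assms(2)] by blast
  have "deriv_bound k 1 (\<lambda>z. (B + C) * exp (q * (norm z)\<^sup>2)) (\<lambda>z. f z + g z)"
    unfolding distrib_right using assms B C by (intro deriv_bound_add gaussian_smooth)
  then show "\<exists>B. deriv_bound k 1 (\<lambda>z. B * exp (q * (norm z)\<^sup>2)) (\<lambda>z. f z + g z)" ..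
qed (use assms gaussian_smooth smooth_add in blast)

lemma gaussian_mult:
  assumes "f \<in> gaussian q" "g \<in> gaussian q'" shows "(\<lambda>z. f z * g z) \<in> gaussian (q + q')"
proof (rule gaussianI)
  fix k
  obtain B where B: "0 \<le> B" "deriv_bound k 1 (\<lambda>z. B * exp (q * (norm z)\<^sup>2)) f"
    using gaussian_deriv_bound[OF assms(1)] by blast
  obtain C where C: "0 \<le> C" "deriv_bound k 1 (\<lambda>z. C * exp (q' * (norm z)\<^sup>2)) g"
    using gaussian_deriv_bound[OF assms(2)] by blast
  have "deriv_bound k 1 (\<lambda>z. 2 ^ k * ((B * exp (q * (norm z)\<^sup>2)) * (C * exp (q' * (norm z)\<^sup>2)))) (\<lambda>z. f z * g z)"
    by (rule deriv_bound_mult[OF gaussian_smooth[OF assms(1)] gaussian_smooth[OF assms(2)] B(2) C(2)]) simp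
  then have "deriv_bound k 1 (\<lambda>z. (2 ^ k * B * C) * exp ((q + q') * (norm z)\<^sup>2)) (\<lambda>z. f z * g z)"
    by (simp add: exp_add distrib_right mult_ac)
  then show "\<exists>B. deriv_bound k 1 (\<lambda>z. B * exp ((q + q') * (norm z)\<^sup>2)) (\<lambda>z. f z * g z)" ..
qed (use assms gaussian_smooth smooth_mult in blast)

lemma gaussian_const: 
  assumes "0 \<le> q" shows "(\<lambda>_. c) \<in> gaussian q"
proof (rule gaussianI)
  fix k
  have "deriv_bound k 1 (\<lambda>z. norm c * exp (q * (norm z)\<^sup>2)) (\<lambda>_. c)"
    using deriv_bound_const[of 1 k c] by (rule deriv_bound_weaken) (use assms in \<open>auto intro!: mult_le_cancel_left1[THEN iffD2]\<close>)
  then show "\<exists>B. deriv_bound k 1 (\<lambda>z. B * exp (q * (norm z)\<^sup>2)) (\<lambda>_. c)" ..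
qed simp

lemma gaussian_cmult: "f \<in> gaussian q \<Longrightarrow> (\<lambda>z. c * f z) \<in> gaussian q"
  using gaussian_mult[OF gaussian_const[of 0 c], of f q] by simp

lemma gaussian_diff: "f \<in> gaussian q \<Longrightarrow> g \<in> gaussian q \<Longrightarrow> (\<lambda>z. f z - g z) \<in> gaussian q"
  using gaussian_add[of f q "\<lambda>z. (-1) * g z"] gaussian_cmult[of g q "-1"] by simp

lemma gaussian_zero: "(\<lambda>_. 0) \<in> gaussian q"
proof (rule gaussianI)
  fix k
  have "deriv_bound k 1 (\<lambda>z. 0 * exp (q * (norm z)\<^sup>2)) (\<lambda>_. 0)"
    using deriv_bound_const[of 1 k 0] by simp
  then show "\<exists>B. deriv_bound k 1 (\<lambda>z. B * exp (q * (norm z)\<^sup>2)) (\<lambda>_. 0)" ..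
qed simp

lemma gaussian_sum: "(\<And>i. i \<in> I \<Longrightarrow> f i \<in> gaussian q) \<Longrightarrow> (\<lambda>z. \<Sum>i\<in>I. f i z) \<in> gaussian q"
  by (induction I rule: infinite_finite_induct) (auto intro: gaussian_zero gaussian_add)

lemma subgaussian_mult: "f \<in> subgaussian \<Longrightarrow> g \<in> subgaussian \<Longrightarrow> (\<lambda>z. f z * g z) \<in> subgaussian"
  unfolding subgaussian_def using gaussian_mult[of f "q / 2" g "q / 2" for q] by auto

lemma subgaussian_const: "(\<lambda>_. c) \<in> subgaussian"
  by (simp add: subgaussian_def gaussian_const)

lemma subgaussian_diff: "f \<in> subgaussian \<Longrightarrow> g \<in> subgaussian \<Longrightarrow> (\<lambda>z. f z - g z) \<in> subgaussian"
  by (simp add: subgaussian_def gaussian_diff)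

lemma subgaussian_sum: "(\<And>i. i \<in> I \<Longrightarrow> f i \<in> subgaussian) \<Longrightarrow> (\<lambda>z. \<Sum>i\<in>I. f i z) \<in> subgaussian"
  by (simp add: subgaussian_def gaussian_sum)

lemma subgaussian_power: "f \<in> subgaussian \<Longrightarrow> (\<lambda>z. f z ^ n) \<in> subgaussian"
  by (induction n) (auto intro: subgaussian_const subgaussian_mult)

lemma subgaussian_bounded:
  assumes "smooth f" "\<And>k. \<exists>B. deriv_bound k 1 (\<lambda>_. B) f" shows "f \<in> subgaussian"
  unfolding subgaussian_def
proof (intro INT_I gaussianI)
  fix q :: real and k assume q: "q \<in> {0<..}"
  obtain B where B: "deriv_bound k 1 (\<lambda>_. B) f" using assms(2) by blast
  have "deriv_bound k 1 (\<lambda>z. B * exp (q * (norm z)\<^sup>2)) f"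
    using B by (rule deriv_bound_weaken) (use q deriv_bound_nonneg[OF B] in \<open>auto intro!: mult_le_cancel_left1[THEN iffD2]\<close>)
  then show "\<exists>B. deriv_bound k 1 (\<lambda>z. B * exp (q * (norm z)\<^sup>2)) f" ..
qed (rule assms(1))

text \<open>Completing the square.\<close>

lemma linear_le_gauss:
  fixes q :: real assumes "0 < q" shows "c * r \<le> c\<^sup>2 / (4 * q) + q * r\<^sup>2"
proof -
  have "0 \<le> (c - 2 * q * r)\<^sup>2 / (4 * q)" using assms by simp
  also have "\<dots> = c\<^sup>2 / (4 * q) + q * r\<^sup>2 - c * r"
    using assms by (simp add: power2_eq_square field_simps)
  finally show ?thesis by simp
qed

lemma exp_le_gauss:
  fixes q :: real assumes "0 < q" shows "exp (c * r) \<le> exp (c\<^sup>2 / (4 * q)) * exp (q * r\<^sup>2)"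
  using linear_le_gauss[OF assms] by (simp flip: exp_add)

lemma subgaussian_expI:
  assumes "smooth f" "\<And>k. \<exists>B c. deriv_bound k 1 (\<lambda>z. B * exp (c * norm z)) f" shows "f \<in> subgaussian"
  unfolding subgaussian_def
proof (intro INT_I gaussianI)
  fix q :: real and k assume q: "q \<in> {0<..}"
  obtain B c where B: "deriv_bound k 1 (\<lambda>z. B * exp (c * norm z)) f" using assms(2) by blast
  have B0: "0 \<le> B" using deriv_bound_nonneg[OF B, of 0] by simp
  have "deriv_bound k 1 (\<lambda>z. (B * exp (c\<^sup>2 / (4 * q))) * exp (q * (norm z)\<^sup>2)) f"
    using B by (rule deriv_bound_weaken) (use q B0 exp_le_gauss[of q c] in \<open>auto simp: mult.assoc intro!: mult_left_mono\<close>)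
  then show "\<exists>B. deriv_bound k 1 (\<lambda>z. B * exp (q * (norm z)\<^sup>2)) f" ..
qed (rule assms(1))

text \<open>A common eigenfunction of both partial derivatives only picks up its eigenvalues.\<close>

lemma deriv_bound_eigen:
  assumes "smooth f" "\<And>u. u = 1 \<or> u = \<i> \<Longrightarrow> \<exists>c. norm c \<le> \<rho> \<and> dir_deriv u f = (\<lambda>z. c * f z)" "0 \<le> \<rho>"
  shows "deriv_bound k \<rho> (\<lambda>z. norm (f z)) f"
proof (induction k)
  case (Suc k)
  show ?case
  proof (rule deriv_bound_SucI)
    fix u :: complex assume "u = 1 \<or> u = \<i>"
    then obtain c where c: "norm c \<le> \<rho>" "dir_deriv u f = (\<lambda>z. c * f z)"
      using assms(2) by blast
    have "deriv_bound k \<rho> (\<lambda>z. norm c * norm (f z)) (\<lambda>z. c * f z)"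
      using assms(1) Suc by (rule deriv_bound_cmult)
    then show "deriv_bound k \<rho> (\<lambda>z. \<rho> * norm (f z)) (dir_deriv u f)"
      unfolding c(2) by (rule deriv_bound_weaken) (use assms(3) c(1) in \<open>auto intro: mult_right_mono\<close>)
  qed simp
qed simp

text \<open>The pairing of these exponentials with a functional is its Fourier-Laplace transform. They are
  unimodular characters of the plane exactly when $t = -\bar s$.\<close>

definition linexp :: "complex \<Rightarrow> complex \<Rightarrow> complex \<Rightarrow> complex" where
  "linexp s t w = exp (s * w + t * cnj w)"

lemma linexp_add: "linexp (s + s') (t + t') w = linexp s t w * linexp s' t' w"
  by (simp add: linexp_def exp_add [symmetric] algebra_simps)

lemma linexp_0 [simp]: "linexp 0 0 w = 1"
  by (simp add: linexp_def)

lemma smooth_linexp: "smooth (linexp s t)"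
  unfolding linexp_def[abs_def] by (intro smooth_intros)

lemma dir_deriv_linexp: "dir_deriv u (linexp s t) = (\<lambda>w. (s * u + t * cnj u) * linexp s t w)"
proof
  fix w
  have "((\<lambda>w. s * w + t * cnj w) has_derivative (\<lambda>u. s * u + t * cnj u)) (at w)"
    by (auto intro!: derivative_eq_intros)
  then have 1: "dir_deriv u (\<lambda>w. s * w + t * cnj w) w = s * u + t * cnj u" "(\<lambda>w. s * w + t * cnj w) differentiable at w"
    using dir_deriv_eq by (blast, auto simp: differentiable_def)
  show "dir_deriv u (linexp s t) w = (s * u + t * cnj u) * linexp s t w"
    unfolding linexp_def[abs_def] using dir_deriv_exp(2)[OF 1(2), of u] 1(1) by simp
qed

lemma deriv_bound_linexp: "deriv_bound k (norm s + norm t) (\<lambda>w. norm (linexp s t w)) (linexp s t)"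
proof (rule deriv_bound_eigen[OF smooth_linexp])
  fix u :: complex assume "u = 1 \<or> u = \<i>"
  then have "norm (s * u + t * cnj u) \<le> norm s + norm t"
    using norm_triangle_ineq[of "s * u" "t * cnj u"] by (auto simp: norm_mult)
  then show "\<exists>c. norm c \<le> norm s + norm t \<and> dir_deriv u (linexp s t) = (\<lambda>z. c * linexp s t z)"
    using dir_deriv_linexp by blast
qed simp

lemma norm_linexp_le: "norm (linexp s t w) \<le> exp ((norm s + norm t) * norm w)"
proof -
  have "norm (linexp s t w) \<le> exp (norm (s * w + t * cnj w))"
    unfolding linexp_def by (rule norm_exp)
  also have "norm (s * w + t * cnj w) \<le> (norm s + norm t) * norm w"
    using norm_triangle_ineq[of "s * w" "t * cnj w"] by (simp add: norm_mult distrib_right)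
  finally show ?thesis by simp
qed

lemma subgaussian_linexp: "linexp s t \<in> subgaussian"
proof (rule subgaussian_expI[OF smooth_linexp])
  fix k
  let ?\<rho> = "1 + norm s + norm t"
  have "deriv_bound k ?\<rho> (\<lambda>w. norm (linexp s t w)) (linexp s t)"
    using deriv_bound_linexp by (rule deriv_bound_mono) auto
  then have "deriv_bound k 1 (\<lambda>z. ?\<rho> ^ k * norm (linexp s t z)) (linexp s t)"
    by (rule deriv_bound_to_1[rotated]) simp
  then have "deriv_bound k 1 (\<lambda>z. ?\<rho> ^ k * exp ((norm s + norm t) * norm z)) (linexp s t)"
    by (rule deriv_bound_weaken) (auto intro!: mult_left_mono norm_linexp_le)
  then show "\<exists>B c. deriv_bound k 1 (\<lambda>z. B * exp (c * norm z)) (linexp s t)" by blast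
qed

lemma one_add_le_exp: "1 + r \<le> exp (r::real)"
  using exp_ge_add_one_self[of r] by simp

text \<open>Here $\kappa$ is $z$ or $\bar z$, so that differentiation of the transform in $s$ and in $t$
  can be treated together.\<close>

lemma dir_deriv_coord: "\<kappa> = (\<lambda>z. z) \<or> \<kappa> = cnj \<Longrightarrow> dir_deriv u \<kappa> = (\<lambda>_. \<kappa> u)"
proof -
  have "dir_deriv u cnj z = cnj u" for z
    by (rule dir_deriv_eq) (auto intro!: derivative_eq_intros)
  then show "\<kappa> = (\<lambda>z. z) \<or> \<kappa> = cnj \<Longrightarrow> dir_deriv u \<kappa> = (\<lambda>_. \<kappa> u)"
    by (auto simp: dir_deriv_id)
qed

lemma smooth_coord: "\<kappa> = (\<lambda>z. z) \<or> \<kappa> = cnj \<Longrightarrow> smooth \<kappa>"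
  using smooth_id smooth_cnj[OF smooth_id] by auto

lemma deriv_bound_coord:
  assumes "\<kappa> = (\<lambda>z. z) \<or> \<kappa> = cnj" shows "deriv_bound k 1 (\<lambda>z. 1 + norm z) \<kappa>"
proof (cases k)
  case 0
  then show ?thesis using assms by auto
next
  case (Suc k')
  show ?thesis unfolding Suc
  proof (rule deriv_bound_SucI)
    show "norm (\<kappa> z) \<le> 1 + norm z" for z using assms by auto
    fix u :: complex assume u: "u = 1 \<or> u = \<i>"
    then have nu: "norm (\<kappa> u) = 1" using assms by auto
    show "deriv_bound k' 1 (\<lambda>z. 1 * (1 + norm z)) (dir_deriv u \<kappa>)"
      unfolding dir_deriv_coord[OF assms] by (rule deriv_bound_weaken[OF deriv_bound_const]) (auto simp: nu)
  qed
qed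

lemma subgaussian_coord: assumes "\<kappa> = (\<lambda>z. z) \<or> \<kappa> = cnj" shows "\<kappa> \<in> subgaussian"
proof (rule subgaussian_expI[OF smooth_coord[OF assms]])
  fix k
  have "deriv_bound k 1 (\<lambda>z. 1 * exp (1 * norm z)) \<kappa>"
    by (rule deriv_bound_weaken[OF deriv_bound_coord[OF assms]]) (auto simp: one_add_le_exp)
  then show "\<exists>B c. deriv_bound k 1 (\<lambda>z. B * exp (c * norm z)) \<kappa>" by blast
qed

lemma subgaussian_id: "(\<lambda>z. z) \<in> subgaussian" and subgaussian_cnj: "cnj \<in> subgaussian"
  using subgaussian_coord by auto

text \<open>A functional is a total function, but only its values on \<^term>\<open>gaussian q\<close> matter.
  The order $m$ of the continuity estimate is made explicit: it controls the growth of the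
  transform on characters and, in the end, the order of the derivatives of the delta
  distributions.\<close>

definition gauss_functional :: "real \<Rightarrow> nat \<Rightarrow> dist \<Rightarrow> bool" where
  "gauss_functional q m H \<longleftrightarrow>
     (\<forall>f\<in>gaussian q. \<forall>g\<in>gaussian q. H (\<lambda>z. f z + g z) = H f + H g) \<and>
     (\<forall>c. \<forall>f\<in>gaussian q. H (\<lambda>z. c * f z) = c * H f) \<and>
     (\<exists>C\<ge>0. \<forall>f\<in>gaussian q. \<forall>B. deriv_bound m 1 (\<lambda>z. B * exp (q * (norm z)\<^sup>2)) f \<longrightarrow> norm (H f) \<le> C * B)"

lemma gauss_functional_add: "gauss_functional q m H \<Longrightarrow> f \<in> gaussian q \<Longrightarrow> g \<in> gaussian q \<Longrightarrow> H (\<lambda>z. f z + g z) = H f + H g"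
  by (simp add: gauss_functional_def)

lemma gauss_functional_cmult: "gauss_functional q m H \<Longrightarrow> f \<in> gaussian q \<Longrightarrow> H (\<lambda>z. c * f z) = c * H f"
  by (simp add: gauss_functional_def)

lemma gauss_functional_bound:
  assumes "gauss_functional q m H"
  obtains C where "0 \<le> C" "\<And>f B. f \<in> gaussian q \<Longrightarrow> deriv_bound m 1 (\<lambda>z. B * exp (q * (norm z)\<^sup>2)) f \<Longrightarrow> norm (H f) \<le> C * B"
  using assms unfolding gauss_functional_def by blast

lemma gauss_functional_zero: "gauss_functional q m H \<Longrightarrow> H (\<lambda>_. 0) = 0"
  using gauss_functional_cmult[of q m H "\<lambda>_. 0" 0] gaussian_zero by simp

lemma gauss_functional_diff: "gauss_functional q m H \<Longrightarrow> f \<in> gaussian q \<Longrightarrow> g \<in> gaussian q \<Longrightarrow> H (\<lambda>z. f z - g z) = H f - H g"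
  using gauss_functional_add[of q m H f "\<lambda>z. (-1) * g z"] gauss_functional_cmult[of q m H g "-1"] gaussian_cmult[of g q "-1"] by simp

lemma gauss_functional_sum:
  assumes "gauss_functional q m H"
  shows "finite I \<Longrightarrow> (\<And>i. i \<in> I \<Longrightarrow> f i \<in> gaussian q) \<Longrightarrow> H (\<lambda>z. \<Sum>i\<in>I. f i z) = (\<Sum>i\<in>I. H (f i))"
  by (induction I rule: finite_induct) (auto simp: gauss_functional_zero[OF assms] gauss_functional_add[OF assms] gaussian_sum)

text \<open>Multiplication by a function of growth $e^{q_1|z|^2}$ uses up $q_1$ of the exponent and leaves
  the order $m$ unchanged.\<close>

lemma gauss_functional_mult:
  assumes H: "gauss_functional (q1 + q2) m H" and a: "a \<in> gaussian q1"
  shows "gauss_functional q2 m (\<lambda>f. H (\<lambda>z. a z * f z))"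
proof -
  obtain C where C: "0 \<le> C" "\<And>f B. f \<in> gaussian (q1 + q2) \<Longrightarrow> deriv_bound m 1 (\<lambda>z. B * exp ((q1 + q2) * (norm z)\<^sup>2)) f \<Longrightarrow> norm (H f) \<le> C * B"
    using gauss_functional_bound[OF H] by blast
  obtain A where A: "0 \<le> A" "deriv_bound m 1 (\<lambda>z. A * exp (q1 * (norm z)\<^sup>2)) a"
    using gaussian_deriv_bound[OF a] by blast
  have "norm (H (\<lambda>z. a z * f z)) \<le> (C * (2 ^ m * A)) * B" 
    if f: "f \<in> gaussian q2" and B: "deriv_bound m 1 (\<lambda>z. B * exp (q2 * (norm z)\<^sup>2)) f" for f B
  proof -
    have "deriv_bound m 1 (\<lambda>z. 2 ^ m * ((A * exp (q1 * (norm z)\<^sup>2)) * (B * exp (q2 * (norm z)\<^sup>2)))) (\<lambda>z. a z * f z)"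
      by (rule deriv_bound_mult[OF gaussian_smooth[OF a] gaussian_smooth[OF f] A(2) B]) simp
    then have "deriv_bound m 1 (\<lambda>z. (2 ^ m * A * B) * exp ((q1 + q2) * (norm z)\<^sup>2)) (\<lambda>z. a z * f z)"
      by (simp add: exp_add distrib_right mult_ac)
    then show ?thesis
      using C(2)[OF gaussian_mult[OF a f]] by (simp add: mult.assoc)
  qed
  moreover have "0 \<le> C * (2 ^ m * A)" using A C by simp
  ultimately have bound: "\<exists>C\<ge>0. \<forall>f\<in>gaussian q2. \<forall>B. deriv_bound m 1 (\<lambda>z. B * exp (q2 * (norm z)\<^sup>2)) f \<longrightarrow> norm (H (\<lambda>z. a z * f z)) \<le> C * B"
    by blast
  have add: "H (\<lambda>z. a z * (f z + g z)) = H (\<lambda>z. a z * f z) + H (\<lambda>z. a z * g z)"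
    if "f \<in> gaussian q2" "g \<in> gaussian q2" for f g
    unfolding distrib_left using that by (intro gauss_functional_add[OF H] gaussian_mult a)
  have scale: "H (\<lambda>z. a z * (c * f z)) = c * H (\<lambda>z. a z * f z)" if "f \<in> gaussian q2" for c f
    using gauss_functional_cmult[OF H gaussian_mult[OF a that], of c] by (simp add: mult.left_commute)
  show ?thesis unfolding gauss_functional_def using bound add scale by blast
qed

lemma gauss_functional_mult0:
  assumes "gauss_functional q m H" "a \<in> subgaussian" "0 < q'" "q' < q" shows "gauss_functional q' m (\<lambda>f. H (\<lambda>z. a z * f z))"
  using gauss_functional_mult[of "q - q'" q' m H a] subgaussian_gaussian[OF assms(2), of "q - q'"] assms by simp

lemma deriv_bound_gauss_of_deriv_bound:
  assumes "deriv_bound m 1 (\<lambda>_. B) f" "0 \<le> q" shows "deriv_bound m 1 (\<lambda>z. B * exp (q * (norm z)\<^sup>2)) f"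
  using assms(1) by (rule deriv_bound_weaken) (use deriv_bound_nonneg[OF assms(1)] assms(2) in \<open>auto intro!: mult_le_cancel_left1[THEN iffD2]\<close>)

text \<open>Differentiation under the functional. The remainder $e^{h\kappa} - 1 - h\kappa$ is bounded,
  with all its derivatives, by $|h|^2 e^{3|w|}$, so continuity of $H$ bounds the error of the
  difference quotient by a multiple of $|h|$.\<close>

lemma gauss_functional_linexp_deriv:
  assumes H: "gauss_functional q m H" and q: "0 < q" and A: "A \<in> subgaussian" and l: "\<kappa> = (\<lambda>z. z) \<or> \<kappa> = cnj"
  shows "((\<lambda>s. H (\<lambda>w. exp (s * \<kappa> w) * A w)) has_field_derivative H (\<lambda>w. \<kappa> w * exp (s * \<kappa> w) * A w)) (at s)"
proof -
  have E: "(\<lambda>w. exp (h * \<kappa> w)) \<in> subgaussian" for h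
    using l subgaussian_linexp[of h 0] subgaussian_linexp[of 0 h] by (auto simp: linexp_def[abs_def])
  have sE: "smooth (\<lambda>w. exp (h * \<kappa> w))" for h using subgaussian_smooth[OF E] .
  have sl: "smooth \<kappa>" using smooth_coord[OF l] .
  have nl: "norm (\<kappa> w) = norm w" for w using l by auto
  have ddE: "dir_deriv u (\<lambda>w. exp (h * \<kappa> w)) = (\<lambda>w. (h * \<kappa> u) * exp (h * \<kappa> w))" for u h
  proof
    fix w
    have "dir_deriv u (\<lambda>w. h * \<kappa> w) w = h * \<kappa> u"
      using dir_deriv_cmult_smooth[OF sl, of u h] dir_deriv_coord[OF l, of u] by simp
    then show "dir_deriv u (\<lambda>w. exp (h * \<kappa> w)) w = (h * \<kappa> u) * exp (h * \<kappa> w)"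
      using dir_deriv_exp(2)[OF smooth_differentiable[OF smooth_mult[OF smooth_const sl]], of u h] by simp
  qed
  \<comment> \<open>The remainder; its derivatives lead back to $e^{h\kappa} - 1$ and to
    $e^{h\kappa}$, which are bounded first.\<close>
  define R where "R h = (\<lambda>w. exp (h * \<kappa> w) - 1 - h * \<kappa> w)" for h
  have bE: "deriv_bound k 1 (\<lambda>w. exp (norm w)) (\<lambda>w. exp (h * \<kappa> w))" if "norm h \<le> 1" for h k
  proof -
    have a: "deriv_bound k 1 (\<lambda>w. norm (exp (h * \<kappa> w))) (\<lambda>w. exp (h * \<kappa> w))"
    proof (rule deriv_bound_eigen[OF sE])
      fix u :: complex assume "u = 1 \<or> u = \<i>"
      then have "norm (h * \<kappa> u) \<le> 1" using that by (auto simp: norm_mult nl)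
      then show "\<exists>c. norm c \<le> 1 \<and> dir_deriv u (\<lambda>w. exp (h * \<kappa> w)) = (\<lambda>z. c * exp (h * \<kappa> z))"
        using ddE by blast
    qed simp
    have b: "norm (exp (h * \<kappa> w)) \<le> exp (norm w)" for w
    proof -
      have "norm (exp (h * \<kappa> w)) \<le> exp (norm (h * \<kappa> w))" by (rule norm_exp)
      also have "norm (h * \<kappa> w) \<le> 1 * norm w"
        unfolding norm_mult nl using that by (intro mult_right_mono) auto
      finally show ?thesis by simp
    qed
    show ?thesis by (rule deriv_bound_weaken[OF a _ b]) simp
  qed
  have taylor: "norm (exp (h * \<kappa> w) - 1) \<le> norm h * norm w * exp (norm w)"
      "norm (exp (h * \<kappa> w) - 1 - h * \<kappa> w) \<le> (norm h)\<^sup>2 * (norm w)\<^sup>2 * exp (norm w)"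
    if "norm h \<le> 1" for h w
  proof -
    have "\<bar>Re (h * \<kappa> w)\<bar> \<le> norm (h * \<kappa> w)" by (rule abs_Re_le_cmod)
    also have "\<dots> \<le> 1 * norm w" unfolding norm_mult nl using that by (intro mult_right_mono) auto
    finally have e: "exp \<bar>Re (h * \<kappa> w)\<bar> \<le> exp (norm w)" by simp
    have "norm (exp (h * \<kappa> w) - 1) \<le> exp \<bar>Re (h * \<kappa> w)\<bar> * norm (h * \<kappa> w)"
      using Taylor_exp[of "h * \<kappa> w" 0] by simp
    also have "\<dots> \<le> exp (norm w) * (norm h * norm w)"
      using e by (intro mult_mono) (auto simp: norm_mult nl)
    finally show "norm (exp (h * \<kappa> w) - 1) \<le> norm h * norm w * exp (norm w)" by (simp add: mult_ac)
    have "norm (exp (h * \<kappa> w) - 1 - h * \<kappa> w) \<le> exp \<bar>Re (h * \<kappa> w)\<bar> * norm (h * \<kappa> w) ^ 2"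
      using Taylor_exp[of "h * \<kappa> w" 1] by (simp add: numeral_2_eq_2 algebra_simps)
    also have "\<dots> \<le> exp (norm w) * (norm h * norm w) ^ 2"
      using e by (intro mult_mono) (auto simp: norm_mult nl)
    finally show "norm (exp (h * \<kappa> w) - 1 - h * \<kappa> w) \<le> (norm h)\<^sup>2 * (norm w)\<^sup>2 * exp (norm w)"
      by (simp add: mult_ac power_mult_distrib)
  qed
  have bX: "deriv_bound k 1 (\<lambda>w. norm h * ((1 + norm w) * exp (norm w))) (\<lambda>w. exp (h * \<kappa> w) - 1)" if h: "norm h \<le> 1" for h k
  proof -
    have val: "norm (exp (h * \<kappa> w) - 1) \<le> norm h * ((1 + norm w) * exp (norm w))" for w
      using taylor(1)[OF h, of w] by (simp add: algebra_simps add_increasing)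
    show ?thesis
    proof (cases k)
      case 0
      then show ?thesis using val by simp
    next
      case (Suc k')
      show ?thesis unfolding Suc
      proof (rule deriv_bound_SucI[OF val])
        fix u :: complex assume "u = 1 \<or> u = \<i>"
        then have nu: "norm (h * \<kappa> u) = norm h" by (auto simp: norm_mult nl)
        have "dir_deriv u (\<lambda>w. exp (h * \<kappa> w) - 1) = (\<lambda>w. (h * \<kappa> u) * exp (h * \<kappa> w))"
          using dir_deriv_add_smooth[OF sE[of h] smooth_const[of "-1"], of u] by (simp add: ddE)
        moreover have "deriv_bound k' 1 (\<lambda>w. norm (h * \<kappa> u) * exp (norm w)) (\<lambda>w. (h * \<kappa> u) * exp (h * \<kappa> w))"
          by (rule deriv_bound_cmult[OF sE bE[OF h]])
        ultimately show "deriv_bound k' 1 (\<lambda>w. 1 * (norm h * ((1 + norm w) * exp (norm w)))) (dir_deriv u (\<lambda>w. exp (h * \<kappa> w) - 1))"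
          by (simp only: nu) (rule deriv_bound_weaken, auto intro!: mult_left_mono)
      qed
    qed
  qed
  have bR: "deriv_bound k 1 (\<lambda>w. (norm h)\<^sup>2 * exp (3 * norm w)) (R h)" if h: "norm h \<le> 1" for h k
  proof -
    have e3: "(1 + norm w) * (1 + norm w) * exp (norm w) \<le> exp (3 * norm w)" for w :: complex
    proof -
      have "(1 + norm w) * (1 + norm w) * exp (norm w) \<le> exp (norm w) * exp (norm w) * exp (norm w)"
        by (intro mult_mono one_add_le_exp) auto
      also have "\<dots> = exp (3 * norm w)" by (simp flip: exp_add)
      finally show ?thesis .
    qed
    have "(norm h)\<^sup>2 * (norm w)\<^sup>2 * exp (norm w) \<le> (norm h)\<^sup>2 * exp (3 * norm w)" for w :: complex
    proof -
      have "(norm w)\<^sup>2 * exp (norm w) \<le> (1 + norm w) * (1 + norm w) * exp (norm w)"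
        unfolding power2_eq_square by (intro mult_mono) auto
      also note e3[of w]
      finally have "(norm h)\<^sup>2 * ((norm w)\<^sup>2 * exp (norm w)) \<le> (norm h)\<^sup>2 * exp (3 * norm w)"
        by (rule mult_left_mono) simp
      then show ?thesis by (simp only: mult.assoc)
    qed
    then have val: "norm (R h w) \<le> (norm h)\<^sup>2 * exp (3 * norm w)" for w
      using taylor(2)[OF h, of w] order_trans unfolding R_def by blast
    show ?thesis
    proof (cases k)
      case 0
      then show ?thesis using val by simp
    next
      case (Suc k')
      show ?thesis unfolding Suc
      proof (rule deriv_bound_SucI[OF val])
        fix u :: complex assume "u = 1 \<or> u = \<i>"
        then have nu: "norm (h * \<kappa> u) = norm h" by (auto simp: norm_mult nl)
        have "dir_deriv u (R h) = (\<lambda>w. dir_deriv u (\<lambda>w. exp (h * \<kappa> w) - 1) w + dir_deriv u (\<lambda>w. (-h) * \<kappa> w) w)"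
          unfolding R_def using dir_deriv_add_smooth[of "\<lambda>w. exp (h * \<kappa> w) - 1" "\<lambda>w. (-h) * \<kappa> w" u] sE sl
          by (simp add: smooth_diff smooth_mult smooth_minus)
        moreover have "dir_deriv u (\<lambda>w. exp (h * \<kappa> w) - 1) = (\<lambda>w. (h * \<kappa> u) * exp (h * \<kappa> w))"
          using dir_deriv_add_smooth[OF sE[of h] smooth_const[of "-1"], of u] by (simp add: ddE)
        moreover have "dir_deriv u (\<lambda>w. (-h) * \<kappa> w) = (\<lambda>w. (-h) * \<kappa> u)"
          using dir_deriv_cmult_smooth[OF sl] dir_deriv_coord[OF l] by metis
        ultimately have "dir_deriv u (R h) = (\<lambda>w. (h * \<kappa> u) * (exp (h * \<kappa> w) - 1))"
          by (simp add: algebra_simps)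
        moreover have "deriv_bound k' 1 (\<lambda>w. norm (h * \<kappa> u) * (norm h * ((1 + norm w) * exp (norm w)))) (\<lambda>w. (h * \<kappa> u) * (exp (h * \<kappa> w) - 1))"
          by (rule deriv_bound_cmult[OF smooth_diff[OF sE smooth_const] bX[OF h]])
        moreover have "(1 + norm w) * exp (norm w) \<le> exp (3 * norm w)" for w :: complex
          using e3[of w] mult_right_mono[of 1 "1 + norm w" "(1 + norm w) * exp (norm w)"] by (simp add: mult.assoc)
        ultimately show "deriv_bound k' 1 (\<lambda>w. 1 * ((norm h)\<^sup>2 * exp (3 * norm w))) (dir_deriv u (R h))"
          by (simp only: nu) (rule deriv_bound_weaken, auto simp: power2_eq_square mult.assoc intro!: mult_left_mono)
      qed
    qed
  qed
  \<comment> \<open>The fixed factor is absorbed into the functional; it takes half of the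
    exponent $q$.\<close>
  let ?A = "\<lambda>w. exp (s * \<kappa> w) * A w"
  define K where "K f = H (\<lambda>w. ?A w * f w)" for f
  have K: "gauss_functional (q/2) m K"
    unfolding K_def using q by (intro gauss_functional_mult0[OF H] subgaussian_mult E A) auto
  obtain C where C: "0 \<le> C" "\<And>f B. f \<in> gaussian (q/2) \<Longrightarrow> deriv_bound m 1 (\<lambda>z. B * exp (q/2 * (norm z)\<^sup>2)) f \<Longrightarrow> norm (K f) \<le> C * B"
    using gauss_functional_bound[OF K] by blast
  have q2: "0 < q/2" using q by simp
  have RG: "R h \<in> gaussian (q/2)" for h
    unfolding R_def by (intro subgaussian_gaussian[OF _ q2] subgaussian_diff E subgaussian_mult subgaussian_const subgaussian_coord l)
  define M where "M = C * exp (3\<^sup>2 / (4 * (q/2)))"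
  have KR: "norm (K (R h)) \<le> M * (norm h)\<^sup>2" if "norm h \<le> 1" for h
  proof -
    have "deriv_bound m 1 (\<lambda>z. ((norm h)\<^sup>2 * exp (3\<^sup>2 / (4 * (q/2)))) * exp (q/2 * (norm z)\<^sup>2)) (R h)"
      using bR[OF that] by (rule deriv_bound_weaken) (use exp_le_gauss[OF q2, of 3] in \<open>auto simp: mult.assoc intro!: mult_left_mono\<close>)
    from C(2)[OF RG this] show ?thesis by (simp add: M_def mult_ac)
  qed
  have id: "H (\<lambda>w. exp ((s + h) * \<kappa> w) * A w) - H ?A - h * H (\<lambda>w. \<kappa> w * exp (s * \<kappa> w) * A w) = K (R h)" for h
  proof -
    have "K (R h) = K (\<lambda>w. exp (h * \<kappa> w) - 1) - K (\<lambda>w. h * \<kappa> w)"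
      unfolding R_def by (intro gauss_functional_diff[OF K] subgaussian_gaussian[OF _ q2] subgaussian_diff E subgaussian_mult subgaussian_const subgaussian_coord l)
    also have "K (\<lambda>w. exp (h * \<kappa> w) - 1) = K (\<lambda>w. exp (h * \<kappa> w)) - K (\<lambda>_. 1)"
      by (intro gauss_functional_diff[OF K] subgaussian_gaussian[OF _ q2] E subgaussian_const)
    also have "K (\<lambda>w. h * \<kappa> w) = h * K \<kappa>"
      by (intro gauss_functional_cmult[OF K] subgaussian_gaussian[OF _ q2] subgaussian_coord l)
    finally have fin: "K (R h) = K (\<lambda>w. exp (h * \<kappa> w)) - K (\<lambda>_. 1) - h * K \<kappa>" .
    have e1: "(\<lambda>w. exp ((s + h) * \<kappa> w) * A w) = (\<lambda>w. ?A w * exp (h * \<kappa> w))"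
      by (simp add: fun_eq_iff distrib_right exp_add)
    have e2: "(\<lambda>w. \<kappa> w * exp (s * \<kappa> w) * A w) = (\<lambda>w. ?A w * \<kappa> w)"
      by (simp add: fun_eq_iff)
    show ?thesis
      unfolding e1 e2 fin unfolding K_def by simp
  qed
  show ?thesis
    unfolding DERIV_def
  proof (rule Lim_transform_bound[where g = "\<lambda>h. of_real (M * norm h)" and 'a = complex, THEN LIM_zero_cancel])
    have "norm ((H (\<lambda>w. exp ((s + h) * \<kappa> w) * A w) - H ?A) / h - H (\<lambda>w. \<kappa> w * exp (s * \<kappa> w) * A w)) \<le> M * norm h"
      if "h \<noteq> 0" "norm h < 1" for h
    proof -
      have "(H (\<lambda>w. exp ((s + h) * \<kappa> w) * A w) - H ?A) / h - H (\<lambda>w. \<kappa> w * exp (s * \<kappa> w) * A w) = K (R h) / h"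
        unfolding id[symmetric] using that by (simp add: field_simps)
      then show ?thesis
        using KR[of h] that by (simp add: norm_divide divide_le_eq power2_eq_square mult.assoc)
    qed
    moreover have "0 \<le> M" using C by (simp add: M_def)
    ultimately show "\<forall>\<^sub>F h in at 0. norm ((H (\<lambda>w. exp ((s + h) * \<kappa> w) * A w) - H ?A) / h - H (\<lambda>w. \<kappa> w * exp (s * \<kappa> w) * A w)) \<le> norm (complex_of_real (M * norm h))"
      unfolding eventually_at by (intro exI[of _ 1]) (auto simp: norm_mult)
    show "((\<lambda>h. complex_of_real (M * norm h)) \<longlongrightarrow> 0) (at (0::complex))"
      by (intro tendsto_eq_intros) auto
  qed
qed

text \<open>A character has modulus one and its derivatives of order at most $m$ are bounded by $(1 +
  2|s|)^m$. So the transform has polynomial growth on the line $t = -\bar s$, although elsewhere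
  only exponential bounds of order two are available.\<close>

lemma gauss_functional_character_bound:
  assumes H: "gauss_functional q m H" and q: "0 < q" and A: "A \<in> subgaussian"
  obtains C where "0 \<le> C" "\<And>s. norm (H (\<lambda>w. linexp s (- cnj s) w * A w)) \<le> C * (1 + 2 * norm s) ^ m"
proof -
  define K where "K f = H (\<lambda>w. A w * f w)" for f
  have K: "gauss_functional (q/2) m K"
    unfolding K_def using q by (intro gauss_functional_mult0[OF H] A) auto
  obtain C where C: "0 \<le> C" "\<And>f B. f \<in> gaussian (q/2) \<Longrightarrow> deriv_bound m 1 (\<lambda>z. B * exp (q/2 * (norm z)\<^sup>2)) f \<Longrightarrow> norm (K f) \<le> C * B"
    using gauss_functional_bound[OF K] by blast
  show ?thesis
  proof (rule that[OF C(1)])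
    fix s :: complex
    let ?\<rho> = "1 + 2 * norm s"
    have "deriv_bound m ?\<rho> (\<lambda>w. norm (linexp s (- cnj s) w)) (linexp s (- cnj s))"
      using deriv_bound_linexp[of m s "- cnj s"] by (rule deriv_bound_mono) auto
    then have "deriv_bound m 1 (\<lambda>w. ?\<rho> ^ m * norm (linexp s (- cnj s) w)) (linexp s (- cnj s))"
      by (rule deriv_bound_to_1[rotated]) simp
    moreover have "norm (linexp s (- cnj s) w) = 1" for w
      by (simp add: linexp_def norm_exp_eq_Re)
    ultimately have "deriv_bound m 1 (\<lambda>_. ?\<rho> ^ m) (linexp s (- cnj s))" by simp
    then have "deriv_bound m 1 (\<lambda>z. ?\<rho> ^ m * exp (q/2 * (norm z)\<^sup>2)) (linexp s (- cnj s))"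
      by (rule deriv_bound_gauss_of_deriv_bound) (use q in simp)
    from C(2)[OF subgaussian_gaussian[OF subgaussian_linexp] this]
    show "norm (H (\<lambda>w. linexp s (- cnj s) w * A w)) \<le> C * ?\<rho> ^ m"
      using q by (simp add: K_def mult.commute)
  qed
qed

section \<open>The dual of the Gaussian space\<close>

text \<open>A strictly smaller exponent turns big-O into little-o.\<close>

lemma gaussian_subset_Dq:
  assumes "q' < q" shows "gaussian q' \<subseteq> Dq q"
proof
  fix f assume f: "f \<in> gaussian q'"
  have "(\<lambda>z. norm (D \<alpha> f z)) \<in> o[at_infinity](\<lambda>z. exp (q * (norm z)\<^sup>2))" for \<alpha>
  proof -
    obtain B where B: "0 \<le> B" "deriv_bound (mi_order \<alpha>) 1 (\<lambda>z. B * exp (q' * (norm z)\<^sup>2)) f"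
      using gaussian_deriv_bound[OF f] by blast
    have le: "norm (D \<alpha> f z) \<le> B * exp (q' * (norm z)\<^sup>2)" for z
      using deriv_bound_D[OF gaussian_smooth[OF f] B(2)] by simp
    have "((\<lambda>z. norm (D \<alpha> f z) / exp (q * (norm z)\<^sup>2)) \<longlongrightarrow> 0) at_infinity"
    proof (rule Lim_null_comparison)
      have "norm (D \<alpha> f z) / exp (q * (norm z)\<^sup>2) \<le> B * exp (- (q - q') * (norm z)\<^sup>2)" for z
      proof -
        have "norm (D \<alpha> f z) / exp (q * (norm z)\<^sup>2) \<le> B * exp (q' * (norm z)\<^sup>2) / exp (q * (norm z)\<^sup>2)"
          using le by (intro divide_right_mono) auto
        also have "\<dots> = B * exp (- (q - q') * (norm z)\<^sup>2)"
          by (simp add: exp_diff algebra_simps)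
        finally show ?thesis .
      qed
      then show "\<forall>\<^sub>F z in at_infinity. norm (norm (D \<alpha> f z) / exp (q * (norm z)\<^sup>2)) \<le> B * exp (- (q - q') * (norm z)\<^sup>2)"
        by simp
      have sq: "filterlim (\<lambda>z::complex. (norm z)\<^sup>2) at_top at_infinity"
        by (intro filterlim_pow_at_top filterlim_norm_at_top) auto
      have "filterlim (\<lambda>z::complex. - (q - q') * (norm z)\<^sup>2) at_bot at_infinity"
        by (rule filterlim_tendsto_neg_mult_at_bot[OF tendsto_const _ sq]) (use assms in simp)
      then have "((\<lambda>z::complex. exp (- (q - q') * (norm z)\<^sup>2)) \<longlongrightarrow> 0) at_infinity"
        by (rule filterlim_compose[OF exp_at_bot])
      then show "((\<lambda>z::complex. B * exp (- (q - q') * (norm z)\<^sup>2)) \<longlongrightarrow> 0) at_infinity"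
        by (rule tendsto_mult_right_zero)
    qed
    then show ?thesis by (intro smalloI_tendsto) auto
  qed
  then show "f \<in> Dq q"
    using gaussian_smooth[OF f] by (simp add: Dq_def)
qed

lemma Dq_smooth: "f \<in> Dq q \<Longrightarrow> smooth f"
  and Dq_smallo: "f \<in> Dq q \<Longrightarrow> (\<lambda>z. norm (D \<alpha> f z)) \<in> o[at_infinity](\<lambda>z. exp (q * (norm z)\<^sup>2))"
  unfolding Dq_def by blast+

lemma Dq_add: "f \<in> Dq q \<Longrightarrow> g \<in> Dq q \<Longrightarrow> (\<lambda>z. f z + g z) \<in> Dq q"
proof -
  assume f: "f \<in> Dq q" and g: "g \<in> Dq q"
  have "(\<lambda>z. norm (D \<alpha> (\<lambda>z. f z + g z) z)) \<in> o[at_infinity](\<lambda>z. exp (q * (norm z)\<^sup>2))" for \<alpha>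
  proof -
    have "(\<lambda>z. norm (D \<alpha> f z) + norm (D \<alpha> g z)) \<in> o[at_infinity](\<lambda>z. exp (q * (norm z)\<^sup>2))"
      by (intro sum_in_smallo Dq_smallo f g)
    moreover have "D \<alpha> (\<lambda>z. f z + g z) = (\<lambda>z. D \<alpha> f z + D \<alpha> g z)"
      using f g by (intro D_add) (auto simp: Dq_def)
    then have "norm (norm (D \<alpha> (\<lambda>z. f z + g z) z)) \<le> 1 * norm (norm (D \<alpha> f z) + norm (D \<alpha> g z))" for z
      by (simp add: norm_triangle_ineq)
    then have "(\<lambda>z. norm (D \<alpha> (\<lambda>z. f z + g z) z)) \<in> O[at_infinity](\<lambda>z. norm (D \<alpha> f z) + norm (D \<alpha> g z))"
      by (intro bigoI[of _ 1] always_eventually) blast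
    ultimately show ?thesis by (rule landau_o.big_small_trans[rotated])
  qed
  then show ?thesis using f g by (simp add: Dq_def smooth_add)
qed

lemma Dq_cmult: "f \<in> Dq q \<Longrightarrow> (\<lambda>z. c * f z) \<in> Dq q"
proof -
  assume f: "f \<in> Dq q"
  have "(\<lambda>z. norm (D \<alpha> (\<lambda>z. c * f z) z)) \<in> o[at_infinity](\<lambda>z. exp (q * (norm z)\<^sup>2))" for \<alpha>
  proof -
    have "D \<alpha> (\<lambda>z. c * f z) = (\<lambda>z. c * D \<alpha> f z)"
      using f by (intro D_cmult) (auto simp: Dq_def)
    then show ?thesis
      using Dq_smallo[OF f, of \<alpha>] by (cases "c = 0") (auto simp: norm_mult)
  qed
  then show ?thesis using f by (simp add: Dq_def smooth_mult)
qed

lemma Dq_diff: "f \<in> Dq q \<Longrightarrow> g \<in> Dq q \<Longrightarrow> (\<lambda>z. f z - g z) \<in> Dq q"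
  using Dq_add[of f q "\<lambda>z. (-1) * g z"] Dq_cmult[of g q "-1"] by simp

text \<open>The little-o condition bounds the weighted derivative outside a disc, compactness inside.\<close>

lemma Dq_seminorm_bdd:
  assumes f: "f \<in> Dq q" shows "bdd_above (range (\<lambda>z. norm (D \<alpha> f z) * exp (- q * (norm z)\<^sup>2)))"
proof -
  let ?h = "\<lambda>z. norm (D \<alpha> f z) * exp (- q * (norm z)\<^sup>2)"
  have "(\<lambda>z. norm (D \<alpha> f z)) \<in> o[at_infinity](\<lambda>z. exp (q * (norm z)\<^sup>2))"
    by (rule Dq_smallo[OF f])
  then have "\<forall>\<^sub>F z in at_infinity. norm (norm (D \<alpha> f z)) \<le> 1 * norm (exp (q * (norm z)\<^sup>2))"
    by (rule landau_o.smallD) simp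
  then obtain R where R: "\<And>z. R \<le> norm z \<Longrightarrow> norm (D \<alpha> f z) \<le> exp (q * (norm z)\<^sup>2)"
    unfolding eventually_at_infinity by auto
  have "continuous_on (cball 0 R) ?h"
    using smooth_continuous[OF smooth_D[of f \<alpha>]] f by (intro continuous_intros) (auto simp: Dq_def)
  then have "bdd_above (?h ` cball 0 R)"
    using compact_continuous_image compact_imp_bounded bounded_imp_bdd_above compact_cball by meson
  then obtain M where "\<forall>y\<in>?h ` cball 0 R. y \<le> M"
    unfolding bdd_above_def by blast
  then have M: "norm z \<le> R \<Longrightarrow> ?h z \<le> M" for z
    by (simp only: ball_simps mem_cball_0)
  have "?h z \<le> max M 1" for z
  proof (cases "norm z \<le> R")
    case True
    then show ?thesis using M[of z] by simp
  next
    case False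
    then have "?h z \<le> exp (q * (norm z)\<^sup>2) * exp (- q * (norm z)\<^sup>2)"
      using R[of z] by (intro mult_right_mono) auto
    also have "\<dots> = 1" by (simp flip: exp_add)
    finally show ?thesis by simp
  qed
  then show ?thesis by (intro bdd_aboveI2)
qed

lemma Dq_seminorm_add:
  assumes f: "f \<in> Dq q" and g: "g \<in> Dq q"
  shows "Dq_seminorm q \<alpha> (\<lambda>z. f z + g z) \<le> Dq_seminorm q \<alpha> f + Dq_seminorm q \<alpha> g"
  unfolding Dq_seminorm_def
proof (rule cSUP_least)
  fix z
  have "D \<alpha> (\<lambda>z. f z + g z) = (\<lambda>z. D \<alpha> f z + D \<alpha> g z)"
    using f g by (intro D_add) (auto simp: Dq_def)
  then have "norm (D \<alpha> (\<lambda>z. f z + g z) z) * exp (- q * (norm z)\<^sup>2)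
     \<le> (norm (D \<alpha> f z) + norm (D \<alpha> g z)) * exp (- q * (norm z)\<^sup>2)"
    by (intro mult_right_mono) (auto simp: norm_triangle_ineq)
  also have "\<dots> = norm (D \<alpha> f z) * exp (- q * (norm z)\<^sup>2) + norm (D \<alpha> g z) * exp (- q * (norm z)\<^sup>2)"
    by (simp add: distrib_right)
  also have "\<dots> \<le> (SUP z. norm (D \<alpha> f z) * exp (- q * (norm z)\<^sup>2)) + (SUP z. norm (D \<alpha> g z) * exp (- q * (norm z)\<^sup>2))"
    by (intro add_mono cSUP_upper Dq_seminorm_bdd f g) auto
  finally show "norm (D \<alpha> (\<lambda>z. f z + g z) z) * exp (- q * (norm z)\<^sup>2) \<le> \<dots>" .
qed simp

lemma Dq_zero: "(\<lambda>_. 0) \<in> Dq q"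
  using gaussian_subset_Dq[of "q - 1" q] gaussian_zero[of "q - 1"] by auto

lemma Dq_seminorm_le:
  assumes "smooth f" "deriv_bound k 1 (\<lambda>z. B * exp (q * (norm z)\<^sup>2)) f" "mi_order \<alpha> \<le> k"
  shows "Dq_seminorm q \<alpha> f \<le> B"
  unfolding Dq_seminorm_def
proof (rule cSUP_least)
  fix z
  have "norm (D \<alpha> f z) * exp (- q * (norm z)\<^sup>2) \<le> (B * exp (q * (norm z)\<^sup>2)) * exp (- q * (norm z)\<^sup>2)"
    using deriv_bound_D[OF assms] by (intro mult_right_mono) auto
  also have "\<dots> = B" by (simp add: mult.assoc flip: exp_add)
  finally show "norm (D \<alpha> f z) * exp (- q * (norm z)\<^sup>2) \<le> B" .
qed simp

lemma Dq_dual_add: "G \<in> Dq_dual q \<Longrightarrow> f \<in> Dq q \<Longrightarrow> g \<in> Dq q \<Longrightarrow> G (\<lambda>z. f z + g z) = G f + G g"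
  and Dq_dual_cmult: "G \<in> Dq_dual q \<Longrightarrow> f \<in> Dq q \<Longrightarrow> G (\<lambda>z. c * f z) = c * G f"
  by (simp_all add: Dq_dual_def)

text \<open>The subbasic sets are balls about arbitrary centres; by the triangle inequality each one that
  contains $0$ contains a ball about $0$. Induction over the generated topology then leaves
  finitely many seminorms, hence finitely many orders of derivatives.\<close>

lemma generated_nhd_zero:
  assumes "generate_topology_on {{\<phi> \<in> Dq q. Dq_seminorm q \<alpha> (\<lambda>z. \<phi> z - \<psi> z) < \<epsilon>} | \<alpha> \<psi> \<epsilon>. \<psi> \<in> Dq q \<and> 0 < \<epsilon>} U"
    and "(\<lambda>_. 0) \<in> U"
  shows "\<exists>k. \<exists>e>0. \<forall>\<phi>\<in>Dq q. (\<forall>\<alpha>. mi_order \<alpha> \<le> k \<longrightarrow> Dq_seminorm q \<alpha> \<phi> < e) \<longrightarrow> \<phi> \<in> U"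
  using assms
proof (induction rule: generate_topology_on.induct)
  case Empty
  then show ?case by simp
next
  case (Int a b)
  then obtain k1 e1 k2 e2 where *: "e1 > 0" "e2 > 0"
    "\<forall>\<phi>\<in>Dq q. (\<forall>\<alpha>. mi_order \<alpha> \<le> k1 \<longrightarrow> Dq_seminorm q \<alpha> \<phi> < e1) \<longrightarrow> \<phi> \<in> a"
    "\<forall>\<phi>\<in>Dq q. (\<forall>\<alpha>. mi_order \<alpha> \<le> k2 \<longrightarrow> Dq_seminorm q \<alpha> \<phi> < e2) \<longrightarrow> \<phi> \<in> b"
    by auto
  show ?case
    by (rule exI[of _ "max k1 k2"], rule exI[of _ "min e1 e2"]) (use * in auto)
next
  case (UN K)
  then obtain V where "V \<in> K" "(\<lambda>_. 0) \<in> V" by auto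
  with UN.IH obtain k e where "e > 0" "\<forall>\<phi>\<in>Dq q. (\<forall>\<alpha>. mi_order \<alpha> \<le> k \<longrightarrow> Dq_seminorm q \<alpha> \<phi> < e) \<longrightarrow> \<phi> \<in> V"
    by blast
  then show ?case using \<open>V \<in> K\<close> by blast
next
  case (Basis s)
  then obtain \<alpha> \<psi> \<epsilon> where s: "s = {\<phi> \<in> Dq q. Dq_seminorm q \<alpha> (\<lambda>z. \<phi> z - \<psi> z) < \<epsilon>}" "\<psi> \<in> Dq q" by blast
  let ?n = "\<lambda>z. 0 - \<psi> z"
  have n: "?n \<in> Dq q" using Dq_diff[OF Dq_zero s(2)] .
  have lt: "Dq_seminorm q \<alpha> ?n < \<epsilon>" using Basis.prems unfolding s(1) by simp
  have "\<phi> \<in> s" if "\<phi> \<in> Dq q" "\<forall>\<beta>. mi_order \<beta> \<le> mi_order \<alpha> \<longrightarrow> Dq_seminorm q \<beta> \<phi> < \<epsilon> - Dq_seminorm q \<alpha> ?n" for \<phi>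
  proof -
    have "Dq_seminorm q \<alpha> (\<lambda>z. \<phi> z - \<psi> z) \<le> Dq_seminorm q \<alpha> \<phi> + Dq_seminorm q \<alpha> ?n"
      using Dq_seminorm_add[OF that(1) n, of \<alpha>] by simp
    also have "\<dots> < \<epsilon>" using that(2) by (metis add.commute less_diff_eq order_refl)
    finally show ?thesis using that(1) by (simp add: s(1))
  qed
  then show ?case
    by (intro exI[of _ "mi_order \<alpha>"] exI[of _ "\<epsilon> - Dq_seminorm q \<alpha> ?n"]) (use lt in auto)
qed

text \<open>Continuity at $0$ bounds the functional on a ball given by finitely many seminorms, and
  homogeneity rescales the bound.\<close>

lemma Dq_dual_bound:
  assumes G: "G \<in> Dq_dual q"
  obtains m C where "0 \<le> C"
    "\<And>f B. f \<in> Dq q \<Longrightarrow> deriv_bound m 1 (\<lambda>z. B * exp (q * (norm z)\<^sup>2)) f \<Longrightarrow> norm (G f) \<le> C * B"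
proof -
  let ?T = "Dq_topology q"
  have cont: "continuous_map ?T euclidean G" using G by (simp add: Dq_dual_def)
  have "openin ?T {\<phi> \<in> topspace ?T. G \<phi> \<in> ball 0 1}"
    using cont by (rule openin_continuous_map_preimage) simp
  then have gen: "generate_topology_on {{\<phi> \<in> Dq q. Dq_seminorm q \<alpha> (\<lambda>z. \<phi> z - \<psi> z) < \<epsilon>} | \<alpha> \<psi> \<epsilon>. \<psi> \<in> Dq q \<and> 0 < \<epsilon>}
      {\<phi> \<in> topspace ?T. G \<phi> \<in> ball 0 1}"
    unfolding Dq_topology_def openin_topology_generated_by_iff .
  have G0: "G (\<lambda>_. 0) = 0" using Dq_dual_cmult[OF G Dq_zero, of 0] by simp
  have sn0: "Dq_seminorm q \<alpha> (\<lambda>z. (0::complex)) = 0" for \<alpha>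
    by (simp add: Dq_seminorm_def D_zero)
  have top: "(\<lambda>_. 0) \<in> topspace ?T"
    unfolding Dq_topology_def topology_generated_by_topspace
    by (rule UnionI[of "{\<phi> \<in> Dq q. Dq_seminorm q (0,0) (\<lambda>z. \<phi> z - (\<lambda>_. 0) z) < 1}"])
       (rule CollectI, intro exI[of _ "(0,0)"] exI[of _ "\<lambda>_. 0"] exI[of _ "1::real"],
        simp_all add: Dq_zero sn0)
  have zU: "(\<lambda>_. 0) \<in> {\<phi> \<in> topspace ?T. G \<phi> \<in> ball 0 1}"
    using top G0 by simp
  obtain k e where e: "e > 0" and ke': "\<forall>\<phi>\<in>Dq q. (\<forall>\<alpha>. mi_order \<alpha> \<le> k \<longrightarrow> Dq_seminorm q \<alpha> \<phi> < e)
      \<longrightarrow> \<phi> \<in> {\<phi> \<in> topspace ?T. G \<phi> \<in> ball 0 1}"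
    using generated_nhd_zero[OF gen zU] by blast
  have ke: "norm (G \<phi>) < 1" if "\<phi> \<in> Dq q" "\<And>\<alpha>. mi_order \<alpha> \<le> k \<Longrightarrow> Dq_seminorm q \<alpha> \<phi> < e" for \<phi>
  proof -
    have "\<phi> \<in> {\<phi> \<in> topspace ?T. G \<phi> \<in> ball 0 1}" using ke' that by blast
    then show ?thesis by simp
  qed
  show ?thesis
  proof (rule that[of "2 / e" k])
    fix f B assume f: "f \<in> Dq q" and B: "deriv_bound k 1 (\<lambda>z. B * exp (q * (norm z)\<^sup>2)) f"
    have fs: "smooth f" using f by (simp add: Dq_def)
    have B0: "0 \<le> B" using deriv_bound_nonneg[OF B, of 0] by simp
    show "norm (G f) \<le> 2 / e * B"
    proof (rule ccontr)
      assume "\<not> ?thesis"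
      then have gt: "B < norm (G f) * e / 2" using e by (simp add: field_simps)
      define B' where "B' = norm (G f) * e / 2"
      have B': "0 < B'" "B < B'" using gt B0 by (auto simp: B'_def)
      \<comment> \<open>Scaling by $c$ moves $f$ into the ball of radius $e$, yet makes the
        value of $G$ have modulus one.\<close>
      define c where "c = complex_of_real (e / (2 * B'))"
      have "Dq_seminorm q \<alpha> (\<lambda>z. c * f z) < e" if "mi_order \<alpha> \<le> k" for \<alpha>
      proof -
        have "deriv_bound k 1 (\<lambda>z. norm c * (B * exp (q * (norm z)\<^sup>2))) (\<lambda>z. c * f z)"
          by (rule deriv_bound_cmult[OF fs B])
        then have "Dq_seminorm q \<alpha> (\<lambda>z. c * f z) \<le> norm c * B"
          using Dq_seminorm_le[of "\<lambda>z. c * f z" k "norm c * B" q \<alpha>] that fs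
          by (simp add: smooth_mult mult.assoc)
        also have "norm c * B \<le> norm c * B'" using B' by (intro mult_left_mono) auto
        also have "norm c * B' = e / 2" using B' e by (simp add: c_def norm_divide)
        also have "\<dots> < e" using e by simp
        finally show ?thesis .
      qed
      then have "norm (G (\<lambda>z. c * f z)) < 1"
        using ke[OF Dq_cmult[OF f]] by blast
      then have "norm c * norm (G f) < 1"
        using Dq_dual_cmult[OF G f] by (simp add: norm_mult)
      moreover have "norm (G f) \<noteq> 0" using B'(1) unfolding B'_def by auto
      then have "norm c * norm (G f) = 1"
        using e by (simp add: c_def norm_divide B'_def field_simps)
      ultimately show False by simp
    qed
  qed (use e in simp)
qed

lemma Dq_dual_gauss_functional:
  assumes G: "G \<in> Dq_dual q" and q': "q' < q"
  obtains m where "gauss_functional q' m G"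
proof -
  obtain m C where C: "0 \<le> C" "\<And>f B. f \<in> Dq q \<Longrightarrow> deriv_bound m 1 (\<lambda>z. B * exp (q * (norm z)\<^sup>2)) f \<Longrightarrow> norm (G f) \<le> C * B"
    using Dq_dual_bound[OF G] by metis
  have sub: "f \<in> Dq q" if "f \<in> gaussian q'" for f using gaussian_subset_Dq[OF q'] that by blast
  have bound: "norm (G f) \<le> C * B" if f: "f \<in> gaussian q'" and B: "deriv_bound m 1 (\<lambda>z. B * exp (q' * (norm z)\<^sup>2)) f" for f B
  proof -
    have B0: "0 \<le> B" using deriv_bound_nonneg[OF B, of 0] by simp
    have "deriv_bound m 1 (\<lambda>z. B * exp (q * (norm z)\<^sup>2)) f"
      using B by (rule deriv_bound_weaken) (use B0 q' in \<open>auto intro!: mult_left_mono mult_right_mono\<close>)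
    then show ?thesis by (rule C(2)[OF sub[OF f]])
  qed
  have "gauss_functional q' m G"
    unfolding gauss_functional_def
  proof (intro conjI ballI allI exI[of _ C] C(1) Dq_dual_add[OF G] Dq_dual_cmult[OF G] sub impI)
    fix f B assume "f \<in> gaussian q'" "deriv_bound m 1 (\<lambda>z. B * exp (q' * (norm z)\<^sup>2)) f"
    then show "norm (G f) \<le> C * B" by (rule bound)
  qed
  then show ?thesis using that by blast
qed

section \<open>Minors of a kernel\<close>

definition minor :: "('a \<Rightarrow> 'b \<Rightarrow> complex) \<Rightarrow> nat \<Rightarrow> (nat \<Rightarrow> 'a) \<Rightarrow> (nat \<Rightarrow> 'b) \<Rightarrow> complex" where
  "minor \<Phi> r a b = Determinant.det (Matrix.mat r r (\<lambda>(i, j). \<Phi> (a i) (b j)))"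

lemma minor_leibniz:
  "minor \<Phi> r a b = (\<Sum>p | p permutes {0..<r}. of_int (sign p) * (\<Prod>i=0..<r. \<Phi> (a i) (b (p i))))"
proof -
  have "minor \<Phi> r a b = (\<Sum>p | p permutes {0..<r}. of_int (sign p) *
      (\<Prod>i=0..<r. Matrix.mat r r (\<lambda>(i, j). \<Phi> (a i) (b j)) $$ (i, p i)))"
    unfolding minor_def by (rule det_def') simp
  also have "\<dots> = (\<Sum>p | p permutes {0..<r}. of_int (sign p) * (\<Prod>i=0..<r. \<Phi> (a i) (b (p i))))"
    by (intro sum.cong refl arg_cong2[where f = "(*)"] prod.cong) (auto dest: permutes_in_image)
  finally show ?thesis .
qed

lemma minor_0 [simp]: "minor \<Phi> 0 a b = 1"
  by (simp add: minor_def)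

lemma minor_cong:
  assumes "\<And>i j. i < r \<Longrightarrow> j < r \<Longrightarrow> \<Phi> (a i) (b j) = \<Psi> (a' i) (b' j)"
  shows "minor \<Phi> r a b = minor \<Psi> r a' b'"
  unfolding minor_def by (rule arg_cong[where f = Determinant.det], rule eq_matI) (use assms in auto)

text \<open>Cofactors along a row do not involve that row; the point is that the coefficients $c$ serve
  all row labels $x$.\<close>

lemma minor_expand_row:
  assumes i: "i < r"
  shows "\<exists>c. \<forall>x. minor \<Phi> r (a(i := x)) b = (\<Sum>k<r. \<Phi> x (b k) * c k)"
proof -
  let ?M = "\<lambda>a. Matrix.mat r r (\<lambda>(i, j). \<Phi> (a i) (b j))"
  have "minor \<Phi> r (a(i := x)) b = (\<Sum>k<r. \<Phi> x (b k) * cofactor (?M a) i k)" for x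
  proof -
    have "minor \<Phi> r (a(i := x)) b = (\<Sum>k<r. ?M (a(i := x)) $$ (i, k) * cofactor (?M (a(i := x))) i k)"
      unfolding minor_def by (rule laplace_expansion_row[OF _ i]) simp
    also have "\<dots> = (\<Sum>k<r. \<Phi> x (b k) * cofactor (?M a) i k)"
    proof (rule sum.cong[OF refl])
      fix k assume "k \<in> {..<r}"
      then have k: "k < r" by simp
      have "mat_delete (?M (a(i := x))) i k = mat_delete (?M a) i k"
        unfolding mat_delete_def by (rule eq_matI) (use i k in auto)
      then show "?M (a(i := x)) $$ (i, k) * cofactor (?M (a(i := x))) i k = \<Phi> x (b k) * cofactor (?M a) i k"
        using i k by (simp add: cofactor_def)
    qed
    finally show ?thesis .
  qed
  then show ?thesis by blast
qed

lemma minor_repeated_row: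
  assumes "i < r" "j < r" "i \<noteq> j" "a i = a j" shows "minor \<Phi> r a b = 0"
  unfolding minor_def
  by (rule det_identical_rows[of _ r i j]) (use assms in \<open>auto intro!: eq_vecI\<close>)

text \<open>The determinant of a product of square matrices.\<close>

lemma minor_mult:
  assumes "\<And>i j. i < r \<Longrightarrow> j < r \<Longrightarrow> \<Phi> (x i) (y j) = (\<Sum>k<r. \<theta> (x i) k * \<Phi> (a k) (y j))"
  shows "minor \<Phi> r x y = minor \<theta> r x (\<lambda>k. k) * minor \<Phi> r a y"
proof -
  let ?A = "Matrix.mat r r (\<lambda>(i, j). \<theta> (x i) j)" and ?B = "Matrix.mat r r (\<lambda>(i, j). \<Phi> (a i) (y j))"
  have "Matrix.mat r r (\<lambda>(i, j). \<Phi> (x i) (y j)) = ?A * ?B"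
    by (rule eq_matI) (use assms in \<open>auto simp: scalar_prod_def atLeast0LessThan\<close>)
  then show ?thesis
    unfolding minor_def using det_mult[of ?A r ?B] by simp
qed

lemma minor_zero_iff:
  "minor \<Phi> r a b = 0 \<longleftrightarrow> (\<exists>c. (\<exists>i<r. c i \<noteq> 0) \<and> (\<forall>j<r. (\<Sum>i<r. c i * \<Phi> (a i) (b j)) = 0))"
proof -
  let ?A = "Matrix.mat r r (\<lambda>(i, j). \<Phi> (a i) (b j))"
  let ?T = "Matrix.mat r r (\<lambda>(j, i). \<Phi> (a i) (b j))"
  have T: "?T = transpose_mat ?A" by (rule eq_matI) auto
  have "minor \<Phi> r a b = Determinant.det ?T"
    unfolding minor_def T by (rule det_transpose[symmetric, of _ r]) simp
  then have iff: "minor \<Phi> r a b = 0 \<longleftrightarrow> (\<exists>v. v \<in> carrier_vec r \<and> v \<noteq> 0\<^sub>v r \<and> ?T *\<^sub>v v = 0\<^sub>v r)"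
    using det_0_iff_vec_prod_zero_field[of ?T r] by simp
  have mv: "vec_index (?T *\<^sub>v v) j = (\<Sum>i<r. vec_index v i * \<Phi> (a i) (b j))" if "v \<in> carrier_vec r" "j < r" for v j
    using that by (auto simp: scalar_prod_def atLeast0LessThan mult.commute intro!: sum.cong)
  show ?thesis
    unfolding iff
  proof (intro iffI; elim exE conjE)
    fix v assume v: "v \<in> carrier_vec r" "v \<noteq> 0\<^sub>v r" "?T *\<^sub>v v = 0\<^sub>v r"
    have "\<exists>i<r. vec_index v i \<noteq> 0"
      using v(1,2) by (metis carrier_vecD eq_vecI index_zero_vec)
    moreover have "(\<Sum>i<r. vec_index v i * \<Phi> (a i) (b j)) = 0" if "j < r" for j
      using mv[OF v(1) that] v(3) that by simp
    ultimately show "\<exists>c. (\<exists>i<r. c i \<noteq> 0) \<and> (\<forall>j<r. (\<Sum>i<r. c i * \<Phi> (a i) (b j)) = 0)"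
      by blast
  next
    fix c i assume c: "\<forall>j<r. (\<Sum>i<r. c i * \<Phi> (a i) (b j)) = 0" "i < r" "c i \<noteq> 0"
    have "Matrix.vec r c \<noteq> 0\<^sub>v r"
      using c(2,3) by (metis index_vec index_zero_vec(1))
    moreover have "?T *\<^sub>v Matrix.vec r c = 0\<^sub>v r"
    proof (rule eq_vecI)
      fix j assume "j < dim_vec (0\<^sub>v r)"
      then have j: "j < r" by simp
      have "vec_index (?T *\<^sub>v Matrix.vec r c) j = (\<Sum>i<r. vec_index (Matrix.vec r c) i * \<Phi> (a i) (b j))"
        by (rule mv[OF _ j]) simp
      also have "\<dots> = (\<Sum>i<r. c i * \<Phi> (a i) (b j))" by (rule sum.cong) auto
      finally show "vec_index (?T *\<^sub>v Matrix.vec r c) j = vec_index (0\<^sub>v r) j" using c(1) j by simp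
    qed simp
    ultimately show "\<exists>v. v \<in> carrier_vec r \<and> v \<noteq> 0\<^sub>v r \<and> ?T *\<^sub>v v = 0\<^sub>v r"
      by (intro exI[of _ "Matrix.vec r c"]) simp
  qed
qed

text \<open>Extending the matrix by zero columns makes it square and singular.\<close>

lemma underdetermined_system:
  fixes X :: "nat \<Rightarrow> 'e \<Rightarrow> complex"
  assumes "finite E" "card E < n"
  shows "\<exists>c. (\<exists>j<n. c j \<noteq> 0) \<and> (\<forall>e\<in>E. (\<Sum>j<n. c j * X j e) = 0)"
proof -
  obtain h where h: "bij_betw h {0..<card E} E"
    using ex_bij_betw_nat_finite[OF assms(1)] by blast
  define \<Phi> where "\<Phi> j k = (if k < card E then X j (h k) else 0)" for j k
  have "minor \<Phi> n (\<lambda>j. j) (\<lambda>k. k) = 0"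
    unfolding minor_leibniz
  proof (rule sum.neutral, intro ballI)
    fix p assume "p \<in> {p. p permutes {0..<n}}"
    then have p: "p permutes {0..<n}" by simp
    have "\<exists>i\<in>{0..<n}. p i = card E"
      using permutes_image[OF p] assms(2) by (metis atLeastLessThan_iff imageE le0)
    then obtain i where "i \<in> {0..<n}" "\<Phi> i (p i) = 0" unfolding \<Phi>_def by fastforce
    then have "(\<Prod>i=0..<n. \<Phi> i (p i)) = 0"
      by (intro prod_zero) blast+
    then show "of_int (sign p) * (\<Prod>i=0..<n. \<Phi> i (p i)) = 0" by simp
  qed
  then obtain c where c: "\<exists>j<n. c j \<noteq> 0" "\<forall>k<n. (\<Sum>j<n. c j * \<Phi> j k) = 0"
    unfolding minor_zero_iff by blast
  have "(\<Sum>j<n. c j * X j e) = 0" if "e \<in> E" for e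
  proof -
    have "e \<in> h ` {0..<card E}" using h that by (simp add: bij_betw_def)
    then obtain k where k: "k < card E" "e = h k" by auto
    then show ?thesis using c(2) assms(2) by (auto simp: \<Phi>_def dest!: spec[of _ k])
  qed
  then show ?thesis using c(1) by blast
qed

text \<open>A vanishing minor of order $r+1$ makes the row of $s$ a combination of the rows of the $a_k$
  at the columns $b_j$ and one further column $t$. Since the minor of order $r$ is nonzero, the
  columns $b_j$ alone determine the coefficients, so these do not depend on $t$.\<close>

lemma kernel_factorization:
  assumes nz: "minor \<Phi> r a b \<noteq> 0" and zero: "\<And>x y. minor \<Phi> (Suc r) x y = 0"
  shows "\<exists>\<theta>. \<forall>s t. \<Phi> s t = (\<Sum>k<r. \<theta> s k * \<Phi> (a k) t)"
proof -
  have ex: "\<exists>\<theta>. \<Phi> s t = (\<Sum>k<r. \<theta> k * \<Phi> (a k) t) \<and> (\<forall>j<r. \<Phi> s (b j) = (\<Sum>k<r. \<theta> k * \<Phi> (a k) (b j)))" for s t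
  proof -
    have "minor \<Phi> (Suc r) (a(r := s)) (b(r := t)) = 0" by (rule zero)
    then obtain c where c: "\<exists>i<Suc r. c i \<noteq> 0"
      "\<And>j. j < Suc r \<Longrightarrow> (\<Sum>i<Suc r. c i * \<Phi> ((a(r := s)) i) ((b(r := t)) j)) = 0"
      unfolding minor_zero_iff by blast
    have sum: "(\<Sum>i<Suc r. c i * \<Phi> ((a(r := s)) i) y) = (\<Sum>i<r. c i * \<Phi> (a i) y) + c r * \<Phi> s y" for y
      by (simp add: sum.lessThan_Suc)
    \<comment> \<open>Otherwise the relation would be one among the $r$ independent rows.\<close>
    have cr: "c r \<noteq> 0"
    proof
      assume "c r = 0"
      then have "\<exists>i<r. c i \<noteq> 0" using c(1) by (auto simp: less_Suc_eq)
      moreover have "(\<Sum>i<r. c i * \<Phi> (a i) (b j)) = 0" if "j < r" for j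
        using c(2)[of j] that \<open>c r = 0\<close> unfolding sum by simp
      then have "\<forall>j<r. (\<Sum>i<r. c i * \<Phi> (a i) (b j)) = 0" by blast
      ultimately have "minor \<Phi> r a b = 0"
        unfolding minor_zero_iff by (intro exI[of _ c] conjI)
      then show False using nz by simp
    qed
    have *: "\<Phi> s y = (\<Sum>k<r. (- c k / c r) * \<Phi> (a k) y)" if "(\<Sum>i<r. c i * \<Phi> (a i) y) + c r * \<Phi> s y = 0" for y
    proof -
      have "c r * \<Phi> s y = - (\<Sum>i<r. c i * \<Phi> (a i) y)"
        using that by (simp add: add_eq_0_iff)
      then have "\<Phi> s y = - (\<Sum>i<r. c i * \<Phi> (a i) y) / c r"
        using cr by (simp add: field_simps)
      also have "\<dots> = (\<Sum>k<r. (- c k / c r) * \<Phi> (a k) y)"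
        by (simp add: sum_divide_distrib sum_negf)
      finally show ?thesis .
    qed
    show ?thesis
    proof (intro exI[of _ "\<lambda>k. - c k / c r"] conjI allI impI)
      show "\<Phi> s t = (\<Sum>k<r. (- c k / c r) * \<Phi> (a k) t)"
        using c(2)[of r] unfolding sum by (intro *) simp
      fix j assume "j < r"
      then show "\<Phi> s (b j) = (\<Sum>k<r. (- c k / c r) * \<Phi> (a k) (b j))"
        using c(2)[of j] unfolding sum by (intro *) simp
    qed
  qed
  have unique: "\<forall>k<r. \<theta> k = \<theta>' k"
    if "\<forall>j<r. (\<Sum>k<r. \<theta> k * \<Phi> (a k) (b j)) = (\<Sum>k<r. \<theta>' k * \<Phi> (a k) (b j))" for \<theta> \<theta>'
  proof (rule ccontr)
    assume "\<not> ?thesis"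
    then have "\<exists>k<r. \<theta> k - \<theta>' k \<noteq> 0" by auto
    moreover have "\<forall>j<r. (\<Sum>k<r. (\<theta> k - \<theta>' k) * \<Phi> (a k) (b j)) = 0"
      using that by (simp add: left_diff_distrib sum_subtractf)
    ultimately have "minor \<Phi> r a b = 0"
      unfolding minor_zero_iff by (intro exI[of _ "\<lambda>k. \<theta> k - \<theta>' k"] conjI)
    then show False using nz by simp
  qed
  have "\<forall>s. \<exists>\<theta>. \<forall>j<r. \<Phi> s (b j) = (\<Sum>k<r. \<theta> k * \<Phi> (a k) (b j))"
    using ex by blast
  from choice[OF this] obtain \<theta> where \<theta>: "\<forall>s. \<forall>j<r. \<Phi> s (b j) = (\<Sum>k<r. \<theta> s k * \<Phi> (a k) (b j))"
    by blast
  have "\<Phi> s t = (\<Sum>k<r. \<theta> s k * \<Phi> (a k) t)" for s t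
  proof -
    obtain \<theta>' where \<theta>': "\<Phi> s t = (\<Sum>k<r. \<theta>' k * \<Phi> (a k) t)"
        "\<forall>j<r. \<Phi> s (b j) = (\<Sum>k<r. \<theta>' k * \<Phi> (a k) (b j))"
      using ex by blast
    have "\<forall>k<r. \<theta>' k = \<theta> s k"
      by (rule unique) (use \<theta>' \<theta> in simp)
    then show ?thesis using \<theta>'(1) by simp
  qed
  then show ?thesis by blast
qed

section \<open>Lagrange interpolation\<close>

definition lagrange :: "(nat \<Rightarrow> complex) \<Rightarrow> nat \<Rightarrow> nat \<Rightarrow> complex \<Rightarrow> complex" where
  "lagrange s M l z = (\<Prod>j\<in>{..M} - {l}. (z - s j) / (s l - s j))"

lemma lagrange_interpolation:
  fixes p :: "complex poly"
  assumes inj: "inj_on s {..M}" and deg: "degree p \<le> M"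
  shows "poly p z = (\<Sum>l\<le>M. poly p (s l) * lagrange s M l z)"
proof -
  define L where "L l = (\<Prod>j\<in>{..M} - {l}. [:- s j / (s l - s j), 1 / (s l - s j):])" for l
  have pL: "poly (L l) z = lagrange s M l z" for l z
    unfolding L_def lagrange_def poly_prod by (rule prod.cong) (auto simp: diff_divide_distrib)
  have degL: "degree (L l) \<le> M" if "l \<le> M" for l
  proof -
    have "degree (L l) \<le> (\<Sum>j\<in>{..M} - {l}. degree [:- s j / (s l - s j), 1 / (s l - s j):])"
      unfolding L_def by (rule degree_prod_sum_le[unfolded o_def]) simp
    also have "\<dots> \<le> (\<Sum>j\<in>{..M} - {l}. 1)" by (intro sum_mono) (simp add: degree_pCons_le)
    also have "\<dots> = M" using that by simp
    finally show ?thesis .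
  qed
  define P where "P = (\<Sum>l\<le>M. Polynomial.smult (poly p (s l)) (L l))"
  have degP: "degree P \<le> M"
    unfolding P_def by (intro degree_sum_le) (auto intro: order_trans[OF degree_smult_le] degL)
  have node: "lagrange s M l (s k) = (if k = l then 1 else 0)" if "l \<le> M" "k \<le> M" for l k
  proof (cases "k = l")
    case True
    have "s l - s j \<noteq> 0" if "j \<in> {..M} - {l}" for j
      using inj that \<open>l \<le> M\<close> by (auto simp: inj_on_def)
    then show ?thesis using True by (simp add: lagrange_def)
  next
    case False
    then show ?thesis using that by (auto simp: lagrange_def intro!: prod_zero bexI[of _ k])
  qed
  have "P = p"
  proof (rule poly_eqI_degree[of "s ` {..M}"])
    fix x assume "x \<in> s ` {..M}"
    then obtain k where k: "k \<le> M" "x = s k" by auto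
    have "poly P x = (\<Sum>l\<le>M. poly p (s l) * (if k = l then 1 else 0))"
      unfolding P_def poly_sum using k node by (auto simp: pL intro!: sum.cong)
    also have "\<dots> = poly p x" using k by (simp add: if_distrib sum.delta cong: if_cong)
    finally show "poly P x = poly p x" .
  qed (use degP deg card_image[OF inj] in auto)
  then have "poly p z = poly P z" by simp
  also have "\<dots> = (\<Sum>l\<le>M. poly p (s l) * lagrange s M l z)"
    unfolding P_def poly_sum by (simp add: pL)
  finally show ?thesis .
qed

text \<open>Liouville's theorem. The degree is recorded because it fixes a number of interpolation nodes
  that must not depend on the function.\<close>

lemma entire_growth_poly:
  assumes "f holomorphic_on UNIV" "\<And>s. norm (f s) \<le> C * (1 + 2 * norm s) ^ M"
  shows "\<exists>p. degree p \<le> M \<and> (\<forall>s. f s = poly p s)"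
proof -
  have C: "0 \<le> C" using order_trans[OF norm_ge_zero assms(2)[of 0]] by simp
  have b: "norm (f s) \<le> (C * 3 ^ M) * norm s ^ M" if "1 \<le> norm s" for s
  proof -
    have "norm (f s) \<le> C * (1 + 2 * norm s) ^ M" by (rule assms(2))
    also have "\<dots> \<le> C * (3 * norm s) ^ M"
      using that C by (intro mult_left_mono power_mono) auto
    finally show ?thesis by (simp add: power_mult_distrib mult.assoc)
  qed
  define p where "p = (\<Sum>k\<le>M. Polynomial.monom ((deriv ^^ k) f 0 / fact k) k)"
  have "f s = poly p s" for s
    unfolding p_def poly_sum poly_monom using Liouville_polynomial[OF assms(1) b] .
  moreover have "degree p \<le> M"
    unfolding p_def by (intro degree_sum_le) (auto intro: order_trans[OF degree_monom_le])
  ultimately show ?thesis by blast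
qed

section \<open>A polynomial annihilating the functional\<close>

lemma transform_holomorphic:
  assumes H: "gauss_functional q m H" and q: "0 < q" and A: "A \<in> subgaussian"
  shows "(\<lambda>s. H (\<lambda>w. linexp s 0 w * A w)) holomorphic_on UNIV"
    and "(\<lambda>t. H (\<lambda>w. linexp 0 t w * A w)) holomorphic_on UNIV"
proof -
  show "(\<lambda>s. H (\<lambda>w. linexp s 0 w * A w)) holomorphic_on UNIV"
    using gauss_functional_linexp_deriv[OF H q A, of "\<lambda>z. z"] 
    by (auto simp: linexp_def holomorphic_on_def field_differentiable_def)
  show "(\<lambda>t. H (\<lambda>w. linexp 0 t w * A w)) holomorphic_on UNIV"
    using gauss_functional_linexp_deriv[OF H q A, of cnj]
    by (auto simp: linexp_def holomorphic_on_def field_differentiable_def)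
qed

text \<open>A function of $x$ that is identically zero has zero derivatives, and its derivatives at $0$
  are the moments.\<close>

lemma moments_zero:
  assumes H: "gauss_functional q m H" and q: "0 < q" and A: "A \<in> subgaussian"
    and zero: "\<And>x. H (\<lambda>w. linexp x 0 w * A w) = 0"
  shows "H (\<lambda>w. w ^ j * A w) = 0"
proof -
  have "\<forall>x. H (\<lambda>w. exp (x * w) * (w ^ j * A w)) = 0"
  proof (induction j)
    case 0
    then show ?case using zero by (simp add: linexp_def)
  next
    case (Suc j)
    show ?case
    proof
      fix x
      have "((\<lambda>x. H (\<lambda>w. exp (x * w) * (w ^ j * A w))) has_field_derivative
          H (\<lambda>w. w * exp (x * w) * (w ^ j * A w))) (at x)"
        by (rule gauss_functional_linexp_deriv[OF H q, where \<kappa> = "\<lambda>w. w"])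
           (auto intro!: subgaussian_mult subgaussian_power subgaussian_id A)
      moreover have "(\<lambda>x. H (\<lambda>w. exp (x * w) * (w ^ j * A w))) = (\<lambda>_. 0)"
        using Suc by auto
      ultimately have "H (\<lambda>w. w * exp (x * w) * (w ^ j * A w)) = 0"
        using DERIV_unique[OF _ DERIV_const] by metis
      moreover have "(\<lambda>w. w * exp (x * w) * (w ^ j * A w)) = (\<lambda>w. exp (x * w) * (w ^ Suc j * A w))"
        by (simp add: fun_eq_iff)
      ultimately show "H (\<lambda>w. exp (x * w) * (w ^ Suc j * A w)) = 0" by simp
    qed
  qed
  from spec[OF this, of 0] show ?thesis by simp
qed

lemma sum_subgaussian: "(\<And>i. i \<in> I \<Longrightarrow> f i \<in> subgaussian) \<Longrightarrow> (\<lambda>z. \<Sum>i\<in>I. c i * f i z) \<in> subgaussian"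
  by (intro subgaussian_sum subgaussian_mult subgaussian_const)

lemma gauss_functional_lincomb:
  assumes H: "gauss_functional q m H" and "finite I" "\<And>i. i \<in> I \<Longrightarrow> f i \<in> gaussian q"
  shows "H (\<lambda>z. \<Sum>i\<in>I. c i * f i z) = (\<Sum>i\<in>I. c i * H (f i))"
proof -
  have "H (\<lambda>z. \<Sum>i\<in>I. c i * f i z) = (\<Sum>i\<in>I. H (\<lambda>z. c i * f i z))"
    using assms by (intro gauss_functional_sum[OF H]) (auto intro: gaussian_cmult)
  then show ?thesis using assms gauss_functional_cmult[OF H] by simp
qed

text \<open>Shifting the row labels by $s$ and the column labels by $-\bar s$ multiplies each exponential
  by a character, so every entry of the matrix has polynomial growth.\<close>

lemma minor_growth:
  assumes H: "gauss_functional q m H" and q: "0 < q"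
  shows "\<exists>C\<ge>0. \<forall>s. norm (minor (\<lambda>s t. H (linexp s t)) r (\<lambda>i. x i + s) (\<lambda>j. y j - cnj s)) \<le> C * (1 + 2 * norm s) ^ (m * r)"
proof -
  have "\<forall>i j. \<exists>C\<ge>0. \<forall>s. norm (H (linexp (x i + s) (y j - cnj s))) \<le> C * (1 + 2 * norm s) ^ m"
  proof (intro allI)
    fix i j
    have "(\<lambda>w. linexp s (- cnj s) w * linexp (x i) (y j) w) = linexp (x i + s) (y j - cnj s)" for s
      using linexp_add[of s "x i" "- cnj s" "y j"] by (auto simp: fun_eq_iff add.commute)
    then show "\<exists>C\<ge>0. \<forall>s. norm (H (linexp (x i + s) (y j - cnj s))) \<le> C * (1 + 2 * norm s) ^ m"
      using gauss_functional_character_bound[OF H q subgaussian_linexp[of "x i" "y j"]] by metis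
  qed
  then obtain C where C: "\<And>i j. 0 \<le> C i j"
    "\<And>i j s. norm (H (linexp (x i + s) (y j - cnj s))) \<le> C i j * (1 + 2 * norm s) ^ m"
    by metis
  let ?P = "{p. p permutes {0..<r}}"
  have "norm (minor (\<lambda>s t. H (linexp s t)) r (\<lambda>i. x i + s) (\<lambda>j. y j - cnj s))
      \<le> (\<Sum>p\<in>?P. \<Prod>i=0..<r. C i (p i)) * (1 + 2 * norm s) ^ (m * r)" for s
  proof -
    have "norm (minor (\<lambda>s t. H (linexp s t)) r (\<lambda>i. x i + s) (\<lambda>j. y j - cnj s))
        \<le> (\<Sum>p\<in>?P. \<Prod>i=0..<r. norm (H (linexp (x i + s) (y (p i) - cnj s))))"
      unfolding minor_leibniz
      by (rule order_trans[OF norm_sum]) (auto simp: norm_mult prod_norm sign_def intro!: sum_mono)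
    also have "\<dots> \<le> (\<Sum>p\<in>?P. \<Prod>i=0..<r. C i (p i) * (1 + 2 * norm s) ^ m)"
      using C by (intro sum_mono prod_mono) auto
    also have "\<dots> = (\<Sum>p\<in>?P. \<Prod>i=0..<r. C i (p i)) * (1 + 2 * norm s) ^ (m * r)"
      by (simp add: prod.distrib sum_distrib_right power_mult)
    finally show ?thesis .
  qed
  moreover have "0 \<le> (\<Sum>p\<in>?P. \<Prod>i=0..<r. C i (p i))"
    using C by (intro sum_nonneg prod_nonneg) auto
  ultimately show ?thesis by blast
qed

lemma minor_holomorphic:
  assumes H: "gauss_functional q m H" and q: "0 < q"
  shows "(\<lambda>s. minor (\<lambda>s t. H (linexp s t)) r (\<lambda>i. x i + s) y) holomorphic_on UNIV"
    and "(\<lambda>t. minor (\<lambda>s t. H (linexp s t)) r x (\<lambda>j. y j + t)) holomorphic_on UNIV"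
proof -
  have 1: "(\<lambda>w. linexp s 0 w * linexp a b w) = linexp (a + s) b"
    and 2: "(\<lambda>w. linexp 0 s w * linexp a b w) = linexp a (b + s)" for s a b
    using linexp_add[of s a 0 b] linexp_add[of 0 a s b] by (auto simp: fun_eq_iff add.commute)
  show "(\<lambda>s. minor (\<lambda>s t. H (linexp s t)) r (\<lambda>i. x i + s) y) holomorphic_on UNIV"
    unfolding minor_leibniz
    by (intro holomorphic_intros transform_holomorphic(1)[OF H q subgaussian_linexp, unfolded 1])
  show "(\<lambda>t. minor (\<lambda>s t. H (linexp s t)) r x (\<lambda>j. y j + t)) holomorphic_on UNIV"
    unfolding minor_leibniz
    by (intro holomorphic_intros transform_holomorphic(2)[OF H q subgaussian_linexp, unfolded 2])
qed

text \<open>The key step. With $e_x(s) = \Delta(x+s;b)$ and $d(s) = \overline{\Delta(a;b-\bar s)}$, both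
  entire, the product formula for minors gives $|e_x(s)\,d(s)| = |\Delta(a;b)\,\Delta(x+s;b-\bar
  s)|$, which grows at most like $|s|^{mr}$. Hence $e_x d$ is a polynomial of degree at most
  $mr$ for every tuple $x$, and is recovered from its values at $mr+1$ nodes $\sigma_l$. For
  small $s$ one may divide by $d(s)$, since $d(0) \neq 0$; so $e_x(s)$ is a combination of the
  $e_x(\sigma_l)$ whose coefficients do not depend on $x$.

  By Cramer's rule the coefficient $\theta_i(x+s)$ of the factorization is a quotient of minors,
  with numerator $\Delta(a';b)$ where $a'$ is $a$ with $a_i$ replaced by $x+s$. Writing its
  other entries as $(a_j - s) + s$ makes this a value $e_{x'}(s)$, and interpolation replaces
  $x+s$ by the points $x+\sigma_l$.\<close>

lemma shifts_finite_dimensional: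
  fixes H defines "\<Phi> \<equiv> (\<lambda>s t. H (linexp s t))"
  assumes H: "gauss_functional q m H" and q: "0 < q"
    and nz: "minor \<Phi> r a b \<noteq> 0" and zero: "\<And>x y. minor \<Phi> (Suc r) x y = 0"
  shows "\<exists>(\<delta>::real) (M::nat) \<sigma>. 0 < \<delta> \<and> (\<forall>s t. norm s < \<delta> \<longrightarrow>
    (\<exists>c. \<forall>x. \<Phi> (x + s) t = (\<Sum>(l, k)\<in>{..M} \<times> {..<r}. c l k * \<Phi> (x + \<sigma> l) (b k))))"
proof -
  obtain \<theta> where \<theta>: "\<And>s t. \<Phi> s t = (\<Sum>k<r. \<theta> s k * \<Phi> (a k) t)"
    using kernel_factorization[OF nz zero] by blast
  have mm: "minor \<Phi> r x y = minor \<theta> r x (\<lambda>k. k) * minor \<Phi> r a y" for x y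
    by (rule minor_mult) (rule \<theta>)
  define d where "d s = cnj (minor \<Phi> r a (\<lambda>j. b j - cnj s))" for s
  define e where "e x s = minor \<Phi> r (\<lambda>i. x i + s) b" for x s
  \<comment> \<open>The inner conjugate makes $d$ antiholomorphic in $s$; the outer one
    restores holomorphy.\<close>
  have d_hol: "d holomorphic_on UNIV"
  proof -
    have "(\<lambda>t. minor \<Phi> r a (\<lambda>j. b j + t)) holomorphic_on UNIV"
      unfolding \<Phi>_def by (rule minor_holomorphic(2)[OF H q])
    then have "((\<lambda>t. minor \<Phi> r a (\<lambda>j. b j + t)) \<circ> uminus) holomorphic_on UNIV"
      by (intro holomorphic_on_compose holomorphic_intros) (auto intro: holomorphic_on_subset)
    then have "cnj \<circ> ((\<lambda>t. minor \<Phi> r a (\<lambda>j. b j + t)) \<circ> uminus) \<circ> cnj holomorphic_on UNIV"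
      by (intro holomorphic_on_compose_cnj_cnj) (auto intro: holomorphic_on_subset)
    then show ?thesis by (simp add: o_def d_def[abs_def])
  qed
  let ?M = "m * r"
  have poly: "\<exists>p. degree p \<le> ?M \<and> (\<forall>s. e x s * d s = poly p s)" for x
  proof -
    obtain C where C: "0 \<le> C" "\<And>s. norm (minor \<Phi> r (\<lambda>i. x i + s) (\<lambda>j. b j - cnj s)) \<le> C * (1 + 2 * norm s) ^ ?M"
      using minor_growth[OF H q, of r x b] unfolding \<Phi>_def by blast
    have "norm (e x s * d s) \<le> (norm (minor \<Phi> r a b) * C) * (1 + 2 * norm s) ^ ?M" for s
    proof -
      have "norm (e x s * d s) = norm (minor \<Phi> r a b * minor \<Phi> r (\<lambda>i. x i + s) (\<lambda>j. b j - cnj s))"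
        unfolding e_def d_def norm_mult complex_mod_cnj
        by (subst (1 4) mm) (simp add: norm_mult)
      also have "\<dots> \<le> norm (minor \<Phi> r a b) * (C * (1 + 2 * norm s) ^ ?M)"
        unfolding norm_mult by (intro mult_left_mono C(2)) auto
      finally show ?thesis by (simp add: mult.assoc)
    qed
    moreover have "(\<lambda>s. e x s * d s) holomorphic_on UNIV"
      using minor_holomorphic(1)[OF H q, of r x b] d_hol
      unfolding e_def \<Phi>_def by (intro holomorphic_intros)
    ultimately show ?thesis by (intro entire_growth_poly)
  qed
  have "d 0 \<noteq> 0" using nz by (simp add: d_def)
  moreover have "continuous (at 0) d"
    using holomorphic_on_imp_continuous_on[OF d_hol] continuous_on_eq_continuous_at[OF open_UNIV] by blast
  ultimately have "\<forall>\<^sub>F s in nhds 0. d s \<noteq> 0"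
    by (metis continuous_at tendsto_imp_eventually_ne tendsto_at_iff_tendsto_nhds)
  then obtain \<delta> where \<delta>: "0 < \<delta>" "\<And>s. norm s < \<delta> \<Longrightarrow> d s \<noteq> 0"
    by (auto simp: eventually_nhds_metric dist_norm)
  \<comment> \<open>Any $mr+1$ distinct nodes will do.\<close>
  define K where "K = real (Suc ?M)"
  have K: "K \<noteq> 0" by (simp add: K_def del: of_nat_Suc)
  define \<sigma> where "\<sigma> l = complex_of_real (\<delta> * real l / K)" for l :: nat
  have \<sigma>_inj: "inj_on \<sigma> {..?M}"
    unfolding \<sigma>_def inj_on_def of_real_eq_iff using \<delta>(1) K by simp
  show ?thesis
  proof (intro exI[of _ \<delta>] exI[of _ ?M] exI[of _ \<sigma>] conjI \<delta>(1) allI impI)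
    fix s t :: complex assume s: "norm s < \<delta>"
    define y where "y l = d (\<sigma> l) * lagrange \<sigma> ?M l s / d s" for l
    have e_interp: "e x s = (\<Sum>l\<le>?M. y l * e x (\<sigma> l))" for x
    proof -
      obtain p where p: "degree p \<le> ?M" "\<And>s. e x s * d s = poly p s"
        using poly by blast
      have "e x s * d s = (\<Sum>l\<le>?M. (e x (\<sigma> l) * d (\<sigma> l)) * lagrange \<sigma> ?M l s)"
        unfolding p(2) by (rule lagrange_interpolation[OF \<sigma>_inj p(1)])
      then have "e x s = (\<Sum>l\<le>?M. (e x (\<sigma> l) * d (\<sigma> l)) * lagrange \<sigma> ?M l s) / d s"
        using \<delta>(2)[OF s] by (simp add: field_simps)
      then show ?thesis by (simp add: y_def sum_divide_distrib mult_ac)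
    qed
    have "\<exists>c. \<forall>x. minor \<Phi> r ((\<lambda>j. a j - s + \<sigma> l)(i := x)) b = (\<Sum>k<r. \<Phi> x (b k) * c k)" if "i < r" for i l
      by (rule minor_expand_row[OF that])
    \<comment> \<open>All rows but the $i$-th are frozen; $s$ is fixed, so the coefficients
      may depend on it.\<close>
    then obtain cf where cf: "\<And>i l x. i < r \<Longrightarrow>
        minor \<Phi> r ((\<lambda>j. a j - s + \<sigma> l)(i := x)) b = (\<Sum>k<r. \<Phi> x (b k) * cf i l k)"
      by metis
    have cramer: "\<theta> x i * minor \<Phi> r a b = minor \<Phi> r (a(i := x)) b" if i: "i < r" for x i
    proof -
      obtain c where c: "\<And>x. minor \<Phi> r (a(i := x)) b = (\<Sum>k<r. \<Phi> x (b k) * c k)"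
        using minor_expand_row[OF i] by blast
      have "minor \<Phi> r (a(i := x)) b = (\<Sum>k<r. (\<Sum>j<r. \<theta> x j * \<Phi> (a j) (b k)) * c k)"
        unfolding c using \<theta>[of x] by simp
      also have "\<dots> = (\<Sum>j<r. \<Sum>k<r. \<theta> x j * (\<Phi> (a j) (b k) * c k))"
        by (subst sum.swap) (simp add: sum_distrib_right mult.assoc)
      also have "\<dots> = (\<Sum>j<r. \<theta> x j * minor \<Phi> r (a(i := a j)) b)"
        unfolding c by (simp add: sum_distrib_left)
      also have "\<dots> = (\<Sum>j<r. if j = i then \<theta> x i * minor \<Phi> r a b else 0)"
      proof (rule sum.cong[OF refl])
        fix j assume "j \<in> {..<r}"
        then show "\<theta> x j * minor \<Phi> r (a(i := a j)) b = (if j = i then \<theta> x i * minor \<Phi> r a b else 0)"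
          using i minor_repeated_row[of i r j "a(i := a j)" \<Phi> b] by auto
      qed
      also have "\<dots> = \<theta> x i * minor \<Phi> r a b" using i by simp
      finally show ?thesis ..
    qed
    have \<theta>_shift: "\<theta> (x + s) i * minor \<Phi> r a b = (\<Sum>l\<le>?M. \<Sum>k<r. y l * (\<Phi> (x + \<sigma> l) (b k) * cf i l k))"
      if i: "i < r" for x i
    proof -
      let ?x = "(\<lambda>j. a j - s)(i := x)"
      have "\<theta> (x + s) i * minor \<Phi> r a b = minor \<Phi> r (a(i := x + s)) b"
        by (rule cramer[OF i])
      also have "\<dots> = minor \<Phi> r (\<lambda>j. ?x j + s) b" by (rule minor_cong) auto
      also have "\<dots> = (\<Sum>l\<le>?M. y l * minor \<Phi> r (\<lambda>j. ?x j + \<sigma> l) b)"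
        using e_interp[of ?x] unfolding e_def .
      also have "\<dots> = (\<Sum>l\<le>?M. y l * minor \<Phi> r ((\<lambda>j. a j - s + \<sigma> l)(i := x + \<sigma> l)) b)"
        by (intro sum.cong refl arg_cong2[where f = "(*)"] minor_cong) auto
      also have "\<dots> = (\<Sum>l\<le>?M. \<Sum>k<r. y l * (\<Phi> (x + \<sigma> l) (b k) * cf i l k))"
        unfolding cf[OF i] by (simp add: sum_distrib_left)
      finally show ?thesis .
    qed
    define c where "c l k = (\<Sum>i<r. \<Phi> (a i) t * (y l * cf i l k) / minor \<Phi> r a b)" for l k
    have "\<Phi> (x + s) t = (\<Sum>(l, k)\<in>{..?M} \<times> {..<r}. c l k * \<Phi> (x + \<sigma> l) (b k))" for x
    proof -
      have "\<Phi> (x + s) t = (\<Sum>i<r. (\<theta> (x + s) i * minor \<Phi> r a b) * (\<Phi> (a i) t / minor \<Phi> r a b))"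
        using \<theta>[of "x + s" t] nz by simp
      also have "\<dots> = (\<Sum>i<r. (\<Sum>l\<le>?M. \<Sum>k<r. y l * (\<Phi> (x + \<sigma> l) (b k) * cf i l k)) * (\<Phi> (a i) t / minor \<Phi> r a b))"
        using \<theta>_shift by simp
      also have "\<dots> = (\<Sum>i<r. \<Sum>(l, k)\<in>{..?M} \<times> {..<r}. (\<Phi> (a i) t * (y l * cf i l k) / minor \<Phi> r a b) * \<Phi> (x + \<sigma> l) (b k))"
        by (simp add: sum.cartesian_product[symmetric] sum_distrib_right sum_distrib_left sum_divide_distrib mult_ac)
      also have "\<dots> = (\<Sum>(l, k)\<in>{..?M} \<times> {..<r}. \<Sum>i<r. (\<Phi> (a i) t * (y l * cf i l k) / minor \<Phi> r a b) * \<Phi> (x + \<sigma> l) (b k))"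
        by (subst sum.swap) (simp add: case_prod_beta)
      also have "\<dots> = (\<Sum>(l, k)\<in>{..?M} \<times> {..<r}. c l k * \<Phi> (x + \<sigma> l) (b k))"
        unfolding c_def by (simp add: sum_distrib_right)
      finally show ?thesis .
    qed
    then show "\<exists>c. \<forall>x. \<Phi> (x + s) t = (\<Sum>(l, k)\<in>{..?M} \<times> {..<r}. c l k * \<Phi> (x + \<sigma> l) (b k))"
      by blast
  qed
qed

text \<open>For small $s$ the functional agrees, in the transform with respect to $x$, on the exponential
  with parameters $s,t$ and on a combination of the finitely many exponentials with parameters
  $\sigma_l,b_k$. Comparing derivatives at $x = 0$, the same combination expresses all moments.
  A polynomial whose coefficients annihilate the moments of those finitely many exponentials
  therefore annihilates all of them, first for small $s$ and then, by analytic continuation,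
  everywhere.\<close>

lemma annihilating_polynomial:
  assumes H: "gauss_functional q m H" and q: "0 < q"
    and rank: "\<And>x y. minor (\<lambda>s t. H (linexp s t)) (Suc N) x y = 0"
  obtains p :: "complex poly" where "p \<noteq> 0" "\<And>s t. H (\<lambda>w. poly p w * linexp s t w) = 0"
proof -
  let ?\<Phi> = "\<lambda>s t. H (linexp s t)"
  \<comment> \<open>For $r = 0$ the minor is empty and equals $1$.\<close>
  define r where "r = (LEAST n. \<forall>x y. minor ?\<Phi> (Suc n) x y = 0)"
  have zero: "minor ?\<Phi> (Suc r) x y = 0" for x y
    using LeastI[of "\<lambda>n. \<forall>x y. minor ?\<Phi> (Suc n) x y = 0" N] rank unfolding r_def by blast
  obtain a b where nz: "minor ?\<Phi> r a b \<noteq> 0"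
  proof (cases r)
    case 0
    then show ?thesis using that by simp
  next
    case (Suc n)
    then have "\<not> (\<forall>x y. minor ?\<Phi> (Suc n) x y = 0)"
      using not_less_Least[of n "\<lambda>n. \<forall>x y. minor ?\<Phi> (Suc n) x y = 0"] by (simp add: r_def)
    then show ?thesis using that Suc by blast
  qed
  from shifts_finite_dimensional[OF H q nz zero]
  obtain \<delta> :: real and M :: nat and \<sigma> :: "nat \<Rightarrow> complex" where *: "0 < \<delta> \<and> (\<forall>s t. norm s < \<delta> \<longrightarrow>
    (\<exists>c. \<forall>x. H (linexp (x + s) t) = (\<Sum>(l, k)\<in>{..M} \<times> {..<r}. c l k * H (linexp (x + \<sigma> l) (b k)))))"
    by (elim exE)
  then have \<delta>: "0 < \<delta>" by simp
  let ?E = "{..M} \<times> {..<r}"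
  \<comment> \<open>One more power of $w$ than there are pairs $(l,k)$, so that a nontrivial
    combination exists.\<close>
  define n where "n = Suc (card ?E)"
  obtain \<eta> where \<eta>: "\<exists>j<n. \<eta> j \<noteq> 0"
    "\<And>l k. l \<le> M \<Longrightarrow> k < r \<Longrightarrow> (\<Sum>j<n. \<eta> j * H (\<lambda>w. w ^ j * linexp (\<sigma> l) (b k) w)) = 0"
    using underdetermined_system[of ?E n "\<lambda>j (l, k). H (\<lambda>w. w ^ j * linexp (\<sigma> l) (b k) w)"]
    by (auto simp: n_def)
  define p where "p = (\<Sum>j<n. Polynomial.monom (\<eta> j) j)"
  have coeff: "coeff p j = (if j < n then \<eta> j else 0)" for j
    unfolding p_def by (simp add: coeff_sum sum.delta cong: if_cong)
  have "p \<noteq> 0" using \<eta>(1) coeff by (metis coeff_0)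
  have pw: "poly p w = (\<Sum>j<n. \<eta> j * w ^ j)" for w
    by (simp add: p_def poly_sum poly_monom)
  have pG: "(\<lambda>w. poly p w * linexp s t w) = (\<lambda>w. \<Sum>j<n. \<eta> j * (w ^ j * linexp s t w))" for s t
    by (simp add: pw sum_distrib_right mult.assoc)
  have powG: "(\<lambda>w. w ^ j * linexp s t w) \<in> subgaussian" for j s t
    by (intro subgaussian_mult subgaussian_power subgaussian_id subgaussian_linexp)
  have Hp: "H (\<lambda>w. poly p w * linexp s t w) = (\<Sum>j<n. \<eta> j * H (\<lambda>w. w ^ j * linexp s t w))" for s t
    unfolding pG by (intro gauss_functional_lincomb[OF H] subgaussian_gaussian[OF powG q]) auto
  have near: "H (\<lambda>w. poly p w * linexp s t w) = 0" if s: "norm s < \<delta>" for s t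
  proof -
    obtain c where c: "\<And>x. H (linexp (x + s) t) = (\<Sum>(l, k)\<in>?E. c l k * H (linexp (x + \<sigma> l) (b k)))"
      using * s by blast
    \<comment> \<open>The transform of $A$ in the first parameter vanishes identically.\<close>
    define A where "A w = linexp s t w - (\<Sum>lk\<in>?E. c (fst lk) (snd lk) * linexp (\<sigma> (fst lk)) (b (snd lk)) w)" for w
    have A: "A \<in> subgaussian" 
      unfolding A_def[abs_def] by (intro subgaussian_diff subgaussian_linexp sum_subgaussian)
    have HA: "H (\<lambda>w. f w * A w) = H (\<lambda>w. f w * linexp s t w)
        - (\<Sum>lk\<in>?E. c (fst lk) (snd lk) * H (\<lambda>w. f w * linexp (\<sigma> (fst lk)) (b (snd lk)) w))" if f: "f \<in> subgaussian" for f
    proof -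
      have g: "(\<lambda>w. f w * linexp s' t' w) \<in> gaussian q" for s' t'
        by (intro subgaussian_gaussian[OF _ q] subgaussian_mult f subgaussian_linexp)
      have "(\<lambda>w. f w * A w) = (\<lambda>w. f w * linexp s t w
          - (\<Sum>lk\<in>?E. c (fst lk) (snd lk) * (f w * linexp (\<sigma> (fst lk)) (b (snd lk)) w)))"
        by (simp add: A_def fun_eq_iff right_diff_distrib sum_distrib_left mult.left_commute)
      moreover have "H (\<lambda>w. f w * linexp s t w
          - (\<Sum>lk\<in>?E. c (fst lk) (snd lk) * (f w * linexp (\<sigma> (fst lk)) (b (snd lk)) w)))
        = H (\<lambda>w. f w * linexp s t w) - H (\<lambda>w. \<Sum>lk\<in>?E. c (fst lk) (snd lk) * (f w * linexp (\<sigma> (fst lk)) (b (snd lk)) w))"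
        by (intro gauss_functional_diff[OF H] g gaussian_sum gaussian_cmult)
      moreover have "H (\<lambda>w. \<Sum>lk\<in>?E. c (fst lk) (snd lk) * (f w * linexp (\<sigma> (fst lk)) (b (snd lk)) w))
        = (\<Sum>lk\<in>?E. c (fst lk) (snd lk) * H (\<lambda>w. f w * linexp (\<sigma> (fst lk)) (b (snd lk)) w))"
        by (rule gauss_functional_lincomb[OF H]) (auto intro: g)
      ultimately show ?thesis by simp
    qed
    have "H (\<lambda>w. linexp x 0 w * A w) = 0" for x
    proof -
      have "(\<lambda>w. linexp x 0 w * linexp s' t' w) = linexp (x + s') t'" for s' t'
        using linexp_add[of x s' 0 t'] by (simp add: fun_eq_iff)
      then show ?thesis
        using HA[OF subgaussian_linexp[of x 0]] c[of x] by (simp add: case_prod_beta)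
    qed
    then have "H (\<lambda>w. w ^ j * A w) = 0" for j
      by (rule moments_zero[OF H q A])
    then have mom: "H (\<lambda>w. w ^ j * linexp s t w) =
        (\<Sum>lk\<in>?E. c (fst lk) (snd lk) * H (\<lambda>w. w ^ j * linexp (\<sigma> (fst lk)) (b (snd lk)) w))" for j
      using HA[OF subgaussian_power[OF subgaussian_id], of j] by simp
    have "H (\<lambda>w. poly p w * linexp s t w) = (\<Sum>j<n. \<Sum>lk\<in>?E. c (fst lk) (snd lk) *
        (\<eta> j * H (\<lambda>w. w ^ j * linexp (\<sigma> (fst lk)) (b (snd lk)) w)))"
      unfolding Hp mom by (simp add: sum_distrib_left mult.left_commute)
    also have "\<dots> = (\<Sum>lk\<in>?E. c (fst lk) (snd lk) *
        (\<Sum>j<n. \<eta> j * H (\<lambda>w. w ^ j * linexp (\<sigma> (fst lk)) (b (snd lk)) w)))"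
      by (subst sum.swap) (simp add: sum_distrib_left)
    also have "\<dots> = 0"
      using \<eta>(2) by (intro sum.neutral) auto
    finally show ?thesis .
  qed
  have pGr0: "(\<lambda>w. poly p w) \<in> subgaussian"
    unfolding pw by (intro sum_subgaussian subgaussian_power subgaussian_id)
  have "H (\<lambda>w. poly p w * linexp s t w) = 0" for s t
  proof (rule analytic_continuation[of "\<lambda>s. H (\<lambda>w. poly p w * linexp s t w)" UNIV "ball 0 \<delta>" 0])
    have A: "(\<lambda>w. poly p w * linexp 0 t w) \<in> subgaussian"
      by (intro subgaussian_mult pGr0 subgaussian_linexp)
    have "(\<lambda>s. H (\<lambda>w. linexp s 0 w * (poly p w * linexp 0 t w))) holomorphic_on UNIV"
      by (rule transform_holomorphic(1)[OF H q A])
    moreover have "(\<lambda>w. linexp s 0 w * (poly p w * linexp 0 t w)) = (\<lambda>w. poly p w * linexp s t w)" for s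
      using linexp_add[of s 0 0 t] by (simp add: fun_eq_iff)
    ultimately show "(\<lambda>s. H (\<lambda>w. poly p w * linexp s t w)) holomorphic_on UNIV" by simp
    show "0 islimpt ball (0::complex) \<delta>" using \<delta> by (simp add: islimpt_ball)
  qed (use near in auto)
  then show ?thesis using that \<open>p \<noteq> 0\<close> by blast
qed

section \<open>Lipschitz estimates\<close>

lemma norm_dir_deriv_le:
  assumes "smooth f" "norm (dir_deriv 1 f z) \<le> B" "norm (dir_deriv \<i> f z) \<le> B"
  shows "norm (dir_deriv w f z) \<le> 2 * B * norm w"
proof -
  have "norm (dir_deriv w f z) \<le> norm (of_real (Re w) * dx f z) + norm (of_real (Im w) * dy f z)"
    unfolding dir_deriv_decomp[OF smooth_differentiable[OF assms(1)], of w] by (rule norm_triangle_ineq)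
  also have "\<dots> = \<bar>Re w\<bar> * norm (dir_deriv 1 f z) + \<bar>Im w\<bar> * norm (dir_deriv \<i> f z)"
    by (simp add: norm_mult dx_dir_deriv dy_dir_deriv)
  also have "\<dots> \<le> norm w * B + norm w * B"
    using assms by (intro add_mono mult_mono abs_Re_le_cmod abs_Im_le_cmod) auto
  finally show ?thesis by simp
qed

text \<open>The factor $2$ comes from estimating an arbitrary direction by the two coordinate ones.\<close>

lemma lipschitz_on_segment:
  assumes f: "smooth f" and B: "\<And>u s. u = 1 \<or> u = \<i> \<Longrightarrow> 0 < s \<Longrightarrow> s < 1 \<Longrightarrow> norm (dir_deriv u f (z + of_real s * (z' - z))) \<le> B"
  shows "norm (f z' - f z) \<le> 2 * B * norm (z' - z)"
proof -
  have "norm (f (z + of_real 1 * (z' - z)) - f z - of_real 1 * 0) \<le> (2 * B * norm (z' - z)) * 1"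
    by (rule mean_value_bound[OF f]) (use norm_dir_deriv_le[OF f] B in auto)
  then show ?thesis by simp
qed

lemma lipschitz_bound:
  assumes f: "smooth f" and B: "\<And>z. norm (dir_deriv 1 f z) \<le> B" "\<And>z. norm (dir_deriv \<i> f z) \<le> B"
  shows "norm (f z' - f z) \<le> 2 * B * norm (z' - z)"
  by (rule lipschitz_on_segment[OF f]) (use B in auto)

lemma deriv_bound_translate_diff:
  "smooth f \<Longrightarrow> deriv_bound (Suc k) 1 (\<lambda>_. B) f \<Longrightarrow> deriv_bound k 1 (\<lambda>_. 2 * B * norm (u - u')) (\<lambda>z. f (z - u) - f (z - u'))"
proof (induction k arbitrary: f)
  case 0
  then have "norm (f (z - u) - f (z - u')) \<le> 2 * B * norm ((z - u) - (z - u'))" for z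
    by (intro lipschitz_bound) auto
  then show ?case by (simp add: norm_minus_commute)
next
  case (Suc k)
  have B: "norm (dir_deriv 1 f z) \<le> B" "norm (dir_deriv \<i> f z) \<le> B" for z
    using deriv_bound_norm[OF deriv_bound_SucD[OF Suc.prems(2)]] by auto
  show ?case
  proof (rule deriv_bound_SucI)
    have "norm (f (z - u) - f (z - u')) \<le> 2 * B * norm ((z - u) - (z - u'))" for z
      by (rule lipschitz_bound[OF Suc.prems(1) B])
    then show "norm (f (z - u) - f (z - u')) \<le> 2 * B * norm (u - u')" for z
      by (simp add: norm_minus_commute)
    fix v :: complex assume v: "v = 1 \<or> v = \<i>"
    have "dir_deriv v (\<lambda>z. f (z - u) - f (z - u')) = (\<lambda>z. dir_deriv v f (z - u) - dir_deriv v f (z - u'))"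
      by (simp only: dir_deriv_diff_smooth[OF smooth_translate smooth_translate] dir_deriv_translate Suc.prems(1))
    moreover have "deriv_bound (Suc k) 1 (\<lambda>_. B) (dir_deriv v f)"
      using deriv_bound_SucD[OF Suc.prems(2) v] by simp
    ultimately show "deriv_bound k 1 (\<lambda>z. 1 * (2 * B * norm (u - u'))) (dir_deriv v (\<lambda>z. f (z - u) - f (z - u')))"
      using Suc.IH[OF smooth_dir_deriv[OF Suc.prems(1)]] by simp
  qed
qed

section \<open>Averages of periodic functions over finite grids\<close>

definition periodic :: "real \<Rightarrow> (complex \<Rightarrow> complex) \<Rightarrow> bool" where
  "periodic L f \<longleftrightarrow> (\<forall>z. f (z + of_real L) = f z \<and> f (z + \<i> * of_real L) = f z)"

lemma periodic_dir_deriv: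
  assumes f: "smooth f" and p: "periodic L f" shows "periodic L (dir_deriv v f)"
proof -
  have "dir_deriv v f (z - u) = dir_deriv v f z" if "\<And>z. f (z - u) = f z" for z u
  proof -
    have "(\<lambda>z. dir_deriv v f (z - u)) = dir_deriv v (\<lambda>z. f (z - u))"
      by (rule dir_deriv_translate[OF f, symmetric])
    also have "(\<lambda>z. f (z - u)) = f" using that by auto
    finally show ?thesis by metis
  qed
  from this[of "- of_real L"] this[of "- (\<i> * of_real L)"] show ?thesis
    using p by (simp add: periodic_def)
qed

lemma periodic_shift:
  assumes p: "periodic L f"
  shows "f (z + of_real (of_int k * L) + \<i> * of_real (of_int l * L)) = f z"
proof -
  have Re: "f (z + of_real (of_int k * L)) = f z" for z k
  proof (induction k arbitrary: z rule: int_induct[where k = 0])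
    case (step1 i)
    have "f (z + of_real (of_int (i + 1) * L)) = f ((z + of_real (of_int i * L)) + of_real L)"
      by (simp add: algebra_simps)
    then show ?case using p step1 by (simp only: periodic_def)
  next
    case (step2 i)
    have "f (z + of_real (of_int (i - 1) * L)) = f ((z + of_real (of_int (i - 1) * L)) + of_real L)"
      using p by (simp only: periodic_def)
    also have "(z + of_real (of_int (i - 1) * L)) + of_real L = z + of_real (of_int i * L)"
      by (simp add: algebra_simps)
    finally show ?case using step2 by simp
  qed simp
  have Im: "f (z + \<i> * of_real (of_int k * L)) = f z" for z k
  proof (induction k arbitrary: z rule: int_induct[where k = 0])
    case (step1 i)
    have "f (z + \<i> * of_real (of_int (i + 1) * L)) = f ((z + \<i> * of_real (of_int i * L)) + \<i> * of_real L)"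
      by (simp add: algebra_simps)
    then show ?case using p step1 by (simp only: periodic_def)
  next
    case (step2 i)
    have "f (z + \<i> * of_real (of_int (i - 1) * L)) = f ((z + \<i> * of_real (of_int (i - 1) * L)) + \<i> * of_real L)"
      using p by (simp only: periodic_def)
    also have "(z + \<i> * of_real (of_int (i - 1) * L)) + \<i> * of_real L = z + \<i> * of_real (of_int i * L)"
      by (simp add: algebra_simps)
    finally show ?case using step2 by simp
  qed simp
  show ?thesis unfolding Im Re ..
qed

lemma periodic_reduce:
  assumes p: "periodic L f" and L: "0 < L"
  obtains z' where "f z' = f z" "norm z' \<le> 2 * L"
proof -
  define k l where "k = \<lfloor>Re z / L\<rfloor>" and "l = \<lfloor>Im z / L\<rfloor>"
  define z' where "z' = Complex (Re z - of_int k * L) (Im z - of_int l * L)"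
  have "z' + of_real (of_int k * L) + \<i> * of_real (of_int l * L) = z"
    by (simp add: z'_def complex_eq_iff)
  then have "f z' = f z" using periodic_shift[OF p, of z' k l] by simp
  have frac: "0 \<le> x - of_int \<lfloor>x / L\<rfloor> * L" "x - of_int \<lfloor>x / L\<rfloor> * L \<le> L" for x
  proof -
    have "of_int \<lfloor>x / L\<rfloor> * L \<le> x" "x \<le> (of_int \<lfloor>x / L\<rfloor> + 1) * L"
      using L of_int_floor_le[of "x / L"] real_of_int_floor_add_one_ge[of "x / L"]
      by (simp_all only: pos_le_divide_eq pos_divide_le_eq)
    then show "0 \<le> x - of_int \<lfloor>x / L\<rfloor> * L" "x - of_int \<lfloor>x / L\<rfloor> * L \<le> L"
      by (simp_all only: distrib_right)
  qed
  have "norm z' \<le> \<bar>Re z'\<bar> + \<bar>Im z'\<bar>" by (rule cmod_le)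
  also have "\<dots> \<le> 2 * L"
    using frac[of "Re z"] frac[of "Im z"] by (simp add: z'_def k_def l_def)
  finally have "norm z' \<le> 2 * L" .
  with \<open>f z' = f z\<close> show ?thesis by (rule that)
qed

lemma periodic_bounded:
  assumes "continuous_on UNIV f" "periodic L f" "0 < L" 
  obtains B where "\<And>z. norm (f z) \<le> B"
proof -
  have "compact (f ` cball 0 (2 * L))"
    using assms(1) by (intro compact_continuous_image compact_cball) (auto intro: continuous_on_subset)
  then obtain B where "\<forall>y\<in>f ` cball 0 (2 * L). norm y \<le> B"
    using compact_imp_bounded bounded_iff by metis
  then have "norm (f z) \<le> B" for z
    using periodic_reduce[OF assms(2,3), of z] by (metis imageI mem_cball_0)
  then show ?thesis using that by blast
qed

lemma periodic_deriv_bound: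
  assumes L: "0 < L" and f: "smooth f" "periodic L f" shows "\<exists>B. deriv_bound k 1 (\<lambda>_. B) f"
proof (rule deriv_bound_of_closed_class[where P = "\<lambda>f. smooth f \<and> periodic L f"])
  show "smooth f \<and> periodic L f" using f by blast
  show "\<exists>B. \<forall>z. norm (f z) \<le> B" if "smooth f \<and> periodic L f" for f
    using periodic_bounded[OF smooth_continuous _ L] that by metis
qed (simp add: smooth_dir_deriv periodic_dir_deriv)

definition grid :: "real \<Rightarrow> nat \<Rightarrow> nat \<times> nat \<Rightarrow> complex" where
  "grid L n = (\<lambda>(j, k). Complex (L * real j / real n) (L * real k / real n))"

definition grid_avg :: "real \<Rightarrow> nat \<Rightarrow> (complex \<Rightarrow> complex) \<Rightarrow> complex" where
  "grid_avg L n f = of_real (1 / (real n)\<^sup>2) * (\<Sum>p\<in>{..<n} \<times> {..<n}. f (grid L n p))"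

definition grid_mean :: "real \<Rightarrow> nat \<Rightarrow> (complex \<Rightarrow> complex) \<Rightarrow> complex \<Rightarrow> complex" where
  "grid_mean L n f z = grid_avg L n (\<lambda>u. f (z - u))"

lemma dir_deriv_sum_smooth:
  "finite I \<Longrightarrow> (\<And>i. i \<in> I \<Longrightarrow> smooth (f i)) \<Longrightarrow> dir_deriv v (\<lambda>z. \<Sum>i\<in>I. f i z) = (\<lambda>z. \<Sum>i\<in>I. dir_deriv v (f i) z)"
  by (induction I rule: finite_induct) (auto simp: dir_deriv_add_smooth smooth_sum)

lemma smooth_grid_mean: "smooth f \<Longrightarrow> smooth (grid_mean L n f)"
  unfolding grid_mean_def[abs_def] grid_avg_def by (intro smooth_intros smooth_translate)

lemma dir_deriv_grid_mean: 
  assumes "smooth f" shows "dir_deriv v (grid_mean L n f) = grid_mean L n (dir_deriv v f)"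
  unfolding grid_mean_def[abs_def] grid_avg_def
  using assms by (simp only: dir_deriv_cmult_smooth dir_deriv_sum_smooth smooth_sum smooth_translate dir_deriv_translate
      finite_cartesian_product finite_lessThan)

lemma periodic_grid_mean: "periodic L f \<Longrightarrow> periodic L (grid_mean L n f)"
  unfolding periodic_def grid_mean_def grid_avg_def diff_add_eq[symmetric] by simp

text \<open>Each step of length $L/n$ changes $f$ by $L/n$ times its derivative, up to $B(L/n)^2$. Over a
  full period the changes of $f$ telescope to zero.\<close>

lemma riemann_sum_of_derivative:
  assumes f: "smooth f" and per: "\<And>z. f (z - of_real L * v) = f z" and L: "0 < L"
    and B: "\<And>z. norm (dir_deriv v (dir_deriv v f) z) \<le> B" and n: "0 < n"
  shows "norm (\<Sum>j<n. dir_deriv v f (z - of_real (L * real j / real n) * v)) \<le> B * L"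
proof -
  define h where "h = L / real n"
  have h: "0 < h" using L n by (simp add: h_def)
  define p where "p j = z - of_real (real j * h) * v" for j
  have neg: "dir_deriv (- v) g = (\<lambda>z. - dir_deriv v g z)" if "smooth g" for g
    using dir_deriv_decomp[OF smooth_differentiable[OF that]] by (auto simp: fun_eq_iff)
  have p_Suc: "p (Suc j) = p j + of_real h * (- v)" for j
    by (simp add: p_def algebra_simps)
  have step: "norm (f (p (Suc j)) - f (p j) + of_real h * dir_deriv v f (p j)) \<le> (B * h) * h" for j
  proof -
    have "norm (f (p j + of_real h * (- v)) - f (p j) - of_real h * (- dir_deriv v f (p j))) \<le> (B * h) * h"
    proof (rule mean_value_bound[OF f])
      fix s :: real assume s: "0 < s" "s < h"
      have "norm (dir_deriv v f (p j + of_real s * (- v)) - dir_deriv v f (p j) - of_real s * 0) \<le> B * s"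
      proof (rule mean_value_bound[OF smooth_dir_deriv[OF f]])
        show "norm (dir_deriv (- v) (dir_deriv v f) (p j + of_real t * (- v)) - 0) \<le> B" for t
          using B by (simp add: neg smooth_dir_deriv f)
      qed (use s in simp)
      also have "B * s \<le> B * h"
        using s order_trans[OF norm_ge_zero B] by (intro mult_left_mono) auto
      finally show "norm (dir_deriv (- v) f (p j + of_real s * (- v)) - (- dir_deriv v f (p j))) \<le> B * h"
        by (simp add: neg f norm_minus_commute)
    qed (rule h)
    then show ?thesis by (simp add: p_Suc)
  qed
  have "(\<Sum>j<n. f (p (Suc j)) - f (p j)) = f (p n) - f (p 0)"
    by (rule sum_lessThan_telescope)
  also have "\<dots> = 0"
    using per[of z] n by (simp add: p_def h_def)
  finally have tele: "(\<Sum>j<n. f (p (Suc j)) - f (p j)) = 0" .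
  have "of_real h * (\<Sum>j<n. dir_deriv v f (p j)) = (\<Sum>j<n. f (p (Suc j)) - f (p j) + of_real h * dir_deriv v f (p j))"
    by (simp add: sum.distrib tele sum_distrib_left)
  also have "norm \<dots> \<le> (\<Sum>j<n. (B * h) * h)"
    using step by (intro sum_norm_le) auto
  also have "\<dots> = h * (B * L)" using n by (simp add: h_def)
  finally have "h * norm (\<Sum>j<n. dir_deriv v f (p j)) \<le> h * (B * L)"
    using h by (simp add: norm_mult)
  then have "norm (\<Sum>j<n. dir_deriv v f (p j)) \<le> B * L"
    using h by simp
  then show ?thesis by (simp add: p_def h_def mult.commute)
qed

text \<open>The sum over the grid splits into $n$ lines in the direction of the derivative, each of which
  runs through one period.\<close>

lemma grid_mean_derivative_small:
  assumes f: "smooth f" and per: "periodic L f" and L: "0 < L" and v: "v = 1 \<or> v = \<i>"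
    and B: "\<And>z. norm (dir_deriv v (dir_deriv v f) z) \<le> B" and n: "0 < n"
  shows "norm (grid_mean L n (dir_deriv v f) z) \<le> B * L / real n"
proof -
  have pv: "f (z - of_real L * v) = f z" for z
    using per v unfolding periodic_def by (metis diff_add_cancel mult.commute mult.right_neutral)
  note rs = riemann_sum_of_derivative[OF f pv L B n]
  let ?S = "\<Sum>p\<in>{..<n} \<times> {..<n}. dir_deriv v f (z - grid L n p)"
  have "norm ?S \<le> real n * (B * L)"
  proof (cases "v = 1")
    case True
    have "?S = (\<Sum>k<n. \<Sum>j<n. dir_deriv v f ((z - \<i> * of_real (L * real k / real n)) - of_real (L * real j / real n) * v))"
      unfolding sum.cartesian_product'
      by (subst sum.swap) (intro sum.cong refl arg_cong[where f = "dir_deriv v f"], simp add: grid_def complex_eq_iff True)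
    also have "norm \<dots> \<le> (\<Sum>k<n. B * L)" by (intro sum_norm_le rs)
    finally show ?thesis by simp
  next
    case False
    then have v: "v = \<i>" using v by simp
    have "?S = (\<Sum>j<n. \<Sum>k<n. dir_deriv v f ((z - of_real (L * real j / real n)) - of_real (L * real k / real n) * v))"
      unfolding sum.cartesian_product'
      by (intro sum.cong refl arg_cong[where f = "dir_deriv v f"]) (simp add: grid_def complex_eq_iff v)
    also have "norm \<dots> \<le> (\<Sum>j<n. B * L)" by (intro sum_norm_le rs)
    finally show ?thesis by simp
  qed
  then have "1 / (real n)\<^sup>2 * norm ?S \<le> 1 / (real n)\<^sup>2 * (real n * (B * L))"
    by (intro mult_left_mono) auto
  also have "\<dots> = B * L / real n" using n by (simp add: power2_eq_square)
  finally show ?thesis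
    unfolding grid_mean_def grid_avg_def by (simp add: norm_mult norm_divide norm_power)
qed

lemma deriv_bound_grid_mean_derivative:
  assumes L: "0 < L"
  shows "smooth f \<Longrightarrow> periodic L f \<Longrightarrow>
    \<exists>K. \<forall>n>0. \<forall>v\<in>{1, \<i>}. deriv_bound k 1 (\<lambda>_. K / real n) (grid_mean L n (dir_deriv v f))"
proof (induction k arbitrary: f)
  case 0
  obtain B1 where B1: "deriv_bound 0 1 (\<lambda>_. B1) (dir_deriv 1 (dir_deriv 1 f))"
    using periodic_deriv_bound[OF L] smooth_dir_deriv periodic_dir_deriv 0 by meson
  obtain B2 where B2: "deriv_bound 0 1 (\<lambda>_. B2) (dir_deriv \<i> (dir_deriv \<i> f))"
    using periodic_deriv_bound[OF L] smooth_dir_deriv periodic_dir_deriv 0 by meson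
  have "norm (grid_mean L n (dir_deriv v f) z) \<le> max B1 B2 * L / real n" if "0 < n" "v \<in> {1, \<i>}" for n v z
  proof (rule grid_mean_derivative_small[OF 0 L _ _ that(1)])
    show "v = 1 \<or> v = \<i>" using that by simp
    show "norm (dir_deriv v (dir_deriv v f) z) \<le> max B1 B2" for z
      using that B1 B2 by (auto simp: le_max_iff_disj)
  qed
  then show ?case by (intro exI[of _ "max B1 B2 * L"]) simp
next
  case (Suc k)
  obtain K0 where K0: "\<And>n v. 0 < n \<Longrightarrow> v \<in> {1, \<i>} \<Longrightarrow> deriv_bound k 1 (\<lambda>_. K0 / real n) (grid_mean L n (dir_deriv v f))"
    using Suc.IH[OF Suc.prems] by blast
  obtain K1 where K1: "\<And>n v. 0 < n \<Longrightarrow> v \<in> {1, \<i>} \<Longrightarrow> deriv_bound k 1 (\<lambda>_. K1 / real n) (grid_mean L n (dir_deriv v (dir_deriv 1 f)))"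
    using Suc.IH[OF smooth_dir_deriv[OF Suc.prems(1)] periodic_dir_deriv[OF Suc.prems]] by blast
  obtain K2 where K2: "\<And>n v. 0 < n \<Longrightarrow> v \<in> {1, \<i>} \<Longrightarrow> deriv_bound k 1 (\<lambda>_. K2 / real n) (grid_mean L n (dir_deriv v (dir_deriv \<i> f)))"
    using Suc.IH[OF smooth_dir_deriv[OF Suc.prems(1)] periodic_dir_deriv[OF Suc.prems]] by blast
  let ?K = "max K0 (max K1 K2)"
  have le: "K0 / real n \<le> ?K / real n" "K1 / real n \<le> ?K / real n" "K2 / real n \<le> ?K / real n" for n
    by (intro divide_right_mono; simp)+
  have "deriv_bound (Suc k) 1 (\<lambda>_. ?K / real n) (grid_mean L n (dir_deriv v f))" if n: "0 < n" and v: "v \<in> {1, \<i>}" for n v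
  proof (rule deriv_bound_SucI)
    show "norm (grid_mean L n (dir_deriv v f) z) \<le> ?K / real n" for z
      using deriv_bound_norm[OF K0[OF n v], of z] le(1)[of n] by linarith
    fix u :: complex assume u: "u = 1 \<or> u = \<i>"
    have "deriv_bound k 1 (\<lambda>_. ?K / real n) (grid_mean L n (dir_deriv u (dir_deriv v f)))"
      using v u deriv_bound_weaken[OF K1[OF n, of u], of "\<lambda>_. ?K / real n"]
        deriv_bound_weaken[OF K2[OF n, of u], of "\<lambda>_. ?K / real n"] le by auto
    then show "deriv_bound k 1 (\<lambda>z. 1 * (?K / real n)) (dir_deriv u (grid_mean L n (dir_deriv v f)))"
      using dir_deriv_grid_mean[OF smooth_dir_deriv[OF Suc.prems(1)]] by simp
  qed
  then show ?case by blast
qed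

text \<open>Averaging over the grid of mesh $L/n$ projects onto the constants, up to an error $O(1/n)$ in
  all derivatives. The derivatives of the mean are means of derivatives and hence small; the
  values follow by the Lipschitz estimate, as every point has a representative at bounded
  distance from $0$.\<close>

lemma grid_mean_near_constant:
  assumes L: "0 < L" and f: "smooth f" and p: "periodic L f"
  shows "\<exists>K. \<forall>n>0. deriv_bound k 1 (\<lambda>_. K / real n) (\<lambda>z. grid_mean L n f z - grid_mean L n f 0)"
proof -
  obtain K where K: "\<And>n v. 0 < n \<Longrightarrow> v \<in> {1, \<i>} \<Longrightarrow> deriv_bound k 1 (\<lambda>_. K / real n) (grid_mean L n (dir_deriv v f))"
    using deriv_bound_grid_mean_derivative[OF L f p] by blast
  have K0: "0 \<le> K" using deriv_bound_nonneg[OF K[of 1 1]] by simp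
  let ?K = "2 * K * (2 * L) + K"
  have val: "norm (grid_mean L n f z - grid_mean L n f 0) \<le> 2 * K * (2 * L) / real n" if n: "0 < n" for n z
  proof -
    obtain z' where z': "grid_mean L n f z' = grid_mean L n f z" "norm z' \<le> 2 * L"
      using periodic_reduce[OF periodic_grid_mean[OF p] L] by blast
    have "norm (grid_mean L n f z' - grid_mean L n f 0) \<le> 2 * (K / real n) * norm (z' - 0)"
    proof (rule lipschitz_bound[OF smooth_grid_mean[OF f]])
      show "norm (dir_deriv 1 (grid_mean L n f) z) \<le> K / real n" "norm (dir_deriv \<i> (grid_mean L n f) z) \<le> K / real n" for z
        unfolding dir_deriv_grid_mean[OF f] using deriv_bound_norm[OF K[OF n]] by auto
    qed
    also have "\<dots> \<le> 2 * (K / real n) * (2 * L)"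
      using z'(2) K0 by (intro mult_left_mono) auto
    finally show ?thesis using z'(1) by (simp add: mult.assoc)
  qed
  have le: "2 * K * (2 * L) / real n \<le> ?K / real n" "K / real n \<le> ?K / real n" for n
    using K0 L by (intro divide_right_mono; simp)+
  have "deriv_bound k 1 (\<lambda>_. ?K / real n) (\<lambda>z. grid_mean L n f z - grid_mean L n f 0)" if n: "0 < n" for n
  proof (cases k)
    case 0
    show ?thesis unfolding 0 deriv_bound.simps using val[OF n] le(1)[of n] order_trans by blast
  next
    case (Suc k')
    show ?thesis unfolding Suc
    proof (rule deriv_bound_SucI)
      show "norm (grid_mean L n f z - grid_mean L n f 0) \<le> ?K / real n" for z
        using val[OF n, of z] le(1)[of n] by linarith
      fix u :: complex assume u: "u = 1 \<or> u = \<i>"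
      have "dir_deriv u (\<lambda>z. grid_mean L n f z + (- grid_mean L n f 0)) = grid_mean L n (dir_deriv u f)"
        using dir_deriv_add_smooth[OF smooth_grid_mean[OF f] smooth_const[of "- grid_mean L n f 0"], of u] dir_deriv_grid_mean[OF f]
        by simp
      moreover have "deriv_bound k' 1 (\<lambda>_. K / real n) (grid_mean L n (dir_deriv u f))"
        by (rule deriv_bound_antimono[OF K[OF n]]) (use u Suc in auto)
      ultimately show "deriv_bound k' 1 (\<lambda>z. 1 * (?K / real n)) (dir_deriv u (\<lambda>z. grid_mean L n f z - grid_mean L n f 0))"
        using deriv_bound_weaken[of k' 1 "\<lambda>_. K / real n" _ "\<lambda>_. ?K / real n"] le(2)[of n] by simp
    qed
  qed
  then show ?thesis by blast
qed

section \<open>A functional vanishing on exponentials vanishes on periodic functions\<close>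

lemma periodic_subgaussian: "0 < L \<Longrightarrow> smooth f \<Longrightarrow> periodic L f \<Longrightarrow> f \<in> subgaussian"
  by (rule subgaussian_bounded) (auto intro: periodic_deriv_bound)

lemma periodic_translate: "periodic L f \<Longrightarrow> periodic L (\<lambda>z. f (z - u))"
  by (simp add: periodic_def diff_add_eq[symmetric])

lemma functional_grid_mean:
  assumes H: "gauss_functional q m H" and q: "0 < q" and L: "0 < L" and f: "smooth f" and p: "periodic L f"
  shows "H (grid_mean L n f) = grid_avg L n (\<lambda>u. H (\<lambda>z. f (z - u)))"
proof -
  have G: "(\<lambda>z. f (z - u)) \<in> gaussian q" for u
    by (rule subgaussian_gaussian[OF periodic_subgaussian[OF L smooth_translate[OF f] periodic_translate[OF p]] q])
  have "H (grid_mean L n f) = of_real (1 / (real n)\<^sup>2) * H (\<lambda>z. \<Sum>p\<in>{..<n} \<times> {..<n}. f (z - grid L n p))"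
    unfolding grid_mean_def[abs_def] grid_avg_def by (intro gauss_functional_cmult[OF H] gaussian_sum G)
  also have "H (\<lambda>z. \<Sum>p\<in>{..<n} \<times> {..<n}. f (z - grid L n p)) = (\<Sum>p\<in>{..<n} \<times> {..<n}. H (\<lambda>z. f (z - grid L n p)))"
    by (rule gauss_functional_sum[OF H]) (auto intro: G)
  finally show ?thesis by (simp add: grid_avg_def)
qed

text \<open>The average is the value of $H$ at the grid mean of $f$, which is close to a constant, and $H$
  kills constants.\<close>

lemma translates_average_to_zero:
  assumes H: "gauss_functional q m H" and q: "0 < q" and L: "0 < L" and f: "smooth f" and p: "periodic L f"
    and one: "H (\<lambda>_. 1) = 0"
  shows "(\<lambda>n. grid_avg L n (\<lambda>u. H (\<lambda>z. f (z - u)))) \<longlonglongrightarrow> 0"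
proof -
  obtain C where C: "0 \<le> C" "\<And>f B. f \<in> gaussian q \<Longrightarrow> deriv_bound m 1 (\<lambda>z. B * exp (q * (norm z)\<^sup>2)) f \<Longrightarrow> norm (H f) \<le> C * B"
    using gauss_functional_bound[OF H] by metis
  obtain K where K: "\<And>n. 0 < n \<Longrightarrow> deriv_bound m 1 (\<lambda>_. K / real n) (\<lambda>z. grid_mean L n f z - grid_mean L n f 0)"
    using grid_mean_near_constant[OF L f p] by metis
  have gm: "grid_mean L n f \<in> gaussian q" for n
    by (rule subgaussian_gaussian[OF periodic_subgaussian[OF L smooth_grid_mean[OF f] periodic_grid_mean[OF p]] q])
  have "norm (grid_avg L n (\<lambda>u. H (\<lambda>z. f (z - u)))) \<le> C * K * (1 / real n)" if n: "0 < n" for n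
  proof -
    have c: "(\<lambda>z. c) \<in> gaussian q" for c using q by (intro gaussian_const) simp
    have "H (\<lambda>z. grid_mean L n f z - grid_mean L n f 0) = H (grid_mean L n f) - H (\<lambda>z. grid_mean L n f 0)"
      by (rule gauss_functional_diff[OF H gm c])
    also have "H (\<lambda>z. grid_mean L n f 0) = 0"
      using gauss_functional_cmult[OF H c, of "grid_mean L n f 0" 1] one by simp
    finally have "H (\<lambda>z. grid_mean L n f z - grid_mean L n f 0) = grid_avg L n (\<lambda>u. H (\<lambda>z. f (z - u)))"
      using functional_grid_mean[OF H q L f p] by simp
    moreover have "norm (H (\<lambda>z. grid_mean L n f z - grid_mean L n f 0)) \<le> C * (K / real n)"
      by (rule C(2)[OF gaussian_diff[OF gm c] deriv_bound_gauss_of_deriv_bound[OF K[OF n]]]) (use q in simp)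
    ultimately show ?thesis by simp
  qed
  then have "\<forall>\<^sub>F n in sequentially. norm (grid_avg L n (\<lambda>u. H (\<lambda>z. f (z - u)))) \<le> C * K * (1 / real n)"
    using eventually_gt_at_top[of 0] by (rule eventually_mono[rotated])
  moreover have "(\<lambda>n. C * K * (1 / real n)) \<longlonglongrightarrow> 0"
    by (rule tendsto_mult_right_zero) (rule lim_1_over_n)
  ultimately show ?thesis by (rule Lim_null_comparison)
qed

text \<open>The character $w \mapsto e^{2i\,\mathrm{Im}(sw)}$.\<close>

definition character :: "complex \<Rightarrow> complex \<Rightarrow> complex" where
  "character s = linexp s (- cnj s)"

lemma character_add_exp: "character (s + t) z = character s z * character t z"
  using linexp_add[of s t "- cnj s" "- cnj t"] by (simp add: character_def)

lemma character_add: "character s (z + w) = character s z * character s w"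
  by (simp add: character_def linexp_def exp_add[symmetric] algebra_simps)

lemma character_0 [simp]: "character 0 z = 1"
  by (simp add: character_def)

lemma character_uminus: "character (- s) z = character s (- z)"
  by (simp add: character_def linexp_def)

lemma character_inverse: "character (- s) z * character s z = 1" "character s z * character (- s) z = 1"
  using character_add_exp[of "- s" s z] character_add_exp[of s "- s" z] by simp_all

definition dual_lattice :: "real \<Rightarrow> complex set" where
  "dual_lattice L = {s. periodic L (character s)}"

lemma dual_lattice_add: "s \<in> dual_lattice L \<Longrightarrow> t \<in> dual_lattice L \<Longrightarrow> s + t \<in> dual_lattice L"
  by (simp add: dual_lattice_def periodic_def character_add_exp)

lemma dual_lattice_uminus: "s \<in> dual_lattice L \<Longrightarrow> - s \<in> dual_lattice L"
proof -
  assume s: "s \<in> dual_lattice L"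
  have "character (- s) z = inverse (character s z)" for z
    using character_inverse(1)[of s z] by (metis inverse_unique mult.commute)
  then show ?thesis using s by (simp add: dual_lattice_def periodic_def)
qed

lemma dual_lattice_0: "0 \<in> dual_lattice L"
  by (simp add: dual_lattice_def periodic_def)

lemma grid_avg_add: "grid_avg L n (\<lambda>u. f u + g u) = grid_avg L n f + grid_avg L n g"
  and grid_avg_cmult: "grid_avg L n (\<lambda>u. c * f u) = c * grid_avg L n f"
  by (simp_all add: grid_avg_def sum.distrib distrib_left sum_distrib_left mult.left_commute)

text \<open>Multiplying $f$ by the inverse of the character and $H$ by the character reduces the claim to
  the trivial character; that the new functional kills constants means that $H$ kills the
  character.\<close>

lemma grid_avg_character_to_zero:
  assumes H: "gauss_functional q m H" and q: "0 < q" and L: "0 < L" and f: "smooth f" and p: "periodic L f"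
    and E: "\<And>s t. H (linexp s t) = 0" and s: "s \<in> dual_lattice L"
  shows "(\<lambda>n. grid_avg L n (\<lambda>u. H (\<lambda>z. f (z - u)) * character s u)) \<longlonglongrightarrow> 0"
proof -
  let ?g = "\<lambda>z. character (- s) z * f z"
  let ?K = "\<lambda>h. H (\<lambda>z. character s z * h z)"
  have K: "gauss_functional (q/2) m ?K"
    unfolding character_def using q by (intro gauss_functional_mult0[OF H] subgaussian_linexp) auto
  have "(\<lambda>n. grid_avg L n (\<lambda>u. ?K (\<lambda>z. ?g (z - u)))) \<longlonglongrightarrow> 0"
  proof (rule translates_average_to_zero[OF K _ L])
    show "smooth ?g" unfolding character_def by (intro smooth_mult smooth_linexp f)
    show "periodic L ?g"
      using p dual_lattice_uminus[OF s] by (simp add: periodic_def dual_lattice_def)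
    show "?K (\<lambda>_. 1) = 0" using E by (simp add: character_def)
  qed (use q in simp)
  moreover have "?K (\<lambda>z. ?g (z - u)) = H (\<lambda>z. f (z - u)) * character s u" for u
  proof -
    have e: "character s z * ?g (z - u) = character s u * f (z - u)" for z
    proof -
      have "character (- s) (z - u) = character (- s) z * character s u"
        using character_add[of "- s" z "- u"] character_uminus[of s "- u"] by simp
      then show ?thesis using character_inverse(2)[of s z] by (simp add: mult.assoc[symmetric])
    qed
    have "H (\<lambda>z. character s u * f (z - u)) = character s u * H (\<lambda>z. f (z - u))"
      by (rule gauss_functional_cmult[OF H subgaussian_gaussian[OF periodic_subgaussian[OF L smooth_translate[OF f] periodic_translate[OF p]] q]])
    then show ?thesis unfolding e by simp
  qed
  ultimately show ?thesis by simp
qed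

text \<open>A nonnegative trigonometric polynomial, equal to $1$ at the lattice points and smaller
  elsewhere, so that its powers concentrate there.\<close>

definition peak :: "real \<Rightarrow> complex \<Rightarrow> real" where
  "peak L u = ((1 + cos (2 * pi * Re u / L)) / 2) * ((1 + cos (2 * pi * Im u / L)) / 2)"

lemma half_cos: "0 \<le> (1 + cos x) / 2" "(1 + cos x) / 2 \<le> (1::real)"
proof -
  have c: "-1 \<le> cos x" "cos x \<le> 1" by auto
  show "0 \<le> (1 + cos x) / 2" "(1 + cos x) / 2 \<le> (1::real)" using c by argo+
qed

lemma peak_nonneg: "0 \<le> peak L u"
  unfolding peak_def by (intro mult_nonneg_nonneg half_cos)

lemma peak_le_1: "peak L u \<le> 1"
  unfolding peak_def using half_cos mult_le_one by blast

lemma peak_eq_1: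
  assumes L: "0 < L" and "peak L u = 1"
  obtains k l :: int where "u = of_real (of_int k * L) + \<i> * of_real (of_int l * L)"
proof -
  have factor: "x = 1" if "x * y = 1" "0 \<le> x" "x \<le> 1" "y \<le> 1" for x y :: real
    using mult_left_mono[OF that(4,2)] that by simp
  have "(1 + cos (2 * pi * Re u / L)) / 2 = 1" "(1 + cos (2 * pi * Im u / L)) / 2 = 1"
    using assms(2) unfolding peak_def
    by (rule factor[OF _ half_cos half_cos(2)], rule factor[OF _ half_cos half_cos(2), OF trans[OF mult.commute]])
  then have "cos (2 * pi * Re u / L) = 1" "cos (2 * pi * Im u / L) = 1" by simp_all
  then obtain k l :: int where "2 * pi * Re u / L = of_int k * 2 * pi" "2 * pi * Im u / L = of_int l * 2 * pi"
    unfolding cos_one_2pi_int by blast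
  then have "Re u = of_int k * L" "Im u = of_int l * L"
    using L by (simp_all add: field_simps)
  then have "u = of_real (of_int k * L) + \<i> * of_real (of_int l * L)"
    by (simp add: complex_eq_iff)
  then show ?thesis using that by blast
qed

lemma character_re_im:
  "character (\<i> * of_real (pi / L)) u = cis (2 * pi * Re u / L)"
  "character (of_real (pi / L)) u = cis (2 * pi * Im u / L)"
proof -
  have "\<i> * of_real (pi / L) * u + - cnj (\<i> * of_real (pi / L)) * cnj u = \<i> * of_real (2 * pi * Re u / L)"
    by (simp add: complex_eq_iff)
  then show "character (\<i> * of_real (pi / L)) u = cis (2 * pi * Re u / L)"
    by (simp add: character_def linexp_def cis_conv_exp)
  have "of_real (pi / L) * u + - cnj (of_real (pi / L)) * cnj u = \<i> * of_real (2 * pi * Im u / L)"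
    by (simp add: complex_eq_iff)
  then show "character (of_real (pi / L)) u = cis (2 * pi * Im u / L)"
    by (simp add: character_def linexp_def cis_conv_exp)
qed

lemma dual_lattice_generators:
  assumes "0 < L" shows "\<i> * of_real (pi / L) \<in> dual_lattice L" "of_real (pi / L) \<in> dual_lattice L"
proof -
  have *: "cis (2 * pi * (x + L) / L) = cis (2 * pi * x / L)" for x
  proof -
    have "2 * pi * (x + L) / L = 2 * pi * x / L + 2 * pi" using assms by (simp add: field_simps)
    then show ?thesis by (simp add: cis_mult[symmetric] del: cis_mult)
  qed
  show "\<i> * of_real (pi / L) \<in> dual_lattice L" "of_real (pi / L) \<in> dual_lattice L"
    unfolding dual_lattice_def periodic_def mem_Collect_eq character_re_im using * by simp_all
qed

lemma peak_eq:
  fixes L defines "a \<equiv> \<i> * complex_of_real (pi / L)" and "b \<equiv> complex_of_real (pi / L)"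
  shows "of_real (peak L u) = (1/16) * ((2 + character a u + character (- a) u) * (2 + character b u + character (- b) u))"
proof -
  have c: "character s u + character (- s) u = of_real (2 * cos x)" if "character s u = cis x" for s x
  proof -
    have "character (- s) u * cis x = 1" using character_inverse(1)[of s u] that by simp
    then have "character (- s) u = cis (- x)"
      by (metis cis_inverse inverse_unique mult.commute)
    then show ?thesis using that by (simp add: complex_eq_iff)
  qed
  have "character a u + character (- a) u = of_real (2 * cos (2 * pi * Re u / L))"
       "character b u + character (- b) u = of_real (2 * cos (2 * pi * Im u / L))"
    unfolding a_def b_def by (intro c character_re_im)+
  then show ?thesis by (simp add: peak_def add.assoc field_simps)
qed

text \<open>The powers of the peak are combinations of characters of the dual lattice.\<close>

lemma grid_avg_peak_power_to_zero:
  assumes g: "\<And>s. s \<in> dual_lattice L \<Longrightarrow> (\<lambda>n. grid_avg L n (\<lambda>u. g u * character s u)) \<longlonglongrightarrow> 0" and L: "0 < L"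
  shows "(\<lambda>n. grid_avg L n (\<lambda>u. g u * of_real (peak L u ^ M))) \<longlonglongrightarrow> 0"
proof -
  \<comment> \<open>Quantifying over all characters makes the property stable under
    multiplication by characters.\<close>
  define T where "T h \<longleftrightarrow> (\<forall>s\<in>dual_lattice L. (\<lambda>n. grid_avg L n (\<lambda>u. g u * character s u * h u)) \<longlonglongrightarrow> 0)" for h
  have T_add: "T (\<lambda>u. h u + h' u)" if "T h" "T h'" for h h'
    unfolding T_def
  proof
    fix s assume "s \<in> dual_lattice L"
    then have "(\<lambda>n. grid_avg L n (\<lambda>u. g u * character s u * h u) + grid_avg L n (\<lambda>u. g u * character s u * h' u)) \<longlonglongrightarrow> 0 + 0"
      using that unfolding T_def by (intro tendsto_add) auto
    then show "(\<lambda>n. grid_avg L n (\<lambda>u. g u * character s u * (h u + h' u))) \<longlonglongrightarrow> 0"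
      by (simp add: distrib_left grid_avg_add)
  qed
  have T_cmult: "T (\<lambda>u. c * h u)" if "T h" for h c
    unfolding T_def
  proof
    fix s assume "s \<in> dual_lattice L"
    then have "(\<lambda>n. c * grid_avg L n (\<lambda>u. g u * character s u * h u)) \<longlonglongrightarrow> c * 0"
      using that unfolding T_def by (intro tendsto_mult tendsto_const) auto
    then show "(\<lambda>n. grid_avg L n (\<lambda>u. g u * character s u * (c * h u))) \<longlonglongrightarrow> 0"
      by (simp add: grid_avg_cmult[symmetric] mult_ac)
  qed
  have T_character: "T (\<lambda>u. character t u * h u)" if "T h" "t \<in> dual_lattice L" for h t
    unfolding T_def
  proof
    fix s assume "s \<in> dual_lattice L"
    then have "(\<lambda>n. grid_avg L n (\<lambda>u. g u * character (s + t) u * h u)) \<longlonglongrightarrow> 0"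
      using that dual_lattice_add unfolding T_def by blast
    then show "(\<lambda>n. grid_avg L n (\<lambda>u. g u * character s u * (character t u * h u))) \<longlonglongrightarrow> 0"
      by (simp add: character_add_exp mult_ac)
  qed
  have T_cos: "T (\<lambda>u. (2 + character t u + character (- t) u) * h u)" if h: "T h" and t: "t \<in> dual_lattice L" for h t
  proof -
    have "T (\<lambda>u. 2 * h u + (character t u * h u + character (- t) u * h u))"
      by (intro T_add T_cmult T_character h t dual_lattice_uminus)
    moreover have "(\<lambda>u. 2 * h u + (character t u * h u + character (- t) u * h u)) = (\<lambda>u. (2 + character t u + character (- t) u) * h u)"
      by (simp add: fun_eq_iff algebra_simps)
    ultimately show ?thesis by simp
  qed
  have "T (\<lambda>u. of_real (peak L u ^ M))"
  proof (induction M)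
    case 0
    then show ?case using g by (simp add: T_def)
  next
    case (Suc M)
    let ?a = "\<i> * complex_of_real (pi / L)" and ?b = "complex_of_real (pi / L)"
    have "T (\<lambda>u. (1/16) * ((2 + character ?a u + character (- ?a) u) * ((2 + character ?b u + character (- ?b) u) * of_real (peak L u ^ M))))"
      by (intro T_cmult T_cos Suc dual_lattice_generators L)
    moreover have "(\<lambda>u. (1/16) * ((2 + character ?a u + character (- ?a) u) * ((2 + character ?b u + character (- ?b) u) * of_real (peak L u ^ M))))
       = (\<lambda>u. of_real (peak L u ^ Suc M))"
      by (simp only: power_Suc of_real_mult peak_eq mult.assoc)
    ultimately show ?case by simp
  qed
  then show ?thesis using dual_lattice_0 unfolding T_def by force
qed

text \<open>On the fundamental square, $\gamma$ can be below $1/2$ only at points where the peak is less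
  than $1-\eta$, for such points stay away from the lattice. Each contributes at least
  $-B(1-\eta)^M$ to the sum. Near the corner $0$, on a fixed proportion $\kappa^2$ of the grid,
  the peak is at least $1-\eta/2$ and each point contributes at least $\frac12(1-\eta/2)^M$,
  which prevails for large $M$.\<close>

lemma peak_concentration:
  fixes \<gamma> :: "complex \<Rightarrow> real"
  assumes cont: "continuous_on UNIV \<gamma>" and L: "0 < L" and \<gamma>0: "\<gamma> 0 = 1"
    and per: "\<And>k l. \<gamma> (of_real (of_int k * L) + \<i> * of_real (of_int l * L)) = \<gamma> 0"
    and B: "\<And>u. \<bar>\<gamma> u\<bar> \<le> B"
  shows "\<exists>M. \<exists>e>0. \<forall>n>0. e \<le> (\<Sum>p\<in>{..<n} \<times> {..<n}. \<gamma> (grid L n p) * peak L (grid L n p) ^ M) / (real n)\<^sup>2"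
proof -
  let ?Q = "cbox 0 (Complex L L)"
  have pc: "continuous_on S (peak L)" for S
    unfolding peak_def[abs_def] using L by (intro continuous_intros) auto
  \<comment> \<open>At lattice points $\gamma = 1$, so the maximum of the peak over this
    compact set is less than $1$.\<close>
  let ?S = "?Q \<inter> {u. \<gamma> u \<le> 1/2}"
  have "compact ?S"
    by (intro compact_Int_closed compact_cbox closed_Collect_le cont continuous_on_const)
  obtain \<eta> where \<eta>: "0 < \<eta>" "\<eta> < 1" "\<And>u. u \<in> ?Q \<Longrightarrow> 1 - \<eta> \<le> peak L u \<Longrightarrow> 1/2 \<le> \<gamma> u"
  proof (cases "?S = {}")
    case True
    then show ?thesis by (intro that[of "1/2"]) (auto simp: disjoint_iff not_le less_imp_le)
  next
    case False
    then obtain u0 where u0: "u0 \<in> ?S" "\<And>u. u \<in> ?S \<Longrightarrow> peak L u \<le> peak L u0"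
      using continuous_attains_sup[OF \<open>compact ?S\<close> _ pc] by blast
    have "peak L u0 \<noteq> 1"
    proof
      assume "peak L u0 = 1"
      then obtain k l :: int where "u0 = of_real (of_int k * L) + \<i> * of_real (of_int l * L)"
        using peak_eq_1[OF L] by blast
      then have "\<gamma> u0 = 1" using per \<gamma>0 by simp
      then show False using u0(1) by simp
    qed
    then have lt: "peak L u0 < 1" using peak_le_1[of L u0] by simp
    show ?thesis
    proof (rule that[of "(1 - peak L u0) / 2"])
      show "(1 - peak L u0) / 2 < 1" using peak_nonneg[of L u0] by simp
      fix u assume "u \<in> ?Q" "1 - (1 - peak L u0) / 2 \<le> peak L u"
      have "u \<notin> ?S"
      proof
        assume "u \<in> ?S"
        from u0(2)[OF this] \<open>1 - (1 - peak L u0) / 2 \<le> peak L u\<close> lt show False by argo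
      qed
      then have "\<not> \<gamma> u \<le> 1/2" using \<open>u \<in> ?Q\<close> by blast
      then show "1/2 \<le> \<gamma> u" by linarith
    qed (use lt in simp)
  qed
  have "isCont (peak L) 0"
    using pc[of UNIV] by (simp add: continuous_on_eq_continuous_at)
  then obtain \<delta> where \<delta>: "0 < \<delta>" "\<And>u. norm u < \<delta> \<Longrightarrow> 1 - \<eta>/2 \<le> peak L u"
  proof -
    have "0 < \<eta>/2" using \<eta>(1) by simp
    with \<open>isCont (peak L) 0\<close> obtain \<delta> where d: "0 < \<delta>"
        "\<forall>u. dist u 0 < \<delta> \<longrightarrow> dist (peak L u) (peak L 0) < \<eta>/2"
      unfolding continuous_at_eps_delta by blast
    have "1 - \<eta>/2 \<le> peak L u" if "norm u < \<delta>" for u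
    proof -
      have "dist (peak L u) (peak L 0) < \<eta>/2" using d(2) that by simp
      moreover have "peak L 0 = 1" by (simp add: peak_def)
      ultimately show ?thesis unfolding dist_real_def by linarith
    qed
    with d(1) show thesis by (rule that)
  qed
  define \<kappa> where "\<kappa> = min 1 (\<delta> / (2 * L))"
  have \<kappa>: "0 < \<kappa>" "\<kappa> \<le> 1" "2 * L * \<kappa> \<le> \<delta>"
    using \<delta>(1) L by (auto simp: \<kappa>_def min_def field_simps)
  have B0: "0 \<le> B" using B[of 0] by linarith
  let ?r = "(1 - \<eta>) / (1 - \<eta>/2)"
  have "?r < 1" using \<eta> by simp
  then obtain M where M: "?r ^ M < (\<kappa>\<^sup>2 / 2) / (B + 1)"
    using real_arch_pow_inv[of "(\<kappa>\<^sup>2 / 2) / (B + 1)" ?r] \<kappa> B0 by (auto simp: field_simps)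
  define e where "e = (1/2) * \<kappa>\<^sup>2 * (1 - \<eta>/2) ^ M - B * (1 - \<eta>) ^ M"
  have "0 < e"
  proof -
    have pos: "0 < (1 - \<eta>/2) ^ M" using \<eta> by simp
    have "B * ?r ^ M \<le> (B + 1) * ?r ^ M"
      using \<eta> by (intro mult_right_mono) auto
    also have "\<dots> < \<kappa>\<^sup>2 / 2"
    proof -
      have "0 < B + 1" using B0 by linarith
      from pos_less_divide_eq[OF this, THEN iffD1, OF M] show ?thesis by (simp only: mult.commute)
    qed
    finally have "B * ?r ^ M * (1 - \<eta>/2) ^ M < \<kappa>\<^sup>2 / 2 * (1 - \<eta>/2) ^ M"
      using pos by (rule mult_strict_right_mono)
    moreover have "?r ^ M * (1 - \<eta>/2) ^ M = (1 - \<eta>) ^ M"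
      using \<eta> by (simp add: power_mult_distrib[symmetric])
    ultimately show ?thesis by (simp add: e_def mult.assoc)
  qed
  moreover have "e \<le> (\<Sum>p\<in>{..<n} \<times> {..<n}. \<gamma> (grid L n p) * peak L (grid L n p) ^ M) / (real n)\<^sup>2" if n: "0 < n" for n
  proof -
    \<comment> \<open>The grid points with both indices below $N$ lie in the square of side
      $\kappa L$ at the corner $0$.\<close>
    define N where "N = nat \<lceil>\<kappa> * real n\<rceil>"
    have kn: "0 < \<kappa> * real n" using \<kappa> n by simp
    have N1: "\<kappa> * real n \<le> real N" unfolding N_def by linarith
    have N2: "N \<le> n"
    proof -
      have "\<kappa> * real n \<le> real n" using \<kappa> by (simp add: mult_left_le_one_le)
      then show ?thesis unfolding N_def by linarith
    qed
    have N3: "real j < \<kappa> * real n" if "j < N" for j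
      using that unfolding N_def by linarith
    let ?J = "{..<N} \<times> {..<N}" and ?G = "{..<n} \<times> {..<n}"
    have JG: "?J \<subseteq> ?G" using N2 by auto
    have tm: "(if p \<in> ?J then (1/2) * (1 - \<eta>/2) ^ M else 0) - B * (1 - \<eta>) ^ M
        \<le> \<gamma> (grid L n p) * peak L (grid L n p) ^ M" if p: "p \<in> ?G" for p
    proof -
      obtain j k where jk: "p = (j, k)" "j < n" "k < n" using p by auto
      define u where "u = grid L n p"
      have fr: "real i / real n \<le> 1" if "i < n" for i using that by simp
      have Q: "u \<in> ?Q"
        using L jk fr[of j] fr[of k] mult_left_mono[OF fr[of j], of L] mult_left_mono[OF fr[of k], of L]
        by (auto simp: u_def grid_def cbox_Complex_eq in_cbox_complex_iff)
      have nn: "0 \<le> B * (1 - \<eta>) ^ M" using B0 \<eta> by simp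
      have pk: "0 \<le> peak L u ^ M" using peak_nonneg by simp
      show ?thesis unfolding u_def[symmetric]
      proof (cases "p \<in> ?J")
        case True
        then have "real j < \<kappa> * real n" "real k < \<kappa> * real n" using jk N3 by auto
        then have "L * real j / real n < L * \<kappa>" "L * real k / real n < L * \<kappa>"
          using L n by (simp_all add: field_simps)
        moreover have "norm u \<le> \<bar>Re u\<bar> + \<bar>Im u\<bar>" by (rule cmod_le)
        ultimately have "norm u < \<delta>" using \<kappa>(3) L by (simp add: u_def grid_def jk)
        then have big: "1 - \<eta>/2 \<le> peak L u" by (rule \<delta>(2))
        then have "1/2 \<le> \<gamma> u" using \<eta>(1) by (intro \<eta>(3) Q) linarith
        then have "(1/2) * (1 - \<eta>/2) ^ M \<le> \<gamma> u * peak L u ^ M"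
          using big \<eta> by (intro mult_mono power_mono) auto
        then show "(if p \<in> ?J then (1/2) * (1 - \<eta>/2) ^ M else 0) - B * (1 - \<eta>) ^ M \<le> \<gamma> u * peak L u ^ M"
          using True nn by simp
      next
        case False
        show "(if p \<in> ?J then (1/2) * (1 - \<eta>/2) ^ M else 0) - B * (1 - \<eta>) ^ M \<le> \<gamma> u * peak L u ^ M"
        proof (cases "1 - \<eta> \<le> peak L u")
          case True
          then have "0 \<le> \<gamma> u" using \<eta>(3)[OF Q] by linarith
          then have "0 \<le> \<gamma> u * peak L u ^ M" using pk by simp
          then show ?thesis using False nn by simp
        next
          case small: False
          have "- (\<gamma> u * peak L u ^ M) \<le> B * peak L u ^ M"
            using B[of u] pk mult_right_mono[of "- \<gamma> u" B "peak L u ^ M"] by simp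
          also have "\<dots> \<le> B * (1 - \<eta>) ^ M"
            using small B0 peak_nonneg by (intro mult_left_mono power_mono) auto
          finally show ?thesis using False by simp
        qed
      qed
    qed
    have "e * (real n)\<^sup>2 = (1/2) * (1 - \<eta>/2) ^ M * (\<kappa> * real n)\<^sup>2 - B * (1 - \<eta>) ^ M * (real n)\<^sup>2"
      by (simp add: e_def algebra_simps power_mult_distrib)
    also have "\<dots> \<le> (1/2) * (1 - \<eta>/2) ^ M * (real N)\<^sup>2 - B * (1 - \<eta>) ^ M * (real n)\<^sup>2"
      using N1 kn \<eta> by (intro diff_right_mono mult_left_mono power_mono) auto
    also have "\<dots> = (\<Sum>p\<in>?G. (if p \<in> ?J then (1/2) * (1 - \<eta>/2) ^ M else 0) - B * (1 - \<eta>) ^ M)"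
    proof -
      have "(\<Sum>p\<in>?G. if p \<in> ?J then (1/2) * (1 - \<eta>/2) ^ M else 0) = (\<Sum>p\<in>?J. (1/2) * (1 - \<eta>/2) ^ M)"
        using JG by (subst sum.inter_restrict[symmetric]) (auto simp: Int_absorb1 intro!: sum.cong)
      then show ?thesis by (simp add: sum_subtractf power2_eq_square)
    qed
    also have "\<dots> \<le> (\<Sum>p\<in>?G. \<gamma> (grid L n p) * peak L (grid L n p) ^ M)"
      by (intro sum_mono tm)
    finally show ?thesis using n by (simp add: pos_le_divide_eq)
  qed
  ultimately show ?thesis by blast
qed

lemma Re_weighted_sum:
  "Re (of_real a * (\<Sum>p\<in>P. f p * of_real (b p))) = a * (\<Sum>p\<in>P. Re (f p) * b p)"
  by (simp add: Re_sum)

text \<open>If $H(f) \neq 0$, then $u \mapsto H(f(\cdot-u))/H(f)$ is continuous, periodic and equal to $1$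
  at $0$. Its averages against powers of the peak tend to $0$, but they are bounded below by
  concentration.\<close>

lemma zero_on_periodic:
  assumes H: "gauss_functional q m H" and q: "0 < q" and E: "\<And>s t. H (linexp s t) = 0"
    and L: "0 < L" and f: "smooth f" and p: "periodic L f"
  shows "H f = 0"
proof (rule ccontr)
  assume nz: "H f \<noteq> 0"
  define g where "g u = H (\<lambda>z. f (z - u))" for u
  have G: "(\<lambda>z. f (z - u)) \<in> gaussian q" for u
    by (rule subgaussian_gaussian[OF periodic_subgaussian[OF L smooth_translate[OF f] periodic_translate[OF p]] q])
  obtain C where C: "0 \<le> C" "\<And>f B. f \<in> gaussian q \<Longrightarrow> deriv_bound m 1 (\<lambda>z. B * exp (q * (norm z)\<^sup>2)) f \<Longrightarrow> norm (H f) \<le> C * B"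
    using gauss_functional_bound[OF H] by metis
  obtain B where B: "deriv_bound (Suc m) 1 (\<lambda>_. B) f" using periodic_deriv_bound[OF L f p] by blast
  have q0: "0 \<le> q" using q by simp
  have lip: "norm (g u - g u') \<le> C * (2 * B) * norm (u - u')" for u u'
  proof -
    have "g u - g u' = H (\<lambda>z. f (z - u) - f (z - u'))"
      unfolding g_def by (rule gauss_functional_diff[OF H G G, symmetric])
    moreover have "norm (H (\<lambda>z. f (z - u) - f (z - u'))) \<le> C * (2 * B * norm (u - u'))"
      by (rule C(2)[OF gaussian_diff[OF G G] deriv_bound_gauss_of_deriv_bound[OF deriv_bound_translate_diff[OF f B] q0]])
    ultimately show ?thesis by (simp add: mult.assoc)
  qed
  have gb: "norm (g u) \<le> C * B" for u
    unfolding g_def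
    by (rule C(2)[OF G deriv_bound_gauss_of_deriv_bound[OF deriv_bound_translate[OF f deriv_bound_pred[OF B]] q0]])
  have gc: "continuous_on UNIV g"
    unfolding continuous_on_iff
  proof (intro ballI allI impI)
    fix u and e :: real assume e: "0 < e"
    let ?K = "C * (2 * B) + 1"
    have "0 \<le> C * (2 * B)" using C(1) deriv_bound_nonneg[OF B] by simp
    then have K: "0 < ?K" by linarith
    show "\<exists>d>0. \<forall>x'\<in>UNIV. dist x' u < d \<longrightarrow> dist (g x') (g u) < e"
    proof (intro exI[of _ "e / ?K"] conjI ballI impI)
      show "0 < e / ?K" using e K by simp
      fix x' assume d: "dist x' u < e / ?K"
      have "norm (g x' - g u) \<le> C * (2 * B) * norm (x' - u)" by (rule lip)
      also have "\<dots> \<le> ?K * norm (x' - u)" by (intro mult_right_mono) auto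
      also have "\<dots> < e" using d K by (simp add: dist_norm field_simps)
      finally show "dist (g x') (g u) < e" by (simp add: dist_norm)
    qed
  qed
  have g0: "g 0 = H f" by (simp add: g_def)
  have gp: "periodic L g"
  proof -
    have "f (z - (u + of_real L)) = f (z - u)" "f (z - (u + \<i> * of_real L)) = f (z - u)" for z u
      using p unfolding periodic_def by (metis diff_add_cancel diff_diff_add)+
    then show ?thesis by (simp add: periodic_def g_def)
  qed
  define \<gamma> where "\<gamma> u = Re (g u / H f)" for u
  have "\<exists>M. \<exists>e>0. \<forall>n>0. e \<le> (\<Sum>p\<in>{..<n} \<times> {..<n}. \<gamma> (grid L n p) * peak L (grid L n p) ^ M) / (real n)\<^sup>2"
  proof (rule peak_concentration[OF _ L])
    show "continuous_on UNIV \<gamma>" unfolding \<gamma>_def[abs_def] using nz by (intro continuous_intros gc) auto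
    show "\<gamma> 0 = 1" using nz by (simp add: \<gamma>_def g0)
    show "\<gamma> (of_real (of_int k * L) + \<i> * of_real (of_int l * L)) = \<gamma> 0" for k l
      using periodic_shift[OF gp, of 0 k l] by (simp add: \<gamma>_def)
    show "\<bar>\<gamma> u\<bar> \<le> C * B / norm (H f)" for u
    proof -
      have "\<bar>\<gamma> u\<bar> \<le> norm (g u / H f)" unfolding \<gamma>_def by (rule abs_Re_le_cmod)
      also have "\<dots> \<le> C * B / norm (H f)" unfolding norm_divide by (intro divide_right_mono gb) simp
      finally show ?thesis .
    qed
  qed
  then obtain M e where e: "0 < e" "\<And>n. 0 < n \<Longrightarrow> e \<le> (\<Sum>p\<in>{..<n} \<times> {..<n}. \<gamma> (grid L n p) * peak L (grid L n p) ^ M) / (real n)\<^sup>2"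
    by blast
  have "(\<lambda>n. grid_avg L n (\<lambda>u. g u * of_real (peak L u ^ M))) \<longlonglongrightarrow> 0"
    unfolding g_def by (rule grid_avg_peak_power_to_zero[OF grid_avg_character_to_zero[OF H q L f p E] L])
  then have "(\<lambda>n. Re (grid_avg L n (\<lambda>u. g u * of_real (peak L u ^ M)) / H f)) \<longlonglongrightarrow> Re (0 / H f)"
    using nz by (intro tendsto_intros) auto
  moreover have "Re (grid_avg L n (\<lambda>u. g u * of_real (peak L u ^ M)) / H f)
      = (\<Sum>p\<in>{..<n} \<times> {..<n}. \<gamma> (grid L n p) * peak L (grid L n p) ^ M) / (real n)\<^sup>2" for n
  proof -
    have "grid_avg L n (\<lambda>u. g u * of_real (peak L u ^ M)) / H f
        = of_real (1 / (real n)\<^sup>2) * (\<Sum>p\<in>{..<n} \<times> {..<n}. (g (grid L n p) / H f) * of_real (peak L (grid L n p) ^ M))"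
      by (simp add: grid_avg_def sum_divide_distrib sum_distrib_left mult_ac)
    also have "Re \<dots> = (1 / (real n)\<^sup>2) * (\<Sum>p\<in>{..<n} \<times> {..<n}. \<gamma> (grid L n p) * peak L (grid L n p) ^ M)"
      unfolding \<gamma>_def by (rule Re_weighted_sum)
    finally show ?thesis by simp
  qed
  ultimately have lim: "(\<lambda>n. (\<Sum>p\<in>{..<n} \<times> {..<n}. \<gamma> (grid L n p) * peak L (grid L n p) ^ M) / (real n)\<^sup>2) \<longlonglongrightarrow> 0"
    by simp
  have "e \<le> 0"
    by (rule LIMSEQ_le_const[OF lim]) (use e(2) in \<open>auto intro!: exI[of _ 1]\<close>)
  then show False using e(1) by simp
qed

section \<open>Compactly supported functions\<close>

definition compactly_supported :: "(complex \<Rightarrow> complex) \<Rightarrow> bool" where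
  "compactly_supported f \<longleftrightarrow> smooth f \<and> (\<exists>R. \<forall>z. R < norm z \<longrightarrow> f z = 0)"

lemma compactly_supported_smooth: "compactly_supported f \<Longrightarrow> smooth f"
  by (simp add: compactly_supported_def)

lemma test_functions_compactly_supported: "f \<in> test_functions \<Longrightarrow> compactly_supported f"
proof -
  assume f: "f \<in> test_functions"
  then have "bounded (closure {z. f z \<noteq> 0})"
    by (simp add: test_functions_def compact_imp_bounded)
  then obtain R where R: "\<And>z. z \<in> closure {z. f z \<noteq> 0} \<Longrightarrow> norm z \<le> R"
    unfolding bounded_iff by blast
  have "f z = 0" if "R < norm z" for z
    using R[of z] that closure_subset[of "{z. f z \<noteq> 0}"] by force
  then show ?thesis using f unfolding compactly_supported_def test_functions_def by blast
qed

lemma compactly_supported_dir_deriv: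
  assumes "compactly_supported f" shows "compactly_supported (dir_deriv v f)"
proof -
  obtain R where R: "\<And>z. R < norm z \<Longrightarrow> f z = 0" using assms by (auto simp: compactly_supported_def)
  have "open {z::complex. R < norm z}" by (intro open_Collect_less continuous_intros)
  then have "dir_deriv v f z = dir_deriv v (\<lambda>_. 0) z" if "R < norm z" for z
    by (rule dir_deriv_zero_on_open) (use R that compactly_supported_smooth[OF assms] smooth_differentiable in auto)
  then show ?thesis using assms unfolding compactly_supported_def by (auto intro: smooth_dir_deriv)
qed

lemma compactly_supported_bounded:
  assumes "compactly_supported f" shows "\<exists>B. \<forall>z. norm (f z) \<le> B"
proof -
  obtain R where R: "\<And>z. R < norm z \<Longrightarrow> f z = 0" using assms by (auto simp: compactly_supported_def)
  have "compact (f ` cball 0 R)"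
    by (intro compact_continuous_image compact_cball smooth_continuous compactly_supported_smooth assms)
  then obtain B where B: "\<forall>y\<in>f ` cball 0 R. norm y \<le> B"
    using compact_imp_bounded bounded_iff by metis
  have "norm (f z) \<le> max B 0" for z
  proof (cases "R < norm z")
    case True
    then show ?thesis using R by simp
  next
    case False
    then have "norm (f z) \<le> B" using B by simp
    then show ?thesis by simp
  qed
  then show ?thesis by blast
qed

lemma compactly_supported_deriv_bound: "compactly_supported f \<Longrightarrow> \<exists>B. deriv_bound k 1 (\<lambda>_. B) f"
  by (rule deriv_bound_of_closed_class[where P = compactly_supported]) (auto intro: compactly_supported_bounded compactly_supported_dir_deriv)

lemma compactly_supported_subgaussian: "compactly_supported f \<Longrightarrow> f \<in> subgaussian"
  by (rule subgaussian_bounded) (auto intro: compactly_supported_deriv_bound compactly_supported_smooth)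

lemma compactly_supported_mult: "smooth g \<Longrightarrow> compactly_supported f \<Longrightarrow> compactly_supported (\<lambda>z. g z * f z)"
  and compactly_supported_mult_right: "compactly_supported f \<Longrightarrow> smooth g \<Longrightarrow> compactly_supported (\<lambda>z. f z * g z)"
  unfolding compactly_supported_def by (auto intro: smooth_mult)

section \<open>Periodization of compactly supported functions\<close>

definition nearest_multiple :: "real \<Rightarrow> real \<Rightarrow> real" where
  "nearest_multiple L x = of_int \<lfloor>x / L + 1 / 2\<rfloor> * L"

text \<open>This is the sum over all lattice translates of $f$ as soon as $L$ exceeds twice the radius of
  the support, because then at most one translate is nonzero at each point. The formula avoids
  the infinite sum.\<close>

definition periodize :: "real \<Rightarrow> (complex \<Rightarrow> complex) \<Rightarrow> complex \<Rightarrow> complex" where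
  "periodize L f z = f (Complex (Re z - nearest_multiple L (Re z)) (Im z - nearest_multiple L (Im z)))"

lemma nearest_multiple_near: assumes L: "0 < L" shows "\<bar>x - nearest_multiple L x\<bar> \<le> L / 2"
proof -
  define k :: real where "k = of_int \<lfloor>x / L + 1 / 2\<rfloor>"
  have "k \<le> x / L + 1 / 2" "x / L + 1 / 2 \<le> k + 1"
    unfolding k_def by (rule of_int_floor_le, rule real_of_int_floor_add_one_ge)
  then have "k - 1/2 \<le> x / L" "x / L \<le> k + 1/2" by argo+
  then have "(k - 1/2) * L \<le> x" "x \<le> (k + 1/2) * L"
    using L by (simp_all only: pos_le_divide_eq pos_divide_le_eq)
  then have "k * L - L / 2 \<le> x" "x \<le> k * L + L / 2" by (simp_all add: algebra_simps)
  then show ?thesis unfolding nearest_multiple_def k_def[symmetric] by argo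
qed

lemma nearest_multiple_far:
  assumes L: "0 < L" and ne: "nearest_multiple L x \<noteq> nearest_multiple L y" shows "L / 2 \<le> \<bar>y - nearest_multiple L x\<bar>"
proof -
  define k l where "k = \<lfloor>x / L + 1 / 2\<rfloor>" and "l = \<lfloor>y / L + 1 / 2\<rfloor>"
  have "k \<noteq> l" using ne by (auto simp: nearest_multiple_def k_def l_def)
  then have "1 \<le> \<bar>real_of_int l - real_of_int k\<bar>" by linarith
  then have "L \<le> \<bar>real_of_int l - real_of_int k\<bar> * L" using L by simp
  also have "\<dots> = \<bar>nearest_multiple L y - nearest_multiple L x\<bar>"
    using L by (simp add: nearest_multiple_def k_def l_def abs_mult left_diff_distrib[symmetric])
  finally have "L \<le> \<bar>nearest_multiple L y - nearest_multiple L x\<bar>" .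
  with nearest_multiple_near[OF L, of y] show ?thesis by argo
qed

text \<open>Near $z_0$ the periodization is a single translate of $f$. Where the nearest lattice point
  changes, the point is too far from both lattice points for either translate to be nonzero.\<close>

lemma periodize_local:
  assumes L: "2 * R < L" "0 < R" and z: "z \<in> ball z0 (L / 2 - R)"
    and f: "\<And>z. R < \<bar>Re z\<bar> \<or> R < \<bar>Im z\<bar> \<Longrightarrow> f z = 0"
  shows "periodize L f z = f (z - Complex (nearest_multiple L (Re z0)) (nearest_multiple L (Im z0)))"
proof -
  have L0: "0 < L" using L by argo
  have d: "\<bar>Re z - Re z0\<bar> < L / 2 - R" "\<bar>Im z - Im z0\<bar> < L / 2 - R"
    using z abs_Re_le_cmod[of "z - z0"] abs_Im_le_cmod[of "z - z0"]
    by (auto simp: dist_norm norm_minus_commute)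
  have far: "R < \<bar>x - nearest_multiple L x\<bar> \<and> R < \<bar>x - nearest_multiple L x0\<bar>"
    if "nearest_multiple L x \<noteq> nearest_multiple L x0" "\<bar>x - x0\<bar> < L / 2 - R" for x x0
    using nearest_multiple_far[OF L0 that(1)] nearest_multiple_far[OF L0 that(1)[symmetric]] that(2) L by argo
  show ?thesis
  proof (cases "nearest_multiple L (Re z) = nearest_multiple L (Re z0) \<and> nearest_multiple L (Im z) = nearest_multiple L (Im z0)")
    case True
    then have "Complex (Re z - nearest_multiple L (Re z)) (Im z - nearest_multiple L (Im z)) = z - Complex (nearest_multiple L (Re z0)) (nearest_multiple L (Im z0))"
      by (simp add: complex_eq_iff)
    then show ?thesis by (simp add: periodize_def)
  next
    case False
    then consider "nearest_multiple L (Re z) \<noteq> nearest_multiple L (Re z0)" | "nearest_multiple L (Im z) \<noteq> nearest_multiple L (Im z0)" by blast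
    then have "periodize L f z = 0 \<and> f (z - Complex (nearest_multiple L (Re z0)) (nearest_multiple L (Im z0))) = 0"
      by cases (use far d f in \<open>simp_all add: periodize_def\<close>)
    then show ?thesis by simp
  qed
qed

lemma dir_deriv_periodize:
  assumes L: "2 * R < L" "0 < R" and s: "smooth f"
    and f: "\<And>z. R < \<bar>Re z\<bar> \<or> R < \<bar>Im z\<bar> \<Longrightarrow> f z = 0"
  shows "periodize L f differentiable at z" "dir_deriv v (periodize L f) z = periodize L (dir_deriv v f) z"
    and "R < \<bar>Re z\<bar> \<or> R < \<bar>Im z\<bar> \<Longrightarrow> dir_deriv v f z = 0"
proof -
  have op: "open {z. R < \<bar>Re z\<bar> \<or> R < \<bar>Im z\<bar>}"
    unfolding Collect_disj_eq by (intro open_Un open_Collect_less continuous_intros)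
  have ddf: "dir_deriv v f z = 0" if "R < \<bar>Re z\<bar> \<or> R < \<bar>Im z\<bar>" for z v
    using dir_deriv_zero_on_open[OF op, of f "\<lambda>_. 0" z v] f that smooth_differentiable[OF s] by simp
  then show "R < \<bar>Re z\<bar> \<or> R < \<bar>Im z\<bar> \<Longrightarrow> dir_deriv v f z = 0" .
  define u where "u = Complex (nearest_multiple L (Re z)) (nearest_multiple L (Im z))"
  have zb: "z \<in> ball z (L / 2 - R)" using L by simp
  have "((\<lambda>z. f (z - u)) has_derivative (\<lambda>v. dir_deriv v (\<lambda>z. f (z - u)) z)) (at z)"
    by (intro has_derivative_dir_deriv smooth_differentiable smooth_translate s)
  then have "(periodize L f has_derivative (\<lambda>v. dir_deriv v (\<lambda>z. f (z - u)) z)) (at z)"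
    by (rule has_derivative_transform_within_open[OF _ open_ball zb])
       (use periodize_local[OF L _ f, of _ z] in \<open>simp add: u_def\<close>)
  then show "periodize L f differentiable at z" "dir_deriv v (periodize L f) z = periodize L (dir_deriv v f) z"
    using dir_deriv_translate[OF s, of v u] periodize_local[OF L zb ddf]
    by (auto simp: differentiable_def dir_deriv_eq u_def)
qed

lemma smooth_periodize:
  assumes L: "2 * R < L" "0 < R" and s: "smooth f"
    and f: "\<And>z. R < \<bar>Re z\<bar> \<or> R < \<bar>Im z\<bar> \<Longrightarrow> f z = 0"
  shows "smooth (periodize L f)"
proof -
  have "C_k k (periodize L f)" for k
    using s f
  proof (induction k arbitrary: f)
    case 0
    have "continuous_on UNIV (periodize L f)"
      using dir_deriv_periodize(1)[OF L 0]
      by (intro continuous_at_imp_continuous_on ballI differentiable_imp_continuous_within)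
    then show ?case by simp
  next
    case (Suc k)
    have "dir_deriv v (periodize L f) = periodize L (dir_deriv v f)" for v
      using dir_deriv_periodize(2)[OF L Suc.prems] by blast
    moreover have "C_k k (periodize L (dir_deriv v f))" for v
      using Suc.IH[OF smooth_dir_deriv[OF Suc.prems(1)]] dir_deriv_periodize(3)[OF L Suc.prems] by blast
    ultimately show ?case
      using dir_deriv_periodize(1)[OF L Suc.prems] by (simp add: dx_dir_deriv dy_dir_deriv)
  qed
  then show ?thesis by (simp add: smooth_def)
qed

lemma deriv_bound_periodize:
  assumes L: "2 * R < L" "0 < R"
  shows "smooth f \<Longrightarrow> (\<And>z. R < \<bar>Re z\<bar> \<or> R < \<bar>Im z\<bar> \<Longrightarrow> f z = 0) \<Longrightarrow> deriv_bound k 1 (\<lambda>_. B) f \<Longrightarrow>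
    deriv_bound k 1 (\<lambda>_. B) (periodize L f)"
proof (induction k arbitrary: f)
  case 0
  then show ?case by (simp add: periodize_def)
next
  case (Suc k)
  show ?case
  proof (rule deriv_bound_SucI)
    show "norm (periodize L f z) \<le> B" for z
      using deriv_bound_norm[OF Suc.prems(3)] by (simp add: periodize_def)
    fix u :: complex assume u: "u = 1 \<or> u = \<i>"
    have "dir_deriv u (periodize L f) = periodize L (dir_deriv u f)"
      using dir_deriv_periodize(2)[OF L Suc.prems(1,2)] by blast
    moreover have "deriv_bound k 1 (\<lambda>_. B) (periodize L (dir_deriv u f))"
      by (rule Suc.IH[OF smooth_dir_deriv[OF Suc.prems(1)] dir_deriv_periodize(3)[OF L Suc.prems(1,2)]])
         (use deriv_bound_SucD[OF Suc.prems(3) u] in auto)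
    ultimately show "deriv_bound k 1 (\<lambda>z. 1 * B) (dir_deriv u (periodize L f))" by simp
  qed
qed

lemma periodic_periodize: assumes "0 < L" shows "periodic L (periodize L f)"
proof -
  have "nearest_multiple L (x + L) = nearest_multiple L x + L" for x
  proof -
    have "(x + L) / L + 1 / 2 = (x / L + 1 / 2) + of_int 1" using assms by (simp add: field_simps)
    then have "\<lfloor>(x + L) / L + 1 / 2\<rfloor> = \<lfloor>x / L + 1 / 2\<rfloor> + 1"
      by (simp only: floor_add_int[symmetric])
    then show ?thesis unfolding nearest_multiple_def by (simp add: distrib_right)
  qed
  then show ?thesis by (simp add: periodic_def periodize_def)
qed

text \<open>The function and its periodization agree on the disc of radius $L/2$. Outside it their
  difference is bounded, hence at most a multiple of $e^{-q(L/2)^2}e^{q|z|^2}$; now let $L \to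
  \infty$.\<close>

lemma zero_on_compactly_supported:
  assumes H: "gauss_functional q m H" and q: "0 < q" and E: "\<And>s t. H (linexp s t) = 0" and f: "compactly_supported f"
  shows "H f = 0"
proof -
  obtain R0 where R0: "\<And>z. R0 < norm z \<Longrightarrow> f z = 0" using f by (auto simp: compactly_supported_def)
  define R where "R = max R0 1"
  have R: "0 < R" by (simp add: R_def)
  have s: "smooth f" using f by (rule compactly_supported_smooth)
  have f0: "f z = 0" if "R < \<bar>Re z\<bar> \<or> R < \<bar>Im z\<bar>" for z
    using R0[of z] that abs_Re_le_cmod[of z] abs_Im_le_cmod[of z] unfolding R_def by linarith
  obtain C where C: "0 \<le> C" "\<And>f B. f \<in> gaussian q \<Longrightarrow> deriv_bound m 1 (\<lambda>z. B * exp (q * (norm z)\<^sup>2)) f \<Longrightarrow> norm (H f) \<le> C * B"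
    using gauss_functional_bound[OF H] by metis
  obtain B where B: "deriv_bound m 1 (\<lambda>_. B) f" using compactly_supported_deriv_bound[OF f] by blast
  have B0: "0 \<le> B" using deriv_bound_nonneg[OF B] by simp
  have bound: "norm (H f) \<le> C * (2 * B) * exp (- (q * (L / 2)\<^sup>2))" if L: "2 * R < L" for L
  proof -
    have L0: "0 < L" using L R by argo
    let ?p = "periodize L f"
    have sp: "smooth ?p" by (rule smooth_periodize[OF L R s f0])
    have pp: "periodic L ?p" by (rule periodic_periodize[OF L0])
    have "H ?p = 0" by (rule zero_on_periodic[OF H q E L0 sp pp])
    moreover have fG: "f \<in> gaussian q" by (rule subgaussian_gaussian[OF compactly_supported_subgaussian[OF f] q])
    moreover have pG: "?p \<in> gaussian q" by (rule subgaussian_gaussian[OF periodic_subgaussian[OF L0 sp pp] q])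
    ultimately have "H f = H (\<lambda>z. f z - ?p z)"
      using gauss_functional_diff[OF H] by simp
    let ?U = "ball 0 (L / 2)"
    have "f z - ?p z = 0" if "z \<in> ?U" for z
    proof -
      have *: "nearest_multiple L x = 0" if "\<bar>x\<bar> < L / 2" for x
      proof -
        have "\<lfloor>x / L + 1 / 2\<rfloor> = 0"
          using that L0 by (intro floor_unique) (simp_all add: field_simps)
        then show ?thesis by (simp add: nearest_multiple_def)
      qed
      have "\<bar>Re z\<bar> < L / 2" "\<bar>Im z\<bar> < L / 2"
        using that abs_Re_le_cmod[of z] abs_Im_le_cmod[of z] by (auto simp: dist_norm)
      then show ?thesis by (simp add: periodize_def *)
    qed
    then have "deriv_bound m 1 (\<lambda>z. if z \<in> ?U then 0 else B + B) (\<lambda>z. f z - ?p z)"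
      using deriv_bound_diff[OF s sp B deriv_bound_periodize[OF L R s f0 B]] by (intro deriv_bound_restrict smooth_diff s sp) auto
    then have "deriv_bound m 1 (\<lambda>z. (2 * B * exp (- (q * (L / 2)\<^sup>2))) * exp (q * (norm z)\<^sup>2)) (\<lambda>z. f z - ?p z)"
    proof (rule deriv_bound_weaken)
      fix z :: complex
      show "(if z \<in> ?U then 0 else B + B) \<le> (2 * B * exp (- (q * (L / 2)\<^sup>2))) * exp (q * (norm z)\<^sup>2)"
      proof (cases "z \<in> ?U")
        case False
        then have "(L / 2)\<^sup>2 \<le> (norm z)\<^sup>2" using L0 by (intro power_mono) auto
        then have "1 \<le> exp (- (q * (L / 2)\<^sup>2)) * exp (q * (norm z)\<^sup>2)"
          using q by (simp flip: exp_add)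
        then have "2 * B * 1 \<le> 2 * B * (exp (- (q * (L / 2)\<^sup>2)) * exp (q * (norm z)\<^sup>2))"
          using B0 by (intro mult_left_mono) auto
        then show ?thesis using False by (simp add: mult.assoc)
      qed (use B0 in simp)
    qed simp
    from C(2)[OF gaussian_diff[OF fG pG] this] show ?thesis
      using \<open>H f = H (\<lambda>z. f z - ?p z)\<close> by (simp add: mult.assoc)
  qed
  have "((\<lambda>L. C * (2 * B) * exp (- (q * (L / 2)\<^sup>2))) \<longlongrightarrow> 0) at_top"
  proof (rule tendsto_mult_right_zero, rule filterlim_compose[OF exp_at_bot])
    have "filterlim (\<lambda>L::real. q / 4 * L\<^sup>2) at_top at_top"
      using q by (intro filterlim_tendsto_pos_mult_at_top[OF tendsto_const] filterlim_pow_at_top filterlim_ident) auto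
    then show "filterlim (\<lambda>L::real. - (q * (L / 2)\<^sup>2)) at_bot at_top"
      unfolding filterlim_uminus_at_bot by (simp add: power_divide)
  qed
  moreover have "\<forall>\<^sub>F L in at_top. norm (H f) \<le> C * (2 * B) * exp (- (q * (L / 2)\<^sup>2))"
    using eventually_gt_at_top[of "2 * R"] bound by (rule eventually_mono)
  ultimately have "norm (H f) \<le> 0"
    by (intro tendsto_lowerbound) auto
  then show ?thesis by simp
qed

section \<open>Cut-off functions\<close>

text \<open>The derivative of a member of this family is a combination of two others, so all of them are
  smooth at $0$.\<close>

definition flat_exp :: "nat \<Rightarrow> real \<Rightarrow> real" where
  "flat_exp n t = (if 0 < t then exp (- inverse t) * inverse t ^ n else 0)"

lemma flat_exp_tendsto_0: "(flat_exp n \<longlongrightarrow> 0) (at 0)"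
proof -
  have "((\<lambda>h. inverse h ^ n / exp (inverse h)) \<longlongrightarrow> (0::real)) (at_right 0)"
    by (rule filterlim_compose[OF tendsto_power_div_exp_0 filterlim_inverse_at_top_right])
  moreover have "\<forall>\<^sub>F h in at_right 0. inverse h ^ n / exp (inverse h) = flat_exp n h"
    using eventually_at_right_less[of 0]
    by eventually_elim (simp add: flat_exp_def exp_minus divide_inverse)
  ultimately have "(flat_exp n \<longlongrightarrow> 0) (at_right 0)"
    by (rule Lim_transform_eventually)
  moreover have "(flat_exp n \<longlongrightarrow> 0) (at_left 0)"
  proof (rule Lim_transform_eventually[OF tendsto_const])
    show "\<forall>\<^sub>F h in at_left 0. 0 = flat_exp n h"
      unfolding eventually_at_filter by (rule always_eventually) (auto simp: flat_exp_def)
  qed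
  ultimately show ?thesis using filterlim_split_at by blast
qed

text \<open>At $0$ the difference quotient is the next member of the family, which tends to $0$.\<close>

lemma flat_exp_deriv: "(flat_exp n has_real_derivative flat_exp (n + 2) t - real n * flat_exp (n + 1) t) (at t)"
proof -
  consider "0 < t" | "t < 0" | "t = 0" by linarith
  then show ?thesis
  proof cases
    case 1
    define s where "s = inverse t"
    have inv: "(inverse has_real_derivative - (s * s)) (at t)"
      using DERIV_inverse[of t] 1 by (simp add: s_def power2_eq_square)
    have "((\<lambda>t. exp (- inverse t)) has_real_derivative exp (- s) * (s * s)) (at t)"
      unfolding s_def using DERIV_chain2[OF DERIV_exp DERIV_minus[OF inv]] by (simp add: s_def)
    moreover have "((\<lambda>t. inverse t ^ n) has_real_derivative real n * (- (s * s) * s ^ (n - Suc 0))) (at t)"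
      unfolding s_def using DERIV_power[OF inv, of n] by (simp add: s_def)
    ultimately have "((\<lambda>t. exp (- inverse t) * inverse t ^ n) has_real_derivative
        (exp (- s) * (s * s)) * inverse t ^ n + (real n * (- (s * s) * s ^ (n - Suc 0))) * exp (- inverse t)) (at t)"
      by (rule DERIV_mult)
    also have "(exp (- s) * (s * s)) * inverse t ^ n + (real n * (- (s * s) * s ^ (n - Suc 0))) * exp (- inverse t)
        = flat_exp (n + 2) t - real n * flat_exp (n + 1) t"
      unfolding s_def[symmetric] flat_exp_def using 1 by (cases n) (simp_all add: algebra_simps)
    finally show ?thesis
      by (rule has_field_derivative_transform_within_open[of _ _ _ "{0<..}"]) (use 1 in \<open>auto simp: flat_exp_def\<close>)
  next
    case 2
    have "((\<lambda>_. 0) has_real_derivative 0) (at t)" by simp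
    then have "(flat_exp n has_real_derivative 0) (at t)"
      by (rule has_field_derivative_transform_within_open[of _ _ _ "{..<0}"]) (use 2 in \<open>auto simp: flat_exp_def\<close>)
    then show ?thesis using 2 by (simp add: flat_exp_def)
  next
    case 3
    have "(\<lambda>h. (flat_exp n (0 + h) - flat_exp n 0) / h) \<midarrow>0\<rightarrow> 0"
    proof (rule Lim_transform_eventually[OF flat_exp_tendsto_0[of "n + 1"]])
      show "\<forall>\<^sub>F h in at 0. flat_exp (n + 1) h = (flat_exp n (0 + h) - flat_exp n 0) / h"
        unfolding eventually_at_filter by (rule always_eventually) (auto simp: flat_exp_def divide_inverse)
    qed
    then have "(flat_exp n has_real_derivative 0) (at 0)" by (simp add: DERIV_def)
    then show ?thesis using 3 by (simp add: flat_exp_def)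
  qed
qed

lemma smooth_flat_exp:
  assumes h: "smooth h" shows "smooth (\<lambda>z. of_real (flat_exp n (Re (h z))))"
proof -
  have der: "((\<lambda>z. complex_of_real (flat_exp n (Re (h z)))) has_derivative
      (\<lambda>v. of_real (Re (dir_deriv v h z)) * (of_real (flat_exp (n + 2) (Re (h z))) + of_real (- real n) * of_real (flat_exp (n + 1) (Re (h z)))))) (at z)"
    for n z
  proof -
    have "((\<lambda>z. Re (h z)) has_derivative (\<lambda>v. Re (dir_deriv v h z))) (at z)"
      by (intro derivative_intros has_derivative_dir_deriv smooth_differentiable h)
    then have "((\<lambda>z. flat_exp n (Re (h z))) has_derivative (\<lambda>v. (flat_exp (n + 2) (Re (h z)) - real n * flat_exp (n + 1) (Re (h z))) * Re (dir_deriv v h z))) (at z)"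
      by (rule has_derivative_compose[OF _ flat_exp_deriv[THEN has_field_derivative_imp_has_derivative]])
    then have "((\<lambda>z. complex_of_real (flat_exp n (Re (h z)))) has_derivative (\<lambda>v. of_real ((flat_exp (n + 2) (Re (h z)) - real n * flat_exp (n + 1) (Re (h z))) * Re (dir_deriv v h z)))) (at z)"
      by (rule derivative_intros)
    then show ?thesis by (simp add: algebra_simps)
  qed
  have "C_k k (\<lambda>z. of_real (flat_exp n (Re (h z))))" for k
  proof (induction k arbitrary: n)
    case 0
    have "continuous_on UNIV (\<lambda>z. complex_of_real (flat_exp n (Re (h z))))"
      using has_derivative_continuous[OF der] by (intro continuous_at_imp_continuous_on) blast
    then show ?case by simp
  next
    case (Suc k)
    have "dir_deriv v (\<lambda>z. of_real (flat_exp n (Re (h z)))) = (\<lambda>z. of_real (Re (dir_deriv v h z)) *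
        (of_real (flat_exp (n + 2) (Re (h z))) + of_real (- real n) * of_real (flat_exp (n + 1) (Re (h z)))))" for v
      using dir_deriv_eq[OF der] by blast
    moreover have "C_k k (\<lambda>z. of_real (Re (dir_deriv v h z)))" for v
      using smooth_Re[OF smooth_dir_deriv[OF h]] by (simp add: smooth_def)
    ultimately have "C_k k (dir_deriv v (\<lambda>z. of_real (flat_exp n (Re (h z)))))" for v
      by (simp only:) (intro C_k_mult C_k_add C_k_const Suc)
    moreover have "(\<lambda>z. complex_of_real (flat_exp n (Re (h z)))) differentiable at z" for z
      using der by (auto simp: differentiable_def)
    ultimately show ?case by (simp add: dx_dir_deriv dy_dir_deriv)
  qed
  then show ?thesis by (simp add: smooth_def)
qed

text \<open>The two terms in the denominator are positive for $|z|^2 < 2$ and $|z|^2 > 1$, so their sum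
  never vanishes.\<close>

definition bump_real :: "complex \<Rightarrow> real" where
  "bump_real z = flat_exp 0 (2 - (norm z)\<^sup>2) / (flat_exp 0 (2 - (norm z)\<^sup>2) + flat_exp 0 ((norm z)\<^sup>2 - 1))"

definition bump :: "complex \<Rightarrow> complex" where
  "bump z = of_real (bump_real z)"

lemma flat_exp_nonneg: "0 \<le> flat_exp n t" and flat_exp_pos: "0 < t \<Longrightarrow> 0 < flat_exp n t" and flat_exp_0: "t \<le> 0 \<Longrightarrow> flat_exp n t = 0"
  by (auto simp: flat_exp_def)

lemma bump_denom: "0 < flat_exp 0 (2 - (norm z)\<^sup>2) + flat_exp 0 ((norm z)\<^sup>2 - 1)"
proof (cases "(norm z)\<^sup>2 < 2")
  case True
  then show ?thesis by (intro add_pos_nonneg flat_exp_pos flat_exp_nonneg) simp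
next
  case False
  then show ?thesis by (intro add_nonneg_pos flat_exp_pos flat_exp_nonneg) simp
qed

lemma bump_real_nonneg: "0 \<le> bump_real z"
  unfolding bump_real_def using bump_denom[of z] flat_exp_nonneg by (intro divide_nonneg_nonneg) auto

lemma smooth_bump: "smooth bump"
proof -
  have n: "Re (z * cnj z) = (norm z)\<^sup>2" for z
    unfolding cmod_power2 by (simp add: power2_eq_square)
  have s: "smooth (\<lambda>z. 2 - z * cnj z)" "smooth (\<lambda>z. z * cnj z - 1)"
    by (intro smooth_intros)+
  let ?a = "\<lambda>z. complex_of_real (flat_exp 0 (Re (2 - z * cnj z)))" and ?b = "\<lambda>z. complex_of_real (flat_exp 0 (Re (z * cnj z - 1)))"
  have "smooth (\<lambda>z. ?a z * inverse (?a z + ?b z))"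
  proof (intro smooth_mult smooth_inverse smooth_add smooth_flat_exp s)
    fix z
    have "?a z + ?b z = of_real (flat_exp 0 (2 - (norm z)\<^sup>2) + flat_exp 0 ((norm z)\<^sup>2 - 1))"
      by (simp only: minus_complex.sel n) simp
    then show "?a z + ?b z \<noteq> 0" using bump_denom[of z] by (metis less_irrefl of_real_eq_0_iff)
  qed
  moreover have "(\<lambda>z. ?a z * inverse (?a z + ?b z)) = bump"
    unfolding bump_def[abs_def] bump_real_def by (simp only: minus_complex.sel n) (simp add: divide_inverse)
  ultimately show ?thesis by simp
qed

lemma bump_eq_1: "norm z \<le> 1 \<Longrightarrow> bump z = 1"
proof -
  assume "norm z \<le> 1"
  then have "(norm z)\<^sup>2 \<le> 1" by (simp add: power_le_one)
  then show ?thesis using bump_denom[of z] by (simp add: bump_def bump_real_def flat_exp_0)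
qed

lemma bump_eq_0: "2 \<le> norm z \<Longrightarrow> bump z = 0"
proof -
  assume "2 \<le> norm z"
  then have "2\<^sup>2 \<le> (norm z)\<^sup>2" by (intro power_mono) auto
  then show ?thesis by (simp add: bump_def bump_real_def flat_exp_0)
qed

lemma compactly_supported_bump: "compactly_supported bump"
  unfolding compactly_supported_def using smooth_bump bump_eq_0 by (auto intro!: exI[of _ 2])

definition cutoff :: "real \<Rightarrow> complex \<Rightarrow> complex \<Rightarrow> complex" where
  "cutoff r l z = bump (of_real (1 / r) * (z - l))"

lemma smooth_cutoff: "smooth (cutoff r l)"
  unfolding cutoff_def[abs_def] by (rule smooth_affine[OF smooth_bump])

lemma cutoff_eq_1: "0 < r \<Longrightarrow> norm (z - l) \<le> r \<Longrightarrow> cutoff r l z = 1"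
  unfolding cutoff_def by (rule bump_eq_1) (simp add: norm_mult norm_divide divide_le_eq)

lemma cutoff_eq_0: "0 < r \<Longrightarrow> 2 * r \<le> norm (z - l) \<Longrightarrow> cutoff r l z = 0"
  unfolding cutoff_def by (rule bump_eq_0) (simp add: norm_mult norm_divide le_divide_eq)

lemma compactly_supported_cutoff: "0 < r \<Longrightarrow> compactly_supported (cutoff r l)"
proof -
  assume r: "0 < r"
  have "cutoff r l z = 0" if "2 * r + norm l < norm z" for z
    by (rule cutoff_eq_0[OF r]) (use that norm_triangle_ineq2[of z l] in linarith)
  then show ?thesis unfolding compactly_supported_def using smooth_cutoff by blast
qed

lemma deriv_bound_cutoff: 
  assumes A: "deriv_bound k 1 (\<lambda>_. A) bump" and r: "0 < r" shows "deriv_bound k (1 / r) (\<lambda>_. A) (cutoff r l)"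
  using deriv_bound_affine[OF _ smooth_bump A, of "1 / r" l] r by (simp add: cutoff_def[abs_def])

section \<open>Functionals annihilated by a polynomial\<close>

lemma poly_subgaussian: "(\<lambda>w. poly p w) \<in> subgaussian"
  unfolding poly_altdef by (intro sum_subgaussian subgaussian_power subgaussian_id)

text \<open>A function that vanishes near the roots of $p$ is divisible by $p$: adding cutoffs at the
  roots to $|p|^2$ gives a smooth denominator without zeros, and changes it only where $f$
  vanishes.\<close>

lemma zero_off_roots:
  assumes H: "gauss_functional q m H" and q: "0 < q" and p: "p \<noteq> 0"
    and ann: "\<And>s t. H (\<lambda>w. poly p w * linexp s t w) = 0"
    and f: "compactly_supported f" and d: "0 < d" and zero: "\<And>l z. poly p l = 0 \<Longrightarrow> norm (z - l) < d \<Longrightarrow> f z = 0"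
  shows "H f = 0"
proof -
  have "finite {l. poly p l = 0}" using poly_roots_finite[OF p] .
  define den where "den z = poly p z * cnj (poly p z) + (\<Sum>l | poly p l = 0. cutoff (d / 2) l z)" for z
  have den_ne: "den z \<noteq> 0" for z
  proof
    assume "den z = 0"
    define b where "b l = bump_real (of_real (1 / (d / 2)) * (z - l))" for l
    have b: "0 \<le> b l" "cutoff (d / 2) l z = of_real (b l)" for l
      by (simp_all add: b_def cutoff_def bump_def bump_real_nonneg)
    have "den z = of_real ((norm (poly p z))\<^sup>2 + (\<Sum>l | poly p l = 0. b l))"
      by (simp add: den_def b(2) complex_norm_square[symmetric])
    then have "(norm (poly p z))\<^sup>2 + (\<Sum>l | poly p l = 0. b l) = 0"
      using \<open>den z = 0\<close> by (metis of_real_eq_0_iff)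
    moreover have "0 \<le> (\<Sum>l | poly p l = 0. b l)" by (intro sum_nonneg b)
    ultimately have "poly p z = 0" "(\<Sum>l | poly p l = 0. b l) = 0"
      by (simp_all add: add_nonneg_eq_0_iff)
    then have "b z = 0"
      using sum_nonneg_eq_0_iff[OF \<open>finite {l. poly p l = 0}\<close>, of b] b(1) by simp
    moreover have "cutoff (d / 2) z z = 1" using d by (intro cutoff_eq_1) auto
    ultimately show False using b(2)[of z] by simp
  qed
  have sp: "smooth (\<lambda>z. poly p z)" by (rule subgaussian_smooth[OF poly_subgaussian])
  have sden: "smooth den"
    unfolding den_def[abs_def] by (intro smooth_intros sp smooth_cutoff)
  define g where "g z = (cnj (poly p z) * inverse (den z)) * f z" for z
  have g: "compactly_supported g"
    unfolding g_def[abs_def] by (intro compactly_supported_mult f smooth_mult smooth_cnj smooth_inverse sp sden den_ne)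
  have pg: "poly p z * g z = f z" for z
  proof (cases "f z = 0")
    case False
    have "cutoff (d / 2) l z = 0" if "poly p l = 0" for l
    proof (rule cutoff_eq_0)
      have "\<not> norm (z - l) < d" using zero[OF that] False by blast
      then show "2 * (d / 2) \<le> norm (z - l)" by simp
    qed (use d in simp)
    then have den: "den z = poly p z * cnj (poly p z)" by (simp add: den_def)
    then have "poly p z \<noteq> 0" "cnj (poly p z) \<noteq> 0" using den_ne[of z] by auto
    then show ?thesis unfolding g_def den by (simp add: divide_simps flip: divide_inverse)
  qed (simp add: g_def)
  define K where "K h = H (\<lambda>z. poly p z * h z)" for h
  have "gauss_functional (q/2) m K"
    unfolding K_def using q by (intro gauss_functional_mult0[OF H poly_subgaussian]) auto
  then have "K g = 0"
    by (rule zero_on_compactly_supported[OF _ _ _ g]) (use q ann in \<open>auto simp: K_def\<close>)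
  then show ?thesis by (simp add: K_def pg)
qed

text \<open>The factor $3$ keeps the supports, of radius $2d$, of the cutoffs at the other points away
  from the disc of radius $d$ about a point.\<close>

lemma separating_radius:
  fixes A :: "complex set"
  assumes "finite A" shows "\<exists>d>0. \<forall>l\<in>A. \<forall>l'\<in>A. l \<noteq> l' \<longrightarrow> 3 * d \<le> norm (l - l')"
proof -
  let ?D = "insert 1 ((\<lambda>(l, l'). norm (l - l')) ` {(l, l') \<in> A \<times> A. l \<noteq> l'})"
  have "finite {(l, l') \<in> A \<times> A. l \<noteq> l'}"
    by (rule finite_subset[of _ "A \<times> A"]) (use assms in auto)
  then have fin: "finite ?D" by simp
  have "\<forall>x\<in>?D. 0 < x" by auto
  then have "0 < Min ?D" using Min_in[OF fin] by blast
  moreover have "3 * (Min ?D / 3) \<le> norm (l - l')" if "l \<in> A" "l' \<in> A" "l \<noteq> l'" for l l'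
  proof -
    have "norm (l - l') \<in> ?D" using that by force
    then show ?thesis using Min_le[OF fin] by simp
  qed
  ultimately show ?thesis
    by (intro exI[of _ "Min ?D / 3"] conjI ballI impI) simp_all
qed

definition local_part :: "dist \<Rightarrow> real \<Rightarrow> complex \<Rightarrow> dist" where
  "local_part H d l f = H (\<lambda>z. cutoff d l z * f z)"

text \<open>The linear functionals of the Taylor polynomial of degree $m$ at $l$.\<close>

definition jet_functional :: "nat \<Rightarrow> complex \<Rightarrow> dist \<Rightarrow> bool" where
  "jet_functional m l T \<longleftrightarrow>
     (\<forall>f g. smooth f \<longrightarrow> smooth g \<longrightarrow> T (\<lambda>z. f z + g z) = T f + T g) \<and>
     (\<forall>c f. smooth f \<longrightarrow> T (\<lambda>z. c * f z) = c * T f) \<and>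
     (\<forall>f. smooth f \<longrightarrow> vanishes (Suc m) f l \<longrightarrow> T f = 0)"

text \<open>Near a zero of order $k$, derivatives of order $j$ are $O(\varepsilon^{k-j})$ on the disc of
  radius $\varepsilon$, by the Lipschitz estimate and induction. Outside the disc only the
  trivial bound is kept, since the function is going to be multiplied by a cutoff.\<close>

lemma deriv_bound_of_vanishes:
  assumes e: "0 < e" "e \<le> 1"
  shows "smooth f \<Longrightarrow> vanishes k f l \<Longrightarrow> deriv_bound k 1 (\<lambda>_. B) f \<Longrightarrow>
    deriv_bound k (1 / e) (\<lambda>z. if norm (z - l) \<le> e then 4 ^ k * B * e ^ k else B) f"
proof (induction k arbitrary: f)
  case 0
  then show ?case by simp
next
  case (Suc k)
  have B0: "0 \<le> B" using deriv_bound_nonneg[OF Suc.prems(3)] by simp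
  have IH: "deriv_bound k (1 / e) (\<lambda>z. if norm (z - l) \<le> e then 4 ^ k * B * e ^ k else B) (dir_deriv u f)"
    if u: "u = 1 \<or> u = \<i>" for u
    by (rule Suc.IH[OF smooth_dir_deriv[OF Suc.prems(1)] vanishes_SucD[OF Suc.prems(2) u]])
       (use deriv_bound_SucD[OF Suc.prems(3) u] in simp)
  show ?case
  proof (rule deriv_bound_SucI)
    fix z
    show "norm (f z) \<le> (if norm (z - l) \<le> e then 4 ^ Suc k * B * e ^ Suc k else B)"
    proof (cases "norm (z - l) \<le> e")
      case True
      have "norm (f z - f l) \<le> 2 * (4 ^ k * B * e ^ k) * norm (z - l)"
      proof (rule lipschitz_on_segment[OF Suc.prems(1)])
        fix u :: complex and s :: real assume u: "u = 1 \<or> u = \<i>" and s: "0 < s" "s < 1"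
        have "norm (l + of_real s * (z - l) - l) \<le> 1 * norm (z - l)"
          using s by (simp add: norm_mult mult_left_le_one_le)
        then have "norm (l + of_real s * (z - l) - l) \<le> e" using True by simp
        then show "norm (dir_deriv u f (l + of_real s * (z - l))) \<le> 4 ^ k * B * e ^ k"
          using deriv_bound_norm[OF IH[OF u], of "l + of_real s * (z - l)"] by simp
      qed
      also have "\<dots> \<le> 4 * (4 ^ k * B * e ^ k) * e"
        using True B0 e by (intro mult_mono) auto
      finally show ?thesis using True Suc.prems(2) by (simp add: mult_ac)
    qed (use deriv_bound_norm[OF Suc.prems(3)] in simp)
  next
    fix u :: complex assume u: "u = 1 \<or> u = \<i>"
    show "deriv_bound k (1 / e) (\<lambda>z. 1 / e * (if norm (z - l) \<le> e then 4 ^ Suc k * B * e ^ Suc k else B)) (dir_deriv u f)"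
    proof (rule deriv_bound_weaken[OF IH[OF u]])
      fix z
      have "1 * B \<le> 1 / e * B" using e B0 by (intro mult_right_mono) auto
      moreover have "4 ^ k * B * e ^ k \<le> 1 / e * (4 ^ Suc k * B * e ^ Suc k)"
        using e B0 by simp
      ultimately show "(if norm (z - l) \<le> e then 4 ^ k * B * e ^ k else B)
          \<le> 1 / e * (if norm (z - l) \<le> e then 4 ^ Suc k * B * e ^ Suc k else B)"
        by simp
    qed (use e in simp)
  qed
qed

text \<open>The $m$ derivatives seen by $H$ cost a factor $(2/\varepsilon)^m$ on functions that vary at
  scale $\varepsilon/2$, while vanishing to order $m+1$ gains $\varepsilon^{m+1}$.\<close>

lemma small_near_high_order_zero:
  assumes H: "gauss_functional q m H" and q: "0 < q" and f: "compactly_supported f" and vanishes: "vanishes (Suc m) f l"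
  shows "\<exists>K. \<forall>e. 0 < e \<and> e \<le> 1 \<longrightarrow> norm (H (\<lambda>z. cutoff (e / 2) l z * f z)) \<le> K * e"
proof -
  obtain C where C: "0 \<le> C" "\<And>f B. f \<in> gaussian q \<Longrightarrow> deriv_bound m 1 (\<lambda>z. B * exp (q * (norm z)\<^sup>2)) f \<Longrightarrow> norm (H f) \<le> C * B"
    using gauss_functional_bound[OF H] by metis
  let ?k = "Suc m"
  obtain B where B: "deriv_bound ?k 1 (\<lambda>_. B) f" using compactly_supported_deriv_bound[OF f] by blast
  obtain A where A: "deriv_bound ?k 1 (\<lambda>_. A) bump" using compactly_supported_deriv_bound[OF compactly_supported_bump] by blast
  have A0: "0 \<le> A" and B0: "0 \<le> B" using deriv_bound_nonneg[OF A] deriv_bound_nonneg[OF B] by auto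
  have s: "smooth f" using f by (rule compactly_supported_smooth)
  define K where "K = C * (2 ^ m * (2 ^ ?k * (A * (4 ^ ?k * B))))"
  have "norm (H (\<lambda>z. cutoff (e / 2) l z * f z)) \<le> K * e" if e: "0 < e" "e \<le> 1" for e
  proof -
    have op: "open {z. e < norm (z - l)}" by (intro open_Collect_less continuous_intros)
    have "deriv_bound ?k (2 / e) (\<lambda>_. A) (cutoff (e / 2) l)"
      using deriv_bound_cutoff[OF A, of "e / 2" l] e by simp
    then have 1: "deriv_bound ?k (2 / e) (\<lambda>z. if z \<in> {z. e < norm (z - l)} then 0 else A) (cutoff (e / 2) l)"
      by (intro deriv_bound_restrict op smooth_cutoff) (use e in \<open>auto intro: cutoff_eq_0\<close>)
    have 2: "deriv_bound ?k (2 / e) (\<lambda>z. if norm (z - l) \<le> e then 4 ^ ?k * B * e ^ ?k else B) f"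
      using deriv_bound_of_vanishes[OF e s vanishes B] by (rule deriv_bound_mono) (use e in \<open>auto simp: divide_right_mono\<close>)
    have "deriv_bound ?k (2 / e) (\<lambda>z. 2 ^ ?k * ((if z \<in> {z. e < norm (z - l)} then 0 else A)
        * (if norm (z - l) \<le> e then 4 ^ ?k * B * e ^ ?k else B))) (\<lambda>z. cutoff (e / 2) l z * f z)"
      by (rule deriv_bound_mult[OF smooth_cutoff s 1 2]) (use e in simp)
    then have b: "deriv_bound ?k (2 / e) (\<lambda>z. 2 ^ ?k * (A * (4 ^ ?k * B * e ^ ?k))) (\<lambda>z. cutoff (e / 2) l z * f z)"
      by (rule deriv_bound_weaken) (use e A0 B0 in auto)
    have "1 \<le> 2 / e" using e by simp
    from deriv_bound_to_1[OF this deriv_bound_pred[OF b]] have b1: "deriv_bound m 1 (\<lambda>z. (2 / e) ^ m * (2 ^ ?k * (A * (4 ^ ?k * B * e ^ ?k)))) (\<lambda>z. cutoff (e / 2) l z * f z)"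
      .
    have eq: "(2 / e) ^ m * (2 ^ ?k * (A * (4 ^ ?k * B * e ^ ?k))) = (2 ^ m * (2 ^ ?k * (A * (4 ^ ?k * B)))) * e"
      using e by (simp add: power_divide)
    have "deriv_bound m 1 (\<lambda>z. ((2 ^ m * (2 ^ ?k * (A * (4 ^ ?k * B)))) * e) * exp (q * (norm z)\<^sup>2)) (\<lambda>z. cutoff (e / 2) l z * f z)"
      using b1 unfolding eq by (rule deriv_bound_gauss_of_deriv_bound) (use q in simp)
    from C(2)[OF _ this] show ?thesis
      using subgaussian_gaussian[OF compactly_supported_subgaussian[OF compactly_supported_mult[OF smooth_cutoff f]] q] by (simp add: K_def mult.assoc)
  qed
  then show ?thesis by blast
qed

text \<open>Subtracting the localized pieces of $f$ leaves a function that vanishes near all roots. At a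
  root, the piece may be restricted to an arbitrarily small disc for the same reason, so it is
  zero if $f$ vanishes to an order exceeding that of $H$.\<close>

lemma finite_support_decomposition:
  assumes H: "gauss_functional q m H" and q: "0 < q" and p: "p \<noteq> 0"
    and ann: "\<And>s t. H (\<lambda>w. poly p w * linexp s t w) = 0"
  shows "\<exists>d>0. (\<forall>f. compactly_supported f \<longrightarrow> H f = (\<Sum>l | poly p l = 0. local_part H d l f)) \<and>
     (\<forall>l. poly p l = 0 \<longrightarrow> jet_functional m l (local_part H d l))"
proof -
  have fin: "finite {l. poly p l = 0}" using poly_roots_finite[OF p] .
  obtain d where d: "0 < d" and sep: "\<And>l l'. poly p l = 0 \<Longrightarrow> poly p l' = 0 \<Longrightarrow> l \<noteq> l' \<Longrightarrow> 3 * d \<le> norm (l - l')"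
    using separating_radius[OF fin] by blast
  have off: "cutoff d l' z = 0" if "poly p l = 0" "poly p l' = 0" "l \<noteq> l'" "norm (z - l) < d" for l l' z
  proof (rule cutoff_eq_0[OF d])
    have "norm (l - l') \<le> norm (z - l') + norm (z - l)"
      using norm_triangle_ineq4[of "z - l'" "z - l"] by simp
    then show "2 * d \<le> norm (z - l')" using sep[OF that(1-3)] that(4) by linarith
  qed
  have G: "f \<in> gaussian q" if "compactly_supported f" for f by (rule subgaussian_gaussian[OF compactly_supported_subgaussian[OF that] q])
  have cc: "compactly_supported (\<lambda>z. cutoff d l z * f z)" if "smooth f" for f l
    by (rule compactly_supported_mult_right[OF compactly_supported_cutoff[OF d] that])
  have "H f = (\<Sum>l | poly p l = 0. local_part H d l f)" if f: "compactly_supported f" for f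
  proof -
    let ?h = "\<lambda>z. \<Sum>l | poly p l = 0. cutoff d l z * f z"
    have h: "compactly_supported ?h"
    proof -
      have "smooth (\<lambda>z. \<Sum>l | poly p l = 0. cutoff d l z)" by (intro smooth_sum smooth_cutoff)
      from compactly_supported_mult[OF this f] show ?thesis by (simp add: sum_distrib_right)
    qed
    have fh: "compactly_supported (\<lambda>z. f z - ?h z)"
    proof -
      have "smooth (\<lambda>z. 1 - (\<Sum>l | poly p l = 0. cutoff d l z))" by (intro smooth_diff smooth_const smooth_sum smooth_cutoff)
      from compactly_supported_mult[OF this f] show ?thesis by (simp add: sum_distrib_right left_diff_distrib)
    qed
    have "H (\<lambda>z. f z - ?h z) = 0"
    proof (rule zero_off_roots[OF H q p ann fh d])
      fix l z assume l: "poly p l = 0" and z: "norm (z - l) < d"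
      have "?h z = (\<Sum>l' | poly p l' = 0. if l' = l then f z else 0)"
      proof (rule sum.cong[OF refl])
        fix l' assume "l' \<in> {l'. poly p l' = 0}"
        then show "cutoff d l' z * f z = (if l' = l then f z else 0)"
          using off[OF l, of l' z] cutoff_eq_1[OF d, of z l] z by auto
      qed
      also have "\<dots> = f z" using fin l by simp
      finally show "f z - ?h z = 0" by simp
    qed
    then have "H f = H ?h" using gauss_functional_diff[OF H G[OF f] G[OF h]] by simp
    also have "\<dots> = (\<Sum>l | poly p l = 0. local_part H d l f)"
      unfolding local_part_def by (rule gauss_functional_sum[OF H fin]) (intro G cc compactly_supported_smooth[OF f])
    finally show ?thesis .
  qed
  moreover have "jet_functional m l (local_part H d l)" if l: "poly p l = 0" for l
    unfolding jet_functional_def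
  proof (intro conjI allI impI)
    show "local_part H d l (\<lambda>z. f z + g z) = local_part H d l f + local_part H d l g" if "smooth f" "smooth g" for f g
      unfolding local_part_def distrib_left by (intro gauss_functional_add[OF H] G cc that)
    show "local_part H d l (\<lambda>z. c * f z) = c * local_part H d l f" if "smooth f" for c f
      unfolding local_part_def using gauss_functional_cmult[OF H G[OF cc[OF that]], of c l] by (simp add: mult.left_commute)
    fix f assume f: "smooth f" and vanishes: "vanishes (Suc m) f l"
    let ?f = "\<lambda>z. cutoff d l z * f z"
    have cf: "compactly_supported ?f" by (rule cc[OF f])
    obtain K where K: "\<And>e. 0 < e \<Longrightarrow> e \<le> 1 \<Longrightarrow> norm (H (\<lambda>z. cutoff (e / 2) l z * ?f z)) \<le> K * e"
      using small_near_high_order_zero[OF H q cf vanishes_mult_left[OF smooth_cutoff f vanishes]] by blast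
    \<comment> \<open>The difference vanishes near all roots, hence is killed by $H$.\<close>
    have eq: "H ?f = H (\<lambda>z. cutoff (e / 2) l z * ?f z)" if e: "0 < e" for e
    proof -
      have c1: "compactly_supported (\<lambda>z. cutoff (e / 2) l z * ?f z)" by (rule compactly_supported_mult[OF smooth_cutoff cf])
      have c2: "compactly_supported (\<lambda>z. ?f z - cutoff (e / 2) l z * ?f z)"
      proof -
        have "smooth (\<lambda>z. 1 - cutoff (e / 2) l z)" by (intro smooth_diff smooth_const smooth_cutoff)
        from compactly_supported_mult[OF this cf] show ?thesis by (simp add: left_diff_distrib)
      qed
      have "H (\<lambda>z. ?f z - cutoff (e / 2) l z * ?f z) = 0"
      proof (rule zero_off_roots[OF H q p ann c2, of "min d (e / 2)"])
        fix l' z assume l': "poly p l' = 0" and z: "norm (z - l') < min d (e / 2)"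
        show "?f z - cutoff (e / 2) l z * ?f z = 0"
        proof (cases "l' = l")
          case True
          then have "cutoff (e / 2) l z = 1" using e z by (intro cutoff_eq_1) auto
          then show ?thesis by simp
        next
          case False
          then have "cutoff d l z = 0" using off[OF l' l] z by auto
          then show ?thesis by simp
        qed
      qed (use d e in simp)
      then show ?thesis using gauss_functional_diff[OF H G[OF cf] G[OF c1]] by simp
    qed
    have bound: "norm (H ?f) \<le> K * e" if "0 < e" "e \<le> 1" for e
      using K[OF that] eq[OF that(1)] by simp
    have "norm (H ?f) \<le> K * (1 / real n)" if "0 < n" for n
    proof (rule bound)
      have "1 \<le> real n" using that by linarith
      then show "1 / real n \<le> 1" by simp
    qed (use that in simp)
    then have "\<forall>\<^sub>F n in sequentially. norm (H ?f) \<le> K * (1 / real n)"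
      using eventually_gt_at_top[of 0] by (rule eventually_mono[rotated])
    moreover have "(\<lambda>n. K * (1 / real n)) \<longlonglongrightarrow> 0"
      by (rule tendsto_mult_right_zero) (rule lim_1_over_n)
    ultimately have "norm (H ?f) \<le> 0" by (intro tendsto_lowerbound) auto
    then show "local_part H d l f = 0" by (simp add: local_part_def)
  qed
  ultimately show ?thesis using d by blast
qed

section \<open>Functionals depending on a finite jet\<close>

lemma jet_add: "jet_functional m l T \<Longrightarrow> smooth f \<Longrightarrow> smooth g \<Longrightarrow> T (\<lambda>z. f z + g z) = T f + T g"
  and jet_cmult: "jet_functional m l T \<Longrightarrow> smooth f \<Longrightarrow> T (\<lambda>z. c * f z) = c * T f"
  and jet_vanishes: "jet_functional m l T \<Longrightarrow> smooth f \<Longrightarrow> vanishes (Suc m) f l \<Longrightarrow> T f = 0"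
  by (simp_all add: jet_functional_def)

lemma jet_diff: "jet_functional m l T \<Longrightarrow> smooth f \<Longrightarrow> smooth g \<Longrightarrow> T (\<lambda>z. f z - g z) = T f - T g"
  using jet_add[of m l T f "\<lambda>z. (-1) * g z"] jet_cmult[of m l T g "-1"] by (simp add: smooth_minus)

lemma jet_sum:
  assumes T: "jet_functional m l T"
  shows "finite I \<Longrightarrow> (\<And>i. i \<in> I \<Longrightarrow> smooth (f i)) \<Longrightarrow> T (\<lambda>z. \<Sum>i\<in>I. f i z) = (\<Sum>i\<in>I. T (f i))"
proof (induction I rule: finite_induct)
  case empty
  then show ?case using jet_cmult[OF T, of "\<lambda>_. 0" 0] by simp
next
  case (insert a I)
  then show ?case using jet_add[OF T, of "f a" "\<lambda>z. \<Sum>i\<in>I. f i z"] by (simp add: smooth_sum)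
qed

definition taylor_monomial :: "complex \<Rightarrow> nat \<times> nat \<Rightarrow> complex \<Rightarrow> complex" where
  "taylor_monomial l \<alpha> z = (of_real (Re (z - l)) ^ fst \<alpha> / fact (fst \<alpha>)) * (of_real (Im (z - l)) ^ snd \<alpha> / fact (snd \<alpha>))"

lemma smooth_taylor_monomial: "smooth (taylor_monomial l \<alpha>)"
  unfolding taylor_monomial_def[abs_def] divide_inverse by (intro smooth_intros)

lemma power_fact_deriv:
  fixes g :: "complex \<Rightarrow> complex"
  assumes "(g has_derivative g') (at z)"
  shows "((\<lambda>z. g z ^ n / fact n) has_derivative (\<lambda>v. (if n = 0 then 0 else g z ^ (n - 1) / fact (n - 1)) * g' v)) (at z)"
proof (cases n)
  case (Suc k)
  have "((\<lambda>z. inverse (fact n) * g z ^ n) has_derivative (\<lambda>v. inverse (fact n) * (of_nat n * g' v * g z ^ (n - 1)))) (at z)"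
    by (intro has_derivative_mult_right has_derivative_power assms)
  moreover have "(\<lambda>v. inverse (fact n) * (of_nat n * g' v * g z ^ (n - 1)))
      = (\<lambda>v. (if n = 0 then 0 else g z ^ (n - 1) / fact (n - 1)) * g' v)"
    using Suc by (simp add: fun_eq_iff field_simps del: of_nat_Suc)
  moreover have "(\<lambda>z. g z ^ n / fact n) = (\<lambda>z. inverse (fact n) * g z ^ n)"
    by (simp add: fun_eq_iff divide_inverse mult.commute)
  ultimately show ?thesis by (simp only:)
qed simp

lemma dir_deriv_taylor_monomial:
  "dir_deriv 1 (taylor_monomial l (a, b)) = (if a = 0 then (\<lambda>_. 0) else taylor_monomial l (a - 1, b))"
  "dir_deriv \<i> (taylor_monomial l (a, b)) = (if b = 0 then (\<lambda>_. 0) else taylor_monomial l (a, b - 1))"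
proof -
  have "dir_deriv v (taylor_monomial l (a, b)) z = (of_real (Re (z - l)) ^ a / fact a) * ((if b = 0 then 0 else of_real (Im (z - l)) ^ (b - 1) / fact (b - 1)) * of_real (Im v))
     + ((if a = 0 then 0 else of_real (Re (z - l)) ^ (a - 1) / fact (a - 1)) * of_real (Re v)) * (of_real (Im (z - l)) ^ b / fact b)" for v z
  proof (rule dir_deriv_eq)
    have r: "((\<lambda>z. complex_of_real (Re (z - l))) has_derivative (\<lambda>v. of_real (Re v))) (at z)"
        "((\<lambda>z. complex_of_real (Im (z - l))) has_derivative (\<lambda>v. of_real (Im v))) (at z)"
      by (auto intro!: derivative_eq_intros)
    show "(taylor_monomial l (a, b) has_derivative (\<lambda>v. (of_real (Re (z - l)) ^ a / fact a) * ((if b = 0 then 0 else of_real (Im (z - l)) ^ (b - 1) / fact (b - 1)) * of_real (Im v))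
     + ((if a = 0 then 0 else of_real (Re (z - l)) ^ (a - 1) / fact (a - 1)) * of_real (Re v)) * (of_real (Im (z - l)) ^ b / fact b))) (at z)"
      unfolding taylor_monomial_def[abs_def] fst_conv snd_conv
      by (intro has_derivative_mult power_fact_deriv r)
  qed
  then show "dir_deriv 1 (taylor_monomial l (a, b)) = (if a = 0 then (\<lambda>_. 0) else taylor_monomial l (a - 1, b))"
    "dir_deriv \<i> (taylor_monomial l (a, b)) = (if b = 0 then (\<lambda>_. 0) else taylor_monomial l (a, b - 1))"
    by (auto simp: fun_eq_iff taylor_monomial_def)
qed

lemma D_taylor_monomial: "D (c, d) (taylor_monomial l (a, b)) = (if c \<le> a \<and> d \<le> b then taylor_monomial l (a - c, b - d) else (\<lambda>_. 0))"
proof -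
  have y: "D (0, d) (taylor_monomial l (a, b)) = (if d \<le> b then taylor_monomial l (a, b - d) else (\<lambda>_. 0))" for a b
  proof (induction d arbitrary: b)
    case (Suc d)
    show ?case unfolding D_0_Suc(2) dy_dir_deriv dir_deriv_taylor_monomial using Suc[of "b - 1"] by (auto simp: D_zero)
  qed simp
  show ?thesis
  proof (induction c)
    case 0
    then show ?case by (simp add: y)
  next
    case (Suc c)
    show ?case unfolding D_Suc_left Suc dx_dir_deriv by (auto simp: dir_deriv_taylor_monomial)
  qed
qed

lemma D_taylor_monomial_at: "D \<beta> (taylor_monomial l \<alpha>) l = (if \<alpha> = \<beta> then 1 else 0)"
proof -
  obtain a b c d where [simp]: "\<alpha> = (a, b)" "\<beta> = (c, d)" by (cases \<alpha>, cases \<beta>) blast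
  have "taylor_monomial l (i, j) l = (if i = 0 \<and> j = 0 then 1 else 0)" for i j
    by (auto simp: taylor_monomial_def)
  then show ?thesis by (auto simp: D_taylor_monomial)
qed

lemma finite_mi_order: "finite {\<alpha>. mi_order \<alpha> \<le> m}"
  by (rule finite_subset[of _ "{..m} \<times> {..m}"]) (auto simp: mi_order_def)

text \<open>The functional does not distinguish $f$ from its Taylor polynomial.\<close>

lemma jet_representation:
  assumes T: "jet_functional m l T" and f: "smooth f"
  shows "T f = (\<Sum>\<alpha> | mi_order \<alpha> \<le> m. D \<alpha> f l * T (taylor_monomial l \<alpha>))"
proof -
  let ?A = "{\<alpha>. mi_order \<alpha> \<le> m}"
  let ?t = "\<lambda>z. \<Sum>\<alpha>\<in>?A. D \<alpha> f l * taylor_monomial l \<alpha> z"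
  have st: "smooth (\<lambda>z. D \<alpha> f l * taylor_monomial l \<alpha> z)" for \<alpha> by (intro smooth_mult smooth_const smooth_taylor_monomial)
  have s: "smooth ?t" by (intro smooth_sum st)
  have "vanishes (Suc m) (\<lambda>z. f z - ?t z) l"
  proof (rule vanishes_of_D)
    show "smooth (\<lambda>z. f z - ?t z)" by (intro smooth_diff f s)
    fix \<beta> assume "mi_order \<beta> < Suc m"
    then have \<beta>: "\<beta> \<in> ?A" by simp
    have "D \<beta> ?t l = (\<Sum>\<alpha>\<in>?A. D \<alpha> f l * D \<beta> (taylor_monomial l \<alpha>) l)"
      by (simp add: D_sum[OF finite_mi_order st] D_cmult[OF smooth_taylor_monomial])
    also have "\<dots> = (\<Sum>\<alpha>\<in>?A. if \<alpha> = \<beta> then D \<beta> f l else 0)"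
      by (rule sum.cong) (auto simp: D_taylor_monomial_at)
    also have "\<dots> = D \<beta> f l" using \<beta> finite_mi_order by simp
    finally have e: "D \<beta> ?t l = D \<beta> f l" .
    have "D \<beta> (\<lambda>z. f z + (-1) * ?t z) l = D \<beta> f l + (-1) * D \<beta> ?t l"
      unfolding D_add[OF f smooth_mult[OF smooth_const s]] D_cmult[OF s] ..
    then show "D \<beta> (\<lambda>z. f z - ?t z) l = 0" using e by simp
  qed
  then have "T (\<lambda>z. f z - ?t z) = 0" by (intro jet_vanishes[OF T] smooth_diff f s)
  then have "T f = T ?t" using jet_diff[OF T f s] by simp
  also have "\<dots> = (\<Sum>\<alpha>\<in>?A. D \<alpha> f l * T (taylor_monomial l \<alpha>))"
    by (simp add: jet_sum[OF T finite_mi_order st] jet_cmult[OF T smooth_taylor_monomial])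
  finally show ?thesis .
qed

lemma jet_functional_mult:
  assumes T: "jet_functional m l T" and g: "smooth g"
  shows "jet_functional m l (\<lambda>f. T (\<lambda>z. g z * f z))"
  unfolding jet_functional_def
proof (intro conjI allI impI)
  show "T (\<lambda>z. g z * (f z + h z)) = T (\<lambda>z. g z * f z) + T (\<lambda>z. g z * h z)" if "smooth f" "smooth h" for f h
    unfolding distrib_left by (rule jet_add[OF T smooth_mult[OF g that(1)] smooth_mult[OF g that(2)]])
  show "T (\<lambda>z. g z * (c * f z)) = c * T (\<lambda>z. g z * f z)" if "smooth f" for c f
    using jet_cmult[OF T smooth_mult[OF g that], of c] by (simp add: mult.left_commute)
  show "T (\<lambda>z. g z * f z) = 0" if "smooth f" "vanishes (Suc m) f l" for f
    by (rule jet_vanishes[OF T smooth_mult[OF g that(1)] vanishes_mult_left[OF g that]])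
qed

text \<open>Monomials in $z - l$ and its conjugate, because the matrix of monomials pairs polynomials with
  conjugates of polynomials.\<close>

definition complex_monomial :: "complex \<Rightarrow> nat \<Rightarrow> nat \<Rightarrow> complex \<Rightarrow> complex" where
  "complex_monomial l a b z = (z - l) ^ a * cnj (z - l) ^ b"

lemma smooth_complex_monomial: "smooth (complex_monomial l a b)"
  unfolding complex_monomial_def[abs_def] by (intro smooth_intros)

lemma vanishes_power: "smooth f \<Longrightarrow> f l = 0 \<Longrightarrow> vanishes k (\<lambda>z. f z ^ k) l"
proof (induction k)
  case (Suc k)
  have "vanishes 1 f l" using Suc.prems(2) by simp
  from vanishes_mult[OF Suc.prems(1) smooth_power[OF Suc.prems(1)] this Suc.IH[OF Suc.prems]]
  show ?case by (simp only: power_Suc One_nat_def add_Suc add_0)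
qed simp

lemma vanishes_complex_monomial: "vanishes (a + b) (complex_monomial l a b) l"
proof -
  have s: "smooth (\<lambda>z. z - l)" "smooth (\<lambda>z. cnj (z - l))"
    by (rule smooth_diff[OF smooth_id smooth_const], rule smooth_cnj, rule smooth_diff[OF smooth_id smooth_const])
  have "vanishes a (\<lambda>z. (z - l) ^ a) l" "vanishes b (\<lambda>z. cnj (z - l) ^ b) l"
    by (rule vanishes_power[OF s(1)], simp) (rule vanishes_power[OF s(2)], simp)
  from vanishes_mult[OF smooth_power[OF s(1)] smooth_power[OF s(2)] this]
  show ?thesis unfolding complex_monomial_def[abs_def] .
qed

lemma jet_lincomb:
  "jet_functional m l T \<Longrightarrow> smooth f \<Longrightarrow> smooth g \<Longrightarrow> T (\<lambda>z. c * f z + e * g z) = c * T f + e * T g"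
  using jet_add[of m l T "\<lambda>z. c * f z" "\<lambda>z. e * g z"] jet_cmult[of m l T]
  by (simp add: smooth_mult)

text \<open>The real Taylor monomials are combinations of complex monomials of the same degree.\<close>

lemma jet_zero_of_complex_monomial:
  assumes T: "jet_functional m l T" and zero: "\<And>a b. d \<le> a + b \<Longrightarrow> T (complex_monomial l a b) = 0"
    and f: "smooth f" "vanishes d f l"
  shows "T f = 0"
proof -
  define x where "x z = complex_of_real (Re (z - l))" for z
  define y where "y z = complex_of_real (Im (z - l))" for z
  have sx: "smooth x" and sy: "smooth y"
    unfolding x_def[abs_def] y_def[abs_def]
    by (rule smooth_Re[OF smooth_diff[OF smooth_id smooth_const]], rule smooth_Im[OF smooth_diff[OF smooth_id smooth_const]])
  have x: "x z = (1/2) * (z - l) + (1/2) * cnj (z - l)" and y: "y z = (- \<i>/2) * (z - l) + (\<i>/2) * cnj (z - l)" for z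
    by (simp_all add: x_def y_def complex_eq_iff field_simps)
  have step: "(c * w + e * w') * (w ^ a * w' ^ b) = c * (w ^ Suc a * w' ^ b) + e * (w ^ a * w' ^ Suc b)"
    for c e w w' :: complex and a b
    by (simp add: algebra_simps)
  have xz: "x z * complex_monomial l a b z = (1/2) * complex_monomial l (Suc a) b z + (1/2) * complex_monomial l a (Suc b) z"
    and yz: "y z * complex_monomial l a b z = (- \<i>/2) * complex_monomial l (Suc a) b z + (\<i>/2) * complex_monomial l a (Suc b) z" for a b z
    unfolding x y complex_monomial_def by (rule step)+
  \<comment> \<open>Powers of $y$, then of $x$, are traded one at a time for factors $z - l$
    and its conjugate.\<close>
  have Y: "T (\<lambda>z. y z ^ j * complex_monomial l a b z) = 0" if "d \<le> j + a + b" for j a b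
    using that
  proof (induction j arbitrary: a b)
    case 0
    then show ?case using zero by simp
  next
    case (Suc j)
    have s: "smooth (\<lambda>z. y z ^ j * complex_monomial l a b z)" for a b
      by (rule smooth_mult[OF smooth_power[OF sy] smooth_complex_monomial])
    have "y z ^ Suc j * complex_monomial l a b z = (- \<i>/2) * (y z ^ j * complex_monomial l (Suc a) b z) + (\<i>/2) * (y z ^ j * complex_monomial l a (Suc b) z)" for z
    proof -
      have "y z ^ Suc j * complex_monomial l a b z = y z ^ j * (y z * complex_monomial l a b z)" by simp
      then show ?thesis unfolding yz by (simp only: distrib_left mult.left_commute)
    qed
    then have "T (\<lambda>z. y z ^ Suc j * complex_monomial l a b z) = (- \<i>/2) * T (\<lambda>z. y z ^ j * complex_monomial l (Suc a) b z) + (\<i>/2) * T (\<lambda>z. y z ^ j * complex_monomial l a (Suc b) z)"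
      using jet_lincomb[OF T s s] by (simp only:)
    moreover have "T (\<lambda>z. y z ^ j * complex_monomial l (Suc a) b z) = 0" "T (\<lambda>z. y z ^ j * complex_monomial l a (Suc b) z) = 0"
      using Suc.prems by (intro Suc.IH; simp)+
    ultimately show ?case by simp
  qed
  have X: "T (\<lambda>z. x z ^ i * (y z ^ j * complex_monomial l a b z)) = 0" if "d \<le> i + j + a + b" for i j a b
    using that
  proof (induction i arbitrary: a b)
    case 0
    then show ?case using Y by simp
  next
    case (Suc i)
    have s: "smooth (\<lambda>z. x z ^ i * (y z ^ j * complex_monomial l a b z))" for a b
      by (rule smooth_mult[OF smooth_power[OF sx] smooth_mult[OF smooth_power[OF sy] smooth_complex_monomial]])
    have "x z ^ Suc i * (y z ^ j * complex_monomial l a b z)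
       = (1/2) * (x z ^ i * (y z ^ j * complex_monomial l (Suc a) b z)) + (1/2) * (x z ^ i * (y z ^ j * complex_monomial l a (Suc b) z))" for z
    proof -
      have "x z ^ Suc i * (y z ^ j * complex_monomial l a b z) = x z ^ i * (y z ^ j * (x z * complex_monomial l a b z))" by simp
      then show ?thesis unfolding xz by (simp only: distrib_left mult.left_commute)
    qed
    then have "T (\<lambda>z. x z ^ Suc i * (y z ^ j * complex_monomial l a b z)) =
        (1/2) * T (\<lambda>z. x z ^ i * (y z ^ j * complex_monomial l (Suc a) b z)) + (1/2) * T (\<lambda>z. x z ^ i * (y z ^ j * complex_monomial l a (Suc b) z))"
      using jet_lincomb[OF T s s] by (simp only:)
    moreover have "T (\<lambda>z. x z ^ i * (y z ^ j * complex_monomial l (Suc a) b z)) = 0" "T (\<lambda>z. x z ^ i * (y z ^ j * complex_monomial l a (Suc b) z)) = 0"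
      using Suc.prems by (intro Suc.IH; simp)+
    ultimately show ?case by simp
  qed
  have Tm: "T (taylor_monomial l \<alpha>) = 0" if "d \<le> mi_order \<alpha>" for \<alpha>
  proof -
    let ?m = "\<lambda>z. x z ^ fst \<alpha> * (y z ^ snd \<alpha> * complex_monomial l 0 0 z)"
    have "taylor_monomial l \<alpha> = (\<lambda>z. (1 / (fact (fst \<alpha>) * fact (snd \<alpha>))) * ?m z)"
      by (simp add: taylor_monomial_def fun_eq_iff complex_monomial_def x_def y_def)
    moreover have "smooth ?m"
      by (rule smooth_mult[OF smooth_power[OF sx] smooth_mult[OF smooth_power[OF sy] smooth_complex_monomial]])
    ultimately have "T (taylor_monomial l \<alpha>) = (1 / (fact (fst \<alpha>) * fact (snd \<alpha>))) * T ?m"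
      using jet_cmult[OF T] by metis
    then show ?thesis using X[of "fst \<alpha>" "snd \<alpha>" 0 0] that by (simp add: mi_order_def)
  qed
  show ?thesis
    unfolding jet_representation[OF T f(1)]
  proof (rule sum.neutral, intro ballI)
    fix \<alpha>
    show "D \<alpha> f l * T (taylor_monomial l \<alpha>) = 0"
      using vanishes_D[OF f, of \<alpha>] Tm[of \<alpha>] by (cases "mi_order \<alpha> < d") auto
  qed
qed

text \<open>Take a complex monomial of maximal degree on which the functional is nonzero. Replacing $g$ by
  its value at $l$ changes the product by a function vanishing to a higher order, which the
  functional kills.\<close>

lemma leading_monomial:
  assumes T: "jet_functional m l T" and nz: "smooth f" "T f \<noteq> 0"
  shows "\<exists>a b. T (complex_monomial l a b) \<noteq> 0 \<and> (\<forall>g. smooth g \<longrightarrow> T (\<lambda>z. g z * complex_monomial l a b z) = g l * T (complex_monomial l a b))"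
proof -
  have "\<exists>a b. T (complex_monomial l a b) \<noteq> 0"
    using jet_zero_of_complex_monomial[OF T, of 0 f] nz by auto
  then have ex: "\<exists>ab. T (complex_monomial l (fst ab) (snd ab)) \<noteq> 0" by auto
  have bounded: "\<forall>ab. T (complex_monomial l (fst ab) (snd ab)) \<noteq> 0 \<longrightarrow> fst ab + snd ab < Suc m"
  proof (intro allI impI)
    fix ab assume "T (complex_monomial l (fst ab) (snd ab)) \<noteq> 0"
    then have "\<not> vanishes (Suc m) (complex_monomial l (fst ab) (snd ab)) l"
      using jet_vanishes[OF T smooth_complex_monomial] by blast
    then show "fst ab + snd ab < Suc m"
      using vanishes_antimono[OF vanishes_complex_monomial[of "fst ab" "snd ab" l]] not_le by blast
  qed
  obtain ab where ab: "T (complex_monomial l (fst ab) (snd ab)) \<noteq> 0"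
    "\<And>cd. T (complex_monomial l (fst cd) (snd cd)) \<noteq> 0 \<Longrightarrow> fst cd + snd cd \<le> fst ab + snd ab"
    using ex_has_greatest_nat[of "\<lambda>ab. T (complex_monomial l (fst ab) (snd ab)) \<noteq> 0" _ "\<lambda>ab. fst ab + snd ab"] ex bounded
    by (metis less_imp_le)
  obtain a b where [simp]: "ab = (a, b)" by force
  have higher: "T (complex_monomial l c d) = 0" if "Suc (a + b) \<le> c + d" for c d
    using ab(2)[of "(c, d)"] that by auto
  have "T (\<lambda>z. g z * complex_monomial l a b z) = g l * T (complex_monomial l a b)" if g: "smooth g" for g
  proof -
    have "vanishes 1 (\<lambda>z. g z - g l) l" by simp
    then have "vanishes (1 + (a + b)) (\<lambda>z. (g z - g l) * complex_monomial l a b z) l"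
      by (intro vanishes_mult smooth_diff g smooth_const smooth_complex_monomial vanishes_complex_monomial)
    then have "T (\<lambda>z. (g z - g l) * complex_monomial l a b z) = 0"
      by (intro jet_zero_of_complex_monomial[OF T higher]) (auto intro!: smooth_mult smooth_diff g smooth_complex_monomial)
    moreover have "(\<lambda>z. (g z - g l) * complex_monomial l a b z) = (\<lambda>z. g z * complex_monomial l a b z - g l * complex_monomial l a b z)"
      by (simp add: fun_eq_iff left_diff_distrib)
    ultimately show ?thesis
      using jet_diff[OF T smooth_mult[OF g smooth_complex_monomial] smooth_mult[OF smooth_const smooth_complex_monomial]]
        jet_cmult[OF T smooth_complex_monomial] by simp
  qed
  then show ?thesis using ab(1) by auto
qed

section \<open>Density of compactly supported functions\<close>

text \<open>Outside a large disc the little-o condition makes the constant arbitrarily small.\<close>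

lemma Dq_weighted_bound:
  assumes f: "f \<in> Dq q" and e: "0 < e"
  shows "\<exists>R B. deriv_bound m 1 (\<lambda>z. (if R \<le> norm z then e else B) * exp (q * (norm z)\<^sup>2)) f"
proof -
  let ?A = "{\<alpha>. mi_order \<alpha> \<le> m}"
  have "\<forall>\<^sub>F z in at_infinity. norm (D \<alpha> f z) \<le> e * exp (q * (norm z)\<^sup>2)" for \<alpha>
    using landau_o.smallD[OF Dq_smallo[OF f, of \<alpha>] e] by simp
  then have "\<forall>\<^sub>F z in at_infinity. \<forall>\<alpha>\<in>?A. norm (D \<alpha> f z) \<le> e * exp (q * (norm z)\<^sup>2)"
    by (intro eventually_ball_finite finite_mi_order) blast
  then obtain R where R: "\<And>z \<alpha>. R \<le> norm z \<Longrightarrow> mi_order \<alpha> \<le> m \<Longrightarrow> norm (D \<alpha> f z) \<le> e * exp (q * (norm z)\<^sup>2)"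
    unfolding eventually_at_infinity by blast
  have sn: "norm (D \<alpha> f z) * exp (- q * (norm z)\<^sup>2) \<le> Dq_seminorm q \<alpha> f" for \<alpha> z
    unfolding Dq_seminorm_def by (intro cSUP_upper Dq_seminorm_bdd f) simp
  have sn0: "0 \<le> Dq_seminorm q \<alpha> f" for \<alpha>
    using order_trans[OF _ sn[of \<alpha> 0]] by simp
  define B where "B = (\<Sum>\<alpha>\<in>?A. Dq_seminorm q \<alpha> f)"
  have B: "norm (D \<alpha> f z) \<le> B * exp (q * (norm z)\<^sup>2)" if "mi_order \<alpha> \<le> m" for \<alpha> z
  proof -
    have "norm (D \<alpha> f z) = (norm (D \<alpha> f z) * exp (- q * (norm z)\<^sup>2)) * exp (q * (norm z)\<^sup>2)"
      by (simp add: mult.assoc flip: exp_add)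
    also have "\<dots> \<le> Dq_seminorm q \<alpha> f * exp (q * (norm z)\<^sup>2)" by (intro mult_right_mono sn) simp
    also have "Dq_seminorm q \<alpha> f \<le> B"
      unfolding B_def using that sn0 finite_mi_order by (intro member_le_sum) auto
    finally show ?thesis by simp
  qed
  have "deriv_bound m 1 (\<lambda>z. (if R \<le> norm z then e else B) * exp (q * (norm z)\<^sup>2)) f"
    by (rule deriv_bound_of_D[OF Dq_smooth[OF f]]) (use R B in auto)
  then show ?thesis by blast
qed

text \<open>The error is supported where the weighted bound of $f$ is small, and cutoffs of radius $R \ge
  1$ have derivatives bounded uniformly in $R$.\<close>

lemma Dq_cutoff_approximation:
  assumes G: "G \<in> Dq_dual q" and q: "0 < q" and f: "f \<in> Dq q" and e: "0 < e"
  shows "\<exists>R0. \<forall>R\<ge>R0. norm (G f - G (\<lambda>z. cutoff R 0 z * f z)) \<le> e"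
proof -
  obtain m C where C: "0 \<le> C" "\<And>f B. f \<in> Dq q \<Longrightarrow> deriv_bound m 1 (\<lambda>z. B * exp (q * (norm z)\<^sup>2)) f \<Longrightarrow> norm (G f) \<le> C * B"
    using Dq_dual_bound[OF G] by metis
  obtain A where A: "deriv_bound m 1 (\<lambda>_. A) bump" using compactly_supported_deriv_bound[OF compactly_supported_bump] by blast
  have A0: "0 \<le> A" using deriv_bound_nonneg[OF A] by simp
  let ?K = "C * (2 ^ m * (1 + A)) + 1"
  have K: "0 < ?K" using C A0 by (intro add_nonneg_pos) auto
  define e' where "e' = e / ?K"
  have e': "0 < e'" using e K by (simp add: e'_def)
  obtain R1 B where RB: "deriv_bound m 1 (\<lambda>z. (if R1 \<le> norm z then e' else B) * exp (q * (norm z)\<^sup>2)) f"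
    using Dq_weighted_bound[OF f e'] by blast
  have s: "smooth f" using Dq_smooth[OF f] .
  have "norm (G f - G (\<lambda>z. cutoff R 0 z * f z)) \<le> e" if R: "max 1 R1 \<le> R" for R
  proof -
    have R0: "0 < R" using R by simp
    have "deriv_bound m (1 / R) (\<lambda>_. A) (cutoff R 0)" by (rule deriv_bound_cutoff[OF A R0])
    then have "deriv_bound m 1 (\<lambda>_. A) (cutoff R 0)" by (rule deriv_bound_mono) (use R in auto)
    then have "deriv_bound m 1 (\<lambda>_. norm (1::complex) + A) (\<lambda>z. 1 - cutoff R 0 z)"
      by (intro deriv_bound_diff smooth_const smooth_cutoff deriv_bound_const) auto
    then have 1: "deriv_bound m 1 (\<lambda>z. if z \<in> ball 0 R then 0 else norm (1::complex) + A) (\<lambda>z. 1 - cutoff R 0 z)"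
      by (intro deriv_bound_restrict smooth_diff smooth_const smooth_cutoff) (auto simp: cutoff_eq_1 R0)
    have "deriv_bound m 1 (\<lambda>z. 2 ^ m * ((if z \<in> ball 0 R then 0 else norm (1::complex) + A) *
        ((if R1 \<le> norm z then e' else B) * exp (q * (norm z)\<^sup>2)))) (\<lambda>z. (1 - cutoff R 0 z) * f z)"
      by (rule deriv_bound_mult[OF smooth_diff[OF smooth_const smooth_cutoff] s 1 RB]) simp
    then have b: "deriv_bound m 1 (\<lambda>z. (2 ^ m * (1 + A) * e') * exp (q * (norm z)\<^sup>2)) (\<lambda>z. (1 - cutoff R 0 z) * f z)"
      by (rule deriv_bound_weaken) (use R A0 e' in auto)
    have "compactly_supported (\<lambda>z. cutoff R 0 z * f z)" by (rule compactly_supported_mult_right[OF compactly_supported_cutoff[OF R0] s])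
    then have "(\<lambda>z. cutoff R 0 z * f z) \<in> gaussian (q/2)"
      using q by (intro subgaussian_gaussian compactly_supported_subgaussian) auto
    then have cD: "(\<lambda>z. cutoff R 0 z * f z) \<in> Dq q" using gaussian_subset_Dq[of "q/2" q] q by auto
    have "(\<lambda>z. (1 - cutoff R 0 z) * f z) = (\<lambda>z. f z - cutoff R 0 z * f z)"
      by (simp add: fun_eq_iff left_diff_distrib)
    then have "norm (G (\<lambda>z. f z - cutoff R 0 z * f z)) \<le> C * (2 ^ m * (1 + A) * e')"
      using C(2)[OF _ b] Dq_diff[OF f cD] by simp
    also have "\<dots> \<le> ?K * e'" using e' by (simp add: algebra_simps)
    also have "\<dots> = e" using K by (simp add: e'_def)
    finally have "norm (G (\<lambda>z. f z - cutoff R 0 z * f z)) \<le> e" .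
    moreover have "G (\<lambda>z. f z + (-1) * (cutoff R 0 z * f z)) = G f + (-1) * G (\<lambda>z. cutoff R 0 z * f z)"
      using Dq_dual_add[OF G f Dq_cmult[OF cD]] Dq_dual_cmult[OF G cD] by metis
    ultimately show ?thesis by simp
  qed
  then show ?thesis by blast
qed

text \<open>A cutoff to a large disc does not change the local parts.\<close>

lemma dual_decomposition_extends:
  assumes G: "G \<in> Dq_dual q" and q: "0 < q" and A: "finite A" and d: "0 < d"
    and dec: "\<And>f. compactly_supported f \<Longrightarrow> G f = (\<Sum>l\<in>A. local_part G d l f)" and f: "f \<in> Dq q"
  shows "G f = (\<Sum>l\<in>A. local_part G d l f)"
proof -
  have "norm (G f - (\<Sum>l\<in>A. local_part G d l f)) \<le> e" if e: "0 < e" for e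
  proof -
    obtain R0 where R0: "\<And>R. R0 \<le> R \<Longrightarrow> norm (G f - G (\<lambda>z. cutoff R 0 z * f z)) \<le> e"
      using Dq_cutoff_approximation[OF G q f e] by blast
    define R where "R = max R0 (max 1 (\<Sum>l\<in>A. norm l + 2 * d))"
    have R: "R0 \<le> R" "0 < R" by (auto simp: R_def)
    have "G (\<lambda>z. cutoff R 0 z * f z) = (\<Sum>l\<in>A. local_part G d l (\<lambda>z. cutoff R 0 z * f z))"
      by (rule dec[OF compactly_supported_mult_right[OF compactly_supported_cutoff[OF R(2)] Dq_smooth[OF f]]])
    also have "\<dots> = (\<Sum>l\<in>A. local_part G d l f)"
    proof (rule sum.cong[OF refl])
      fix l assume l: "l \<in> A"
      have "norm l + 2 * d \<le> (\<Sum>l\<in>A. norm l + 2 * d)"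
        using A l d by (intro member_le_sum) auto
      then have lR: "norm l + 2 * d \<le> R" by (simp add: R_def)
      have "cutoff d l z * (cutoff R 0 z * f z) = cutoff d l z * f z" for z
      proof (cases "2 * d \<le> norm (z - l)")
        case True
        then show ?thesis by (simp add: cutoff_eq_0[OF d])
      next
        case False
        then have "norm (z - 0) \<le> R" using lR norm_triangle_ineq2[of z l] by simp
        then show ?thesis by (simp add: cutoff_eq_1[OF R(2)])
      qed
      then show "local_part G d l (\<lambda>z. cutoff R 0 z * f z) = local_part G d l f"
        unfolding local_part_def by (simp only:)
    qed
    finally show ?thesis using R0[OF R(1)] by simp
  qed
  then have "norm (G f - (\<Sum>l\<in>A. local_part G d l f)) \<le> 0"
    using field_le_epsilon[of "norm (G f - (\<Sum>l\<in>A. local_part G d l f))" 0] by simp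
  then show ?thesis by simp
qed

section \<open>Consequences of finite rank\<close>

lemma sum_fun_apply: "(\<Sum>i\<in>I. f i) k = (\<Sum>i\<in>I. f i k)" for f :: "'i \<Rightarrow> nat \<Rightarrow> complex"
  by (induction I rule: infinite_finite_induct) auto

lemma rank_dependence:
  assumes rank: "finite_rank A \<and> matrix_rank A \<le> N" and v: "\<And>i. i < Suc N \<Longrightarrow> v i \<in> module.span seq_scale (range A)"
  shows "\<exists>c. (\<exists>i<Suc N. c i \<noteq> 0) \<and> (\<forall>k. (\<Sum>i<Suc N. c i * v i k) = 0)"
proof -
  interpret vs: vector_space seq_scale by (rule vector_space_seq_scale)
  obtain S where S: "finite S" "range A \<subseteq> vs.span S"
    using rank unfolding finite_rank_def by blast
  obtain B where B: "B \<subseteq> range A" "vs.independent B" "range A \<subseteq> vs.span B" "card B = vs.dim (range A)"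
    using vs.basis_exists by blast
  have finB: "finite B"
    using vs.independent_span_bound[OF S(1) B(2)] B(1) S(2) by blast
  have cardB: "card B < Suc N" using rank B(4) by (simp add: matrix_rank_def)
  have "\<exists>r. v i = (\<Sum>b\<in>B. seq_scale (r b) b)" if "i < Suc N" for i
  proof -
    have "v i \<in> vs.span B" using v[OF that] B(3) vs.span_minimal[OF _ vs.subspace_span] by blast
    then show ?thesis unfolding vs.span_finite[OF finB] by blast
  qed
  then obtain r where r: "\<And>i. i < Suc N \<Longrightarrow> v i = (\<Sum>b\<in>B. seq_scale (r i b) b)" by metis
  obtain c where c: "\<exists>i<Suc N. c i \<noteq> 0" "\<forall>b\<in>B. (\<Sum>i<Suc N. c i * r i b) = 0"
    using underdetermined_system[OF finB cardB, of r] by blast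
  have "(\<Sum>i<Suc N. c i * v i k) = 0" for k
  proof -
    have "(\<Sum>i<Suc N. c i * v i k) = (\<Sum>i<Suc N. \<Sum>b\<in>B. (c i * r i b) * b k)"
      using r by (simp add: sum_fun_apply seq_scale_def sum_distrib_left mult.assoc)
    also have "\<dots> = (\<Sum>b\<in>B. (\<Sum>i<Suc N. c i * r i b) * b k)"
      by (subst sum.swap) (simp only: sum_distrib_right)
    also have "\<dots> = 0" using c(2) by simp
    finally show ?thesis .
  qed
  then show ?thesis using c(1) by blast
qed

text \<open>The Gaussian in the Toeplitz form cancels the factor in $F$ up to $1/\pi$.\<close>

lemma toeplitz_form_eq:
  assumes bF: "bF \<in> Dq_dual q" and F: "F = dist_mult (\<lambda>z. of_real (exp ((norm z)\<^sup>2))) bF"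
    and uv: "(\<lambda>w. u w * cnj (v w)) \<in> Dq q"
  shows "toeplitz_form F u v = (1 / of_real pi) * bF (\<lambda>w. u w * cnj (v w))"
proof -
  have "of_real (exp ((norm z)\<^sup>2)) * (gauss z * (u z * cnj (v z))) = (1 / of_real pi) * (u z * cnj (v z))" for z
  proof -
    have "complex_of_real (exp ((norm z)\<^sup>2)) * gauss z = of_real (exp ((norm z)\<^sup>2) * exp (- (norm z)\<^sup>2) / pi)"
      by (simp add: gauss_def)
    also have "exp ((norm z)\<^sup>2) * exp (- (norm z)\<^sup>2) = 1" by (simp flip: exp_add)
    finally show ?thesis by (simp add: mult.assoc[symmetric])
  qed
  then have "toeplitz_form F u v = bF (\<lambda>z. (1 / of_real pi) * (u z * cnj (v z)))"
    by (simp only: toeplitz_form_def F dist_mult_def)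
  also have "\<dots> = (1 / of_real pi) * bF (\<lambda>w. u w * cnj (v w))"
    by (rule Dq_dual_cmult[OF bF uv])
  finally show ?thesis .
qed

lemma subgaussian_Dq: "f \<in> subgaussian \<Longrightarrow> 0 < q \<Longrightarrow> f \<in> Dq q"
  using subgaussian_gaussian[of f "q/2"] gaussian_subset_Dq[of "q/2" q] by auto

text \<open>The first $N+1$ points of the sequence supply the row labels, conjugated because the
  reproducing kernel is antilinear in the exponent, and the next $N+1$ points the column labels.\<close>

lemma minors_vanish:
  assumes q: "0 < q" and bF: "bF \<in> Dq_dual q" and F: "F = dist_mult (\<lambda>z. of_real (exp ((norm z)\<^sup>2))) bF"
    and K: "\<And>z. finite_rank (K_matrix F z) \<and> matrix_rank (K_matrix F z) \<le> N"
  shows "minor (\<lambda>s t. bF (linexp s t)) (Suc N) x y = 0"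
proof -
  interpret vs: vector_space seq_scale by (rule vector_space_seq_scale)
  define z where "z k = (if k < Suc N then cnj (x k) else y (k - Suc N))" for k
  have entry: "K_matrix F z k k' = (1 / of_real pi) * bF (linexp (cnj (z k)) (z k'))" for k k'
  proof -
    have "(\<lambda>w. fock_kernel (z k) w * cnj (fock_kernel (z k') w)) = linexp (cnj (z k)) (z k')"
      by (simp add: fock_kernel_def linexp_def exp_cnj fun_eq_iff exp_add mult.commute)
    then show ?thesis
      unfolding K_matrix_def using toeplitz_form_eq[OF bF F, of "fock_kernel (z k)" "fock_kernel (z k')"]
        subgaussian_Dq[OF subgaussian_linexp q] by simp
  qed
  have "K_matrix F z i \<in> vs.span (range (K_matrix F z))" for i
    by (intro vs.span_base) blast
  then obtain c where c: "\<exists>i<Suc N. c i \<noteq> 0" "\<And>k. (\<Sum>i<Suc N. c i * K_matrix F z i k) = 0"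
    using rank_dependence[OF K[of z], of "\<lambda>i. K_matrix F z i"] by blast
  have "(\<Sum>i<Suc N. c i * bF (linexp (x i) (y j))) = 0" for j
  proof -
    have "(\<Sum>i<Suc N. c i * K_matrix F z i (Suc N + j)) = (1 / of_real pi) * (\<Sum>i<Suc N. c i * bF (linexp (x i) (y j)))"
      unfolding entry sum_distrib_left by (intro sum.cong refl) (auto simp: z_def)
    then show ?thesis using c(2)[of "Suc N + j"] by simp
  qed
  then show ?thesis unfolding minor_zero_iff using c(1) by (intro exI[of _ c]) simp
qed

text \<open>At each point $l$ choose a leading monomial $(z-l)^a\overline{(z-l)}^b$ of the local part, and
  let $u_l = Q_l\,(z-l)^a$ and $v_l = Q_l\,(z-l)^b$, where $Q_l$ vanishes to order $m+1$ at all
  other points. Then $G(u_l\overline{v_{l'}})$ is zero for $l \neq l'$ and nonzero for $l = l'$.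
  With more than $N$ points, the rows obtained from the $u_l$ would satisfy a nontrivial linear
  relation; pairing it with $v_l$ for a point where its coefficient is nonzero gives a
  contradiction.\<close>

lemma number_of_points_le_rank:
  assumes q: "0 < q" and bF: "bF \<in> Dq_dual q" and F: "F = dist_mult (\<lambda>z. of_real (exp ((norm z)\<^sup>2))) bF"
    and P: "finite_rank (P_matrix F) \<and> matrix_rank (P_matrix F) \<le> N"
    and A: "finite A" and T: "\<And>l. l \<in> A \<Longrightarrow> jet_functional m l (T l)"
    and nz: "\<And>l. l \<in> A \<Longrightarrow> \<exists>f. smooth f \<and> T l f \<noteq> 0"
    and dec: "\<And>f. f \<in> Dq q \<Longrightarrow> bF f = (\<Sum>l\<in>A. T l f)"
  shows "card A \<le> N"
proof (rule ccontr)
  assume "\<not> ?thesis"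
  then have N: "Suc N \<le> card A" by simp
  interpret vs: vector_space seq_scale by (rule vector_space_seq_scale)
  have "\<exists>a b. T l (complex_monomial l a b) \<noteq> 0 \<and> (\<forall>g. smooth g \<longrightarrow> T l (\<lambda>z. g z * complex_monomial l a b z) = g l * T l (complex_monomial l a b))"
    if "l \<in> A" for l
    using leading_monomial[OF T[OF that]] nz[OF that] by blast
  then obtain a b where ab: "\<And>l. l \<in> A \<Longrightarrow> T l (complex_monomial l (a l) (b l)) \<noteq> 0"
    "\<And>l g. l \<in> A \<Longrightarrow> smooth g \<Longrightarrow> T l (\<lambda>z. g z * complex_monomial l (a l) (b l) z) = g l * T l (complex_monomial l (a l) (b l))"
    by metis
  define Q where "Q l = (\<Prod>l'\<in>A - {l}. [:- l', 1:] ^ Suc m)" for l :: complex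
  define U where "U l k = Q l * [:- l, 1:] ^ k" for l k
  have pQ: "poly (Q l) z = (\<Prod>l'\<in>A - {l}. (z - l') ^ Suc m)" for l z
    by (simp add: Q_def poly_prod poly_power del: power_Suc)
  have pU: "poly (U l k) z = poly (Q l) z * (z - l) ^ k" for l k z
    by (simp add: U_def poly_power)
  have sp: "smooth (\<lambda>z. poly p z)" for p by (rule subgaussian_smooth[OF poly_subgaussian])
  have vanU: "vanishes (Suc m) (\<lambda>z. poly (U l k) z) l'" "vanishes (Suc m) (\<lambda>z. cnj (poly (U l k) z)) l'"
    if "l' \<in> A" "l' \<noteq> l" for l l' k
  proof -
    define h where "h z = (\<Prod>l''\<in>A - {l} - {l'}. (z - l'') ^ Suc m) * (z - l) ^ k" for z
    have sh: "smooth h" unfolding h_def[abs_def] by (intro smooth_intros)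
    have eq: "poly (U l k) z = h z * (z - l') ^ Suc m" for z
      unfolding pU pQ h_def using that A by (subst prod.remove[of _ l']) (auto simp: mult_ac)
    have s: "smooth (\<lambda>z. cnj (z - l'))" "smooth (\<lambda>z. z - l')"
      by (rule smooth_cnj, rule smooth_diff[OF smooth_id smooth_const], rule smooth_diff[OF smooth_id smooth_const])
    have 1: "vanishes (Suc m) (\<lambda>z. (z - l') ^ Suc m) l'" "vanishes (Suc m) (\<lambda>z. cnj (z - l') ^ Suc m) l'"
      by (rule vanishes_power[OF s(2)], simp) (rule vanishes_power[OF s(1)], simp)
    show "vanishes (Suc m) (\<lambda>z. poly (U l k) z) l'"
      unfolding eq by (intro vanishes_mult_left sh 1 smooth_power s)
    have "cnj (poly (U l k) z) = cnj (h z) * cnj (z - l') ^ Suc m" for z by (simp add: eq)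
    then show "vanishes (Suc m) (\<lambda>z. cnj (poly (U l k) z)) l'"
      by (simp only:) (intro vanishes_mult_left smooth_cnj[OF sh] 1 smooth_power s)
  qed
  let ?u = "\<lambda>l. U l (a l)" and ?v = "\<lambda>l. U l (b l)"
  have prod_Dq: "(\<lambda>z. poly p z * cnj (poly r z)) \<in> Dq q" for p r
  proof -
    have "(\<lambda>z. cnj (poly r z)) = (\<lambda>z. \<Sum>i\<le>degree r. cnj (coeff r i) * cnj z ^ i)"
      by (simp add: poly_altdef)
    then have "(\<lambda>z. cnj (poly r z)) \<in> subgaussian"
      by (simp only:) (intro sum_subgaussian subgaussian_power subgaussian_cnj)
    then show ?thesis by (intro subgaussian_Dq q subgaussian_mult poly_subgaussian)
  qed
  have pairing: "bF (\<lambda>z. poly (?u l) z * cnj (poly (?v l') z)) =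
      (if l = l' then poly (Q l) l * cnj (poly (Q l) l) * T l (complex_monomial l (a l) (b l)) else 0)"
    if l: "l \<in> A" "l' \<in> A" for l l'
  proof -
    let ?f = "\<lambda>z. poly (?u l) z * cnj (poly (?v l') z)"
    have s: "smooth ?f" by (intro smooth_mult smooth_cnj sp)
    have zero: "T i ?f = 0" if i: "i \<in> A" "i \<noteq> l \<or> i \<noteq> l'" for i
    proof (rule jet_vanishes[OF T[OF i(1)] s])
      show "vanishes (Suc m) ?f i"
      proof (cases "i = l")
        case True
        then show ?thesis using i vanU(2)[of i l'] by (intro vanishes_mult_left sp smooth_cnj) auto
      next
        case False
        have "vanishes (Suc m) (\<lambda>z. cnj (poly (?v l') z) * poly (?u l) z) i"
          by (rule vanishes_mult_left[OF smooth_cnj[OF sp] sp vanU(1)]) (use i False in auto)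
        then show ?thesis by (simp only: mult.commute)
      qed
    qed
    show ?thesis
    proof (cases "l = l'")
      case True
      have "bF ?f = (\<Sum>i\<in>A. if i = l then T l ?f else 0)"
        unfolding dec[OF prod_Dq] using zero True by (intro sum.cong) auto
      also have "\<dots> = T l ?f" using A l by simp
      also have "\<dots> = T l (\<lambda>z. (poly (Q l) z * cnj (poly (Q l) z)) * complex_monomial l (a l) (b l) z)"
        using True by (simp add: pU complex_monomial_def mult_ac)
      also have "\<dots> = poly (Q l) l * cnj (poly (Q l) l) * T l (complex_monomial l (a l) (b l))"
        by (rule ab(2)[OF l(1)]) (intro smooth_mult smooth_cnj sp)
      finally show ?thesis using True by simp
    next
      case False
      then have "bF ?f = 0"
        unfolding dec[OF prod_Dq] by (intro sum.neutral ballI zero) auto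
      then show ?thesis using False by simp
    qed
  qed
  obtain h where h: "bij_betw h {0..<card A} A"
    using ex_bij_betw_nat_finite[OF A] by blast
  have hA: "h i \<in> A" if "i < Suc N" for i
    using h that N by (auto simp: bij_betw_def)
  have hinj: "h i = h j \<longleftrightarrow> i = j" if "i < Suc N" "j < Suc N" for i j
    using h that N by (auto simp: bij_betw_def inj_on_def)
  have entry: "P_matrix F k k' = (1 / of_real pi) * bF (\<lambda>w. w ^ k * cnj (w ^ k'))" for k k'
    unfolding P_matrix_def
  proof (rule toeplitz_form_eq[OF bF F])
    have "(\<lambda>w. w ^ k * cnj w ^ k') \<in> subgaussian" by (intro subgaussian_mult subgaussian_power subgaussian_id subgaussian_cnj)
    then show "(\<lambda>w. w ^ k * cnj (w ^ k')) \<in> Dq q" by (simp add: subgaussian_Dq q)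
  qed
  \<comment> \<open>The combination of rows of the matrix that belongs to the polynomial $u$
    of the $i$-th point.\<close>
  define v where "v i = (\<Sum>k\<le>degree (?u (h i)). seq_scale (coeff (?u (h i)) k) (P_matrix F k))" for i
  have v_span: "v i \<in> vs.span (range (P_matrix F))" for i
    unfolding v_def by (intro vs.span_sum vs.span_scale vs.span_base) blast
  obtain c where c: "\<exists>i<Suc N. c i \<noteq> 0" "\<And>k. (\<Sum>i<Suc N. c i * v i k) = 0"
    using rank_dependence[OF P, of v] v_span by blast
  have dual: "(\<Sum>k'\<le>degree r. cnj (coeff r k') * v i k')
      = (1 / of_real pi) * bF (\<lambda>z. poly (?u (h i)) z * cnj (poly r z))" for i r
  proof -
    let ?p = "?u (h i)"
    let ?I = "{..degree ?p} \<times> {..degree r}"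
    obtain m' where H: "gauss_functional (q/2) m' bF" using Dq_dual_gauss_functional[OF bF, of "q/2"] q by auto
    have G: "(\<lambda>w. w ^ k * cnj (w ^ k')) \<in> gaussian (q/2)" for k k'
    proof -
      have "(\<lambda>w. w ^ k * cnj w ^ k') \<in> subgaussian" by (intro subgaussian_mult subgaussian_power subgaussian_id subgaussian_cnj)
      then show ?thesis using q by (simp add: subgaussian_gaussian)
    qed
    have cn: "cnj (poly r z) = (\<Sum>k'\<le>degree r. cnj (coeff r k') * cnj (z ^ k'))" for z
      by (simp add: poly_altdef)
    have "(\<lambda>z. poly ?p z * cnj (poly r z)) = (\<lambda>z. \<Sum>kk\<in>?I. (coeff ?p (fst kk) * cnj (coeff r (snd kk))) * (z ^ fst kk * cnj (z ^ snd kk)))"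
      unfolding cn poly_altdef[of ?p] sum_product sum.cartesian_product' fst_conv snd_conv
      by (intro ext sum.cong refl) (simp only: mult_ac)
    then have "bF (\<lambda>z. poly ?p z * cnj (poly r z)) =
        (\<Sum>kk\<in>?I. (coeff ?p (fst kk) * cnj (coeff r (snd kk))) * bF (\<lambda>z. z ^ fst kk * cnj (z ^ snd kk)))"
      using gauss_functional_lincomb[OF H, of ?I "\<lambda>kk z. z ^ fst kk * cnj (z ^ snd kk)"] G by simp
    also have "\<dots> = (\<Sum>k\<le>degree ?p. \<Sum>k'\<le>degree r.
        (coeff ?p k * cnj (coeff r k')) * bF (\<lambda>z. z ^ k * cnj (z ^ k')))"
      by (simp only: sum.cartesian_product' fst_conv snd_conv)
    finally have R: "bF (\<lambda>z. poly ?p z * cnj (poly r z)) = (\<Sum>k\<le>degree ?p. \<Sum>k'\<le>degree r.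
        (coeff ?p k * cnj (coeff r k')) * bF (\<lambda>z. z ^ k * cnj (z ^ k')))" .
    have "(\<Sum>k'\<le>degree r. cnj (coeff r k') * v i k') = (\<Sum>k'\<le>degree r. \<Sum>k\<le>degree ?p.
        (1 / of_real pi) * ((coeff ?p k * cnj (coeff r k')) * bF (\<lambda>z. z ^ k * cnj (z ^ k'))))"
      unfolding v_def sum_fun_apply seq_scale_def entry sum_distrib_left
      by (intro sum.cong refl) (simp only: mult_ac)
    also have "\<dots> = (1 / of_real pi) * bF (\<lambda>z. poly ?p z * cnj (poly r z))"
      unfolding R sum_distrib_left by (rule sum.swap)
    finally show ?thesis .
  qed
  obtain j where j: "j < Suc N" "c j \<noteq> 0" using c(1) by blast
  let ?r = "?v (h j)"
  have "0 = (\<Sum>k'\<le>degree ?r. cnj (coeff ?r k') * (\<Sum>i<Suc N. c i * v i k'))"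
    using c(2) by simp
  also have "\<dots> = (\<Sum>i<Suc N. c i * (\<Sum>k'\<le>degree ?r. cnj (coeff ?r k') * v i k'))"
    unfolding sum_distrib_left by (subst sum.swap) (simp add: mult_ac)
  also have "\<dots> = (\<Sum>i<Suc N. if i = j then c j * ((1 / of_real pi) * (poly (Q (h j)) (h j) * cnj (poly (Q (h j)) (h j)) * T (h j) (complex_monomial (h j) (a (h j)) (b (h j))))) else 0)"
    unfolding dual using pairing[OF hA hA] hinj j(1) by (intro sum.cong refl) auto
  also have "\<dots> = c j * ((1 / of_real pi) * (poly (Q (h j)) (h j) * cnj (poly (Q (h j)) (h j)) * T (h j) (complex_monomial (h j) (a (h j)) (b (h j)))))"
    using j(1) by simp
  finally have "c j * ((1 / of_real pi) * (poly (Q (h j)) (h j) * cnj (poly (Q (h j)) (h j)) * T (h j) (complex_monomial (h j) (a (h j)) (b (h j))))) = 0"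
    by simp
  moreover have "poly (Q (h j)) (h j) \<noteq> 0"
    unfolding pQ using A by (auto simp: prod_zero_iff)
  ultimately show False using j(2) ab(1)[OF hA[OF j(1)]] by simp
qed

lemma differential_operator_of_jet:
  assumes T: "jet_functional m l T"
  shows "\<exists>L. differential_operator L \<and> (\<forall>f. smooth f \<longrightarrow> T f = L (dirac l) f)"
proof -
  \<comment> \<open>The sign compensates the one in the definition of the distributional
    derivative.\<close>
  define L where "L = (\<lambda>(G::dist) f. \<Sum>\<alpha> | mi_order \<alpha> \<le> m. ((- 1) ^ mi_order \<alpha> * T (taylor_monomial l \<alpha>)) * dist_deriv \<alpha> G f)"
  have "differential_operator L"
    unfolding differential_operator_def L_def
    by (rule exI[of _ m], rule exI[of _ "\<lambda>\<alpha>. (- 1) ^ mi_order \<alpha> * T (taylor_monomial l \<alpha>)"]) simp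
  moreover have "T f = L (dirac l) f" if f: "smooth f" for f
  proof -
    have sgn: "((- 1) ^ k * t) * ((- 1) ^ k * x) = x * t" for k and t x :: complex
      by (simp add: power_add[symmetric] mult_ac flip: power_mult_distrib mult.assoc)
    show ?thesis
      unfolding jet_representation[OF T f] L_def dist_deriv_def dirac_def
      by (intro sum.cong refl) (simp only: sgn)
  qed
  ultimately show ?thesis by blast
qed

theorem theorem6p8:
  fixes q :: real and bF F :: dist and N :: nat
  assumes q: "q > 0"
    and bF: "bF \<in> Dq_dual q"
    and F: "F = dist_mult (\<lambda>z. of_real (exp ((norm z)\<^sup>2))) bF"
    and P: "finite_rank (P_matrix F) \<and> matrix_rank (P_matrix F) \<le> N"
    and K: "\<And>z :: nat \<Rightarrow> complex.
              finite_rank (K_matrix F z) \<and> matrix_rank (K_matrix F z) \<le> N"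
  shows "\<exists>N\<^sub>0 \<le> N. \<exists>z :: nat \<Rightarrow> complex. inj_on z {1..N\<^sub>0} \<and>
           (\<exists>L. (\<forall>j\<in>{1..N\<^sub>0}. differential_operator (L j)) \<and>
                (\<forall>\<psi>\<in>Dq q. bF \<psi> = (\<Sum>j=1..N\<^sub>0. L j (dirac (z j)) \<psi>))) \<and>
           (\<exists>M. (\<forall>j\<in>{1..N\<^sub>0}. differential_operator (M j)) \<and>
                (\<forall>\<phi>\<in>test_functions. F \<phi> = (\<Sum>j=1..N\<^sub>0. M j (dirac (z j)) \<phi>)))"
proof -
  obtain m where H: "gauss_functional (q/2) m bF" using Dq_dual_gauss_functional[OF bF, of "q/2"] q by auto
  have q2: "0 < q/2" using q by simp
  obtain p :: "complex poly" where p: "p \<noteq> 0" "\<And>s t. bF (\<lambda>w. poly p w * linexp s t w) = 0"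
    using annihilating_polynomial[OF H q2 minors_vanish[OF q bF F K]] by blast
  obtain d where d: "0 < d"
    and dec0: "\<And>f. compactly_supported f \<Longrightarrow> bF f = (\<Sum>l | poly p l = 0. local_part bF d l f)"
    and jet: "\<And>l. poly p l = 0 \<Longrightarrow> jet_functional m l (local_part bF d l)"
    using finite_support_decomposition[OF H q2 p] by blast
  let ?T = "local_part bF d"
  \<comment> \<open>Roots with a trivial local part are discarded, as the rank sees only the
    others.\<close>
  define A where "A = {l. poly p l = 0 \<and> (\<exists>f. smooth f \<and> ?T l f \<noteq> 0)}"
  have finR: "finite {l. poly p l = 0}" using poly_roots_finite[OF p(1)] .
  have finA: "finite A" using finR by (rule rev_finite_subset) (auto simp: A_def)
  have jetA: "jet_functional m l (?T l)" if "l \<in> A" for l using jet that by (auto simp: A_def)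
  have restrict: "(\<Sum>l | poly p l = 0. ?T l f) = (\<Sum>l\<in>A. ?T l f)" if "smooth f" for f
    by (rule sum.mono_neutral_right[OF finR]) (use that in \<open>auto simp: A_def\<close>)
  have decA: "bF f = (\<Sum>l\<in>A. ?T l f)" if "f \<in> Dq q" for f
    using dual_decomposition_extends[OF bF q finR d dec0 that] restrict[OF Dq_smooth[OF that]] by simp
  have card: "card A \<le> N"
    by (rule number_of_points_le_rank[OF q bF F P finA jetA _ decA]) (auto simp: A_def)
  obtain z where z: "bij_betw z {1..card A} A"
    using ex_bij_betw_nat_finite_1[OF finA] by blast
  have zA: "z j \<in> A" if "j \<in> {1..card A}" for j using z that by (auto simp: bij_betw_def)
  have reindex: "(\<Sum>l\<in>A. h l) = (\<Sum>j=1..card A. h (z j))" for h :: "complex \<Rightarrow> complex"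
    using sum.reindex_bij_betw[OF z, of h] by simp
  let ?e = "\<lambda>z::complex. complex_of_real (exp ((norm z)\<^sup>2))"
  have se: "smooth ?e"
  proof -
    have "smooth (\<lambda>z. exp (z * cnj z))" by (intro smooth_intros)
    moreover have "exp (z * cnj z) = ?e z" for z :: complex
      by (simp only: complex_norm_square[symmetric] exp_of_real)
    ultimately show ?thesis by simp
  qed
  have "\<exists>L. differential_operator L \<and> (\<forall>f. smooth f \<longrightarrow> ?T l f = L (dirac l) f)" if "l \<in> A" for l
    by (rule differential_operator_of_jet[OF jetA[OF that]])
  then obtain L where L: "\<And>l. l \<in> A \<Longrightarrow> differential_operator (L l)"
    "\<And>l f. l \<in> A \<Longrightarrow> smooth f \<Longrightarrow> ?T l f = L l (dirac l) f" by metis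
  have "\<exists>M. differential_operator M \<and> (\<forall>f. smooth f \<longrightarrow> ?T l (\<lambda>z. ?e z * f z) = M (dirac l) f)" if "l \<in> A" for l
    by (rule differential_operator_of_jet[OF jet_functional_mult[OF jetA[OF that] se]])
  then obtain M where M: "\<And>l. l \<in> A \<Longrightarrow> differential_operator (M l)"
    "\<And>l f. l \<in> A \<Longrightarrow> smooth f \<Longrightarrow> ?T l (\<lambda>z. ?e z * f z) = M l (dirac l) f" by metis
  show ?thesis
  proof (intro exI[of _ "card A"] exI[of _ z] conjI card)
    show "inj_on z {1..card A}" using z by (simp add: bij_betw_def)
    show "\<exists>L. (\<forall>j\<in>{1..card A}. differential_operator (L j)) \<and>
        (\<forall>\<psi>\<in>Dq q. bF \<psi> = (\<Sum>j=1..card A. L j (dirac (z j)) \<psi>))"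
    proof (intro exI[of _ "\<lambda>j. L (z j)"] conjI ballI)
      show "differential_operator (L (z j))" if "j \<in> {1..card A}" for j using L(1) zA that by blast
      fix \<psi> assume \<psi>: "\<psi> \<in> Dq q"
      show "bF \<psi> = (\<Sum>j=1..card A. L (z j) (dirac (z j)) \<psi>)"
        unfolding decA[OF \<psi>] reindex using L(2) zA Dq_smooth[OF \<psi>] by (intro sum.cong) auto
    qed
    show "\<exists>M. (\<forall>j\<in>{1..card A}. differential_operator (M j)) \<and>
        (\<forall>\<phi>\<in>test_functions. F \<phi> = (\<Sum>j=1..card A. M j (dirac (z j)) \<phi>))"
    proof (intro exI[of _ "\<lambda>j. M (z j)"] conjI ballI)
      show "differential_operator (M (z j))" if "j \<in> {1..card A}" for j using M(1) zA that by blast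
      fix \<phi> assume "\<phi> \<in> test_functions"
      then have \<phi>: "compactly_supported \<phi>" by (rule test_functions_compactly_supported)
      have c: "compactly_supported (\<lambda>z. ?e z * \<phi> z)" by (rule compactly_supported_mult[OF se \<phi>])
      have "F \<phi> = bF (\<lambda>z. ?e z * \<phi> z)" by (simp add: F dist_mult_def)
      also have "\<dots> = (\<Sum>j=1..card A. ?T (z j) (\<lambda>z. ?e z * \<phi> z))"
        unfolding decA[OF subgaussian_Dq[OF compactly_supported_subgaussian[OF c] q]] reindex ..
      also have "\<dots> = (\<Sum>j=1..card A. M (z j) (dirac (z j)) \<phi>)"
        using M(2) zA compactly_supported_smooth[OF \<phi>] by (intro sum.cong) auto
      finally show "F \<phi> = (\<Sum>j=1..card A. M (z j) (dirac (z j)) \<phi>)" .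
    qed
  qed
qed

end
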